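(* Let $d\geq 2$ and let $n_1,\dots,n_d\geq 1$ be fixed integers. Let $c=\{c(i,j): i,j=1,\dots,d\}$ be a positive definite symmetric matrix, and let $(s_1,\dots,s_d)$ be a semicircular family with covariance $c$. For each $i=1,\dots,d$, let $(f_k^{(i)})_{k\in\mathbb{N}}$ be a sequence of mirror symmetric functions in $L^2(\mathbb{R}_+^{n_i})$ such that, for all $i,j=1,\dots,d$, $$\lim_{k\to\infty}\varphi\big[I^S(f_k^{(i)})\,I^S(f_k^{(j)})\big]=c(i,j).$$ Then the following three statements are equivalent as $k\to\infty$: (1) The vector $\big(I^S(f_k^{(1)}),\dots,I^S(f_k^{(d)})\big)$ converges in distribution to $(s_1,\dots,s_d)$. (2) For each $i=1,\dots,d$, the random variable $I^S(f_k^{(i)})$ converges in distribution to $s_i$. (3) For each $i=1,\dots,d$, $$\lim_{k\to\infty}\varphi\big[I^S(f_k^{(i)})^4\big]=2\,c(i,i)^2.$$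
   Context: Setting: $(\mathscr{A},\varphi)$ is a tracial $W^*$-probability space, i.e. $\mathscr{A}$ is a von Neumann algebra and $\varphi:\mathscr{A}\to\mathbb{C}$ is a weakly continuous, positive, faithful, tracial state ($\varphi(1)=1$, $\varphi(XY)=\varphi(YX)$). Self-adjoint elements of $\mathscr{A}$ are called random variables. The law of a random variable $X$ is the unique Borel measure on $\mathbb{R}$ with the same moments as $X$. Freeness: unital subalgebras $\mathscr{A}_1,\dots,\mathscr{A}_n$ of $\mathscr{A}$ are free if $\varphi(X_1\cdots X_m)=0$ whenever each $X_j$ belongs to one of the $\mathscr{A}_i$'s, consecutive $X_j,X_{j+1}$ come from different $\mathscr{A}_i$'s, and $\varphi(X_j)=0$ for every $j$. Random variables are free if the unital algebras they generate are free. Semicircular distribution: $S(0,t)(dx)=\frac{1}{2\pi t}\sqrt{4t-x^2}\,dx$ on $|x|\le 2\sqrt t$ (variance $t$, fourth moment $2t^2$). Free Brownian motion: it is assumed that $(\mathscr{A},\varphi)$ carries a free Brownian motion $S=\{S_t:t\ge 0\}$, that is, an increasing family $\{\mathscr{A}_t:t\ge0\}$ of von Neumann subalgebras of $\mathscr{A}$ and self-adjoint $S_t\in\mathscr{A}_t$ with $S_0=0$ such that $S_t$ has law $S(0,t)$ and, for $0\le u<t$, the increment $S_t-S_u$ is free from $\mathscr{A}_u$ and has law $S(0,t-u)$. Multiple Wigner integrals: for $n\ge1$ and $f\in L^2(\mathbb{R}_+^n)=L^2(\mathbb{R}_+^n;\mathbb{C})$, the operator $I^S(f)$ is defined as follows.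 If $f(t_1,\dots,t_n)=\mathbf{1}_{(a_1,b_1)}(t_1)\cdots\mathbf{1}_{(a_n,b_n)}(t_n)$ with pairwise disjoint intervals $(a_i,b_i)$, set $I^S(f)=(S_{b_1}-S_{a_1})\cdots(S_{b_n}-S_{a_n})$. Extend linearly to finite linear combinations of such functions, and then to all of $L^2(\mathbb{R}_+^n)$ by density, using the isometry $\varphi[I^S(g)^*I^S(f)]=\int_{\mathbb{R}_+^n} f\,\overline{g}$. Mirror symmetry: $f\in L^2(\mathbb{R}_+^n)$ is mirror symmetric if $f(t_1,\dots,t_n)=\overline{f(t_n,\dots,t_1)}$ for almost all $t_1,\dots,t_n\ge0$. The operator $I^S(f)$ is self-adjoint if and only if $f$ is mirror symmetric. Semicircular family: a partition of $[n]=\{1,\dots,n\}$ is a pairing if all its blocks have two elements; it is non-crossing if there are no distinct blocks $B_1,B_2$ and $x_1,y_1\in B_1$, $x_2,y_2\in B_2$ with $x_1<x_2<y_1<y_2$. $NC_2(n)$ is the set of non-crossing pairings of $[n]$. A vector $(s_1,\dots,s_d)$ of random variables in $\mathscr{A}$ is a semicircular family with covariance $c$ if for every $n\ge1$ and every $(i_1,\dots,i_n)\in[d]^n$, $$\varphi(s_{i_1}s_{i_2}\cdots s_{i_n})=\sum_{\pi\in NC_2(n)}\prod_{\{a,b\}\in\pi}c(i_a,i_b).$$ In particular $s_i$ has law $S(0,c(i,i))$. Convergence in distribution: a sequence of vectors $(X_k^{(1)},\dots,X_k^{(d)})$ of random variables converges in distribution to $(s_1,\dots,s_d)$ if $\varphi(X_k^{(i_1)}\cdots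 X_k^{(i_r)})\to\varphi(s_{i_1}\cdots s_{i_r})$ as $k\to\infty$ for all $r\ge1$ and all $(i_1,\dots,i_r)\in[d]^r$; for a single variable this is convergence of all moments. *)

theory Defs
  imports "HOL-Analysis.Analysis" "HOL-Library.Disjoint_Sets"
begin

section \<open>Complex Hilbert spaces and bounded operators\<close>

text \<open>The inner product is linear in the first argument. Completeness comes from \<^class>\<open>banach\<close>;
  positivity and definiteness of the inner product follow from the last axiom.\<close>

class complex_hilbert_space = banach +
  fixes scaleC :: "complex \<Rightarrow> 'a \<Rightarrow> 'a"  (infixr \<open>*\<^sub>C\<close> 75)
    and cinner :: "'a \<Rightarrow> 'a \<Rightarrow> complex"
  assumes scaleC_add_right: "c *\<^sub>C (x + y) = c *\<^sub>C x + c *\<^sub>C y"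
    and scaleC_add_left: "(b + c) *\<^sub>C x = b *\<^sub>C x + c *\<^sub>C x"
    and scaleC_scaleC: "b *\<^sub>C c *\<^sub>C x = (b * c) *\<^sub>C x"
    and scaleR_eq_scaleC: "r *\<^sub>R x = complex_of_real r *\<^sub>C x"
    and cinner_commute: "cinner x y = cnj (cinner y x)"
    and cinner_add_left: "cinner (x + y) z = cinner x z + cinner y z"
    and cinner_scaleC_left: "cinner (c *\<^sub>C x) y = c * cinner x y"
    and norm_eq_sqrt_cinner: "norm x = sqrt (Re (cinner x x))"

text \<open>The library type of bounded operators consists of real-linear maps;
  \<open>BH\<close> is the set of those that are complex-linear.\<close>

type_synonym 'h op = "'h \<Rightarrow>\<^sub>L 'h"

definition BH :: "'h::complex_hilbert_space op set" where
  "BH = {T :: 'h op. \<forall>c x. T (c *\<^sub>C x) = c *\<^sub>C T x}"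

definition scale_op :: "complex \<Rightarrow> 'h::complex_hilbert_space op \<Rightarrow> 'h op" where
  "scale_op c T = Blinfun (\<lambda>x. c *\<^sub>C T x)"

definition adj :: "'h::complex_hilbert_space op \<Rightarrow> 'h op" where
  "adj T = (THE T' :: 'h op. \<forall>x y. cinner (T x) y = cinner x (T' y))"

definition op_prod :: "'h::complex_hilbert_space op list \<Rightarrow> 'h op" where
  "op_prod Ts = foldr (o\<^sub>L) Ts id_blinfun"

definition op_pow :: "'h::complex_hilbert_space op \<Rightarrow> nat \<Rightarrow> 'h op" where
  "op_pow T m = op_prod (replicate m T)"

lemma norm_scaleC: "norm (c *\<^sub>C (x::'h::complex_hilbert_space)) = cmod c * norm x"
proof -
  have "cinner (c *\<^sub>C x) (c *\<^sub>C x) = c * cnj c * cinner x x"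
    by (metis cinner_commute cinner_scaleC_left complex_cnj_mult mult.assoc)
  then have "Re (cinner (c *\<^sub>C x) (c *\<^sub>C x)) = (cmod c)\<^sup>2 * Re (cinner x x)"
    by (simp flip: complex_norm_square of_real_power)
  then show ?thesis
    by (simp add: norm_eq_sqrt_cinner real_sqrt_mult)
qed

lemma bounded_linear_scaleC: "bounded_linear (\<lambda>x::'h::complex_hilbert_space. c *\<^sub>C x)"
  by (rule bounded_linear_intro[where K = "cmod c"])
    (simp_all add: scaleC_add_right scaleR_eq_scaleC scaleC_scaleC norm_scaleC mult.commute)

lemma scale_op_apply: "scale_op c T x = c *\<^sub>C T x"
  unfolding scale_op_def
  by (simp add: bounded_linear_Blinfun_apply
      bounded_linear_compose[OF bounded_linear_scaleC blinfun.bounded_linear_right])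


section \<open>Tracial W*-probability spaces\<close>

definition weak_operator_topology :: "'h::complex_hilbert_space op topology" where
  "weak_operator_topology =
     topology_generated_by {{T \<in> BH. cinner (T x) y \<in> U} | x y U. open U}"

definition sigma_weak_topology :: "'h::complex_hilbert_space op topology" where
  "sigma_weak_topology =
     topology_generated_by
       {{T \<in> BH. (\<Sum>n. cinner (T (\<xi> n)) (\<eta> n)) \<in> U} | \<xi> \<eta> U.
          summable (\<lambda>n::nat. (norm (\<xi> n))\<^sup>2) \<and> summable (\<lambda>n. (norm (\<eta> n))\<^sup>2) \<and> open U}"

definition unital_subalgebra :: "'h::complex_hilbert_space op set \<Rightarrow> bool" where
  "unital_subalgebra B \<longleftrightarrow>
     B \<subseteq> BH \<and> id_blinfun \<in> B \<and>
     (\<forall>X\<in>B. \<forall>Y\<in>B. X + Y \<in> B \<and> X o\<^sub>L Y \<in> B) \<and>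
     (\<forall>c. \<forall>X\<in>B. scale_op c X \<in> B)"

definition von_neumann_algebra :: "'h::complex_hilbert_space op set \<Rightarrow> bool" where
  "von_neumann_algebra A \<longleftrightarrow>
     unital_subalgebra A \<and> (\<forall>X\<in>A. adj X \<in> A) \<and> closedin weak_operator_topology A"

text \<open>Weak continuity of the state is understood on \<open>A\<close> with its ultraweak (sigma-weak,
  i.e. weak-*) topology. Values of \<open>\<phi>\<close> outside \<open>A\<close> are irrelevant.\<close>

locale tracial_W_prob_space =
  fixes A :: "'h::complex_hilbert_space op set" and \<phi> :: "'h op \<Rightarrow> complex"
  assumes von_neumann: "von_neumann_algebra A"
    and state_add: "\<lbrakk>X \<in> A; Y \<in> A\<rbrakk> \<Longrightarrow> \<phi> (X + Y) = \<phi> X + \<phi> Y"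
    and state_scale: "X \<in> A \<Longrightarrow> \<phi> (scale_op c X) = c * \<phi> X"
    and state_unital: "\<phi> id_blinfun = 1"
    and state_positive: "X \<in> A \<Longrightarrow> \<phi> (adj X o\<^sub>L X) \<in> \<real>\<^sub>\<ge>\<^sub>0"
    and state_faithful: "\<lbrakk>X \<in> A; \<phi> (adj X o\<^sub>L X) = 0\<rbrakk> \<Longrightarrow> X = 0"
    and state_tracial: "\<lbrakk>X \<in> A; Y \<in> A\<rbrakk> \<Longrightarrow> \<phi> (X o\<^sub>L Y) = \<phi> (Y o\<^sub>L X)"
    and state_weakly_continuous: "continuous_map (subtopology sigma_weak_topology A) euclidean \<phi>"

definition random_variable :: "'h::complex_hilbert_space op set \<Rightarrow> 'h op \<Rightarrow> bool" where
  "random_variable A X \<longleftrightarrow> X \<in> A \<and> adj X = X"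

definition has_law :: "('h::complex_hilbert_space op \<Rightarrow> complex) \<Rightarrow> 'h op \<Rightarrow> real measure \<Rightarrow> bool" where
  "has_law \<phi> X \<mu> \<longleftrightarrow>
     sets \<mu> = sets borel \<and>
     (\<forall>m::nat. integrable \<mu> (\<lambda>x. x ^ m) \<and> \<phi> (op_pow X m) = complex_of_real (\<integral>x. x ^ m \<partial>\<mu>))"


section \<open>Freeness\<close>

text \<open>In a word \<open>X\<^sub>1 \<dots> X\<^sub>m\<close> each letter is paired with the index of the subalgebra it is taken from.\<close>

definition free_subalgebras ::
  "('h::complex_hilbert_space op \<Rightarrow> complex) \<Rightarrow> 'i set \<Rightarrow> ('i \<Rightarrow> 'h op set) \<Rightarrow> bool" where
  "free_subalgebras \<phi> I B \<longleftrightarrow>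
     (\<forall>w. w \<noteq> [] \<longrightarrow> distinct_adj (map fst w) \<longrightarrow>
          (\<forall>(i, X)\<in>set w. i \<in> I \<and> X \<in> B i \<and> \<phi> X = 0) \<longrightarrow>
          \<phi> (op_prod (map snd w)) = 0)"

definition generated_algebra :: "'h::complex_hilbert_space op set \<Rightarrow> 'h op set" where
  "generated_algebra G = unital_subalgebra hull G"

definition free_from ::
  "('h::complex_hilbert_space op \<Rightarrow> complex) \<Rightarrow> 'h op \<Rightarrow> 'h op set \<Rightarrow> bool" where
  "free_from \<phi> X B \<longleftrightarrow>
     free_subalgebras \<phi> UNIV (\<lambda>b::bool. if b then generated_algebra {X} else B)"


section \<open>Free Brownian motion\<close>

text \<open>The semicircular law \<open>S(0,t)\<close>, meaningful for \<open>t > 0\<close> only.\<close>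

definition semicircular :: "real \<Rightarrow> real measure" where
  "semicircular t = density lborel
     (\<lambda>x. ennreal (indicator {x. \<bar>x\<bar> \<le> 2 * sqrt t} x * (sqrt (4 * t - x\<^sup>2) / (2 * pi * t))))"

locale free_brownian_motion = tracial_W_prob_space A \<phi>
  for A :: "'h::complex_hilbert_space op set" and \<phi> +
  fixes \<A> :: "real \<Rightarrow> 'h op set" and S :: "real \<Rightarrow> 'h op"
  assumes filtration_von_neumann: "0 \<le> t \<Longrightarrow> von_neumann_algebra (\<A> t)"
    and filtration_subset: "0 \<le> t \<Longrightarrow> \<A> t \<subseteq> A"
    and filtration_mono: "\<lbrakk>0 \<le> u; u \<le> t\<rbrakk> \<Longrightarrow> \<A> u \<subseteq> \<A> t"
    and adapted: "0 \<le> t \<Longrightarrow> S t \<in> \<A> t"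
    and self_adjoint: "0 \<le> t \<Longrightarrow> adj (S t) = S t"
    and initial: "S 0 = 0"
    and law: "0 < t \<Longrightarrow> has_law \<phi> (S t) (semicircular t)"
    and increment_free: "\<lbrakk>0 \<le> u; u < t\<rbrakk> \<Longrightarrow> free_from \<phi> (S t - S u) (\<A> u)"
    and increment_law: "\<lbrakk>0 \<le> u; u < t\<rbrakk> \<Longrightarrow> has_law \<phi> (S t - S u) (semicircular (t - u))"


section \<open>Multiple Wigner integrals\<close>

definition Rplus :: "nat \<Rightarrow> (nat \<Rightarrow> real) measure" where
  "Rplus n = (\<Pi>\<^sub>M i\<in>{1..n}. restrict_space lborel {0..})"

definition L2 :: "nat \<Rightarrow> ((nat \<Rightarrow> real) \<Rightarrow> complex) set" where
  "L2 n = {f \<in> borel_measurable (Rplus n). integrable (Rplus n) (\<lambda>t. (cmod (f t))\<^sup>2)}"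

definition mirror_symmetric :: "nat \<Rightarrow> ((nat \<Rightarrow> real) \<Rightarrow> complex) \<Rightarrow> bool" where
  "mirror_symmetric n f \<longleftrightarrow>
     (AE t in Rplus n. f t = cnj (f (\<lambda>i\<in>{1..n}. t (n + 1 - i))))"

text \<open>A formal linear combination of indicators of boxes
  \<open>(a\<^sub>1,b\<^sub>1) \<times> \<dots> \<times> (a\<^sub>n,b\<^sub>n)\<close> is a list of triples \<open>(c, a, b)\<close>, with \<open>c\<close> the coefficient.\<close>

type_synonym boxes = "(complex \<times> (nat \<Rightarrow> real) \<times> (nat \<Rightarrow> real)) list"

definition off_diagonal :: "nat \<Rightarrow> boxes \<Rightarrow> bool" where
  "off_diagonal n ts \<longleftrightarrow>
     (\<forall>(c, a, b)\<in>set ts. (\<forall>i\<in>{1..n}. 0 \<le> a i \<and> a i < b i) \<and>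
        disjoint_family_on (\<lambda>i. {a i<..<b i}) {1..n})"

definition box_fun :: "nat \<Rightarrow> boxes \<Rightarrow> (nat \<Rightarrow> real) \<Rightarrow> complex" where
  "box_fun n ts t = (\<Sum>(c, a, b)\<leftarrow>ts. c * (\<Prod>i=1..n. indicator {a i<..<b i} (t i)))"

definition box_integral ::
  "(real \<Rightarrow> 'h::complex_hilbert_space op) \<Rightarrow> nat \<Rightarrow> boxes \<Rightarrow> 'h op" where
  "box_integral S n ts =
     (\<Sum>(c, a, b)\<leftarrow>ts. scale_op c (op_prod (map (\<lambda>i. S (b i) - S (a i)) [1..<n + 1])))"

text \<open>Extension by density: the integral of \<open>f\<close> is the element of \<open>A\<close> that is the limit in
  \<open>L\<^sup>2(A, \<phi>)\<close> of the integrals of simple functions tending to \<open>f\<close> in \<open>L\<^sup>2\<close>. The isometry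
  property and faithfulness make it independent of the representation of the simple functions
  and of the approximating sequence; that the limit lies in \<open>A\<close> itself is the Haagerup
  inequality of Biane and Speicher.\<close>

definition wigner_integral ::
  "'h::complex_hilbert_space op set \<Rightarrow> ('h op \<Rightarrow> complex) \<Rightarrow> (real \<Rightarrow> 'h op) \<Rightarrow> nat \<Rightarrow>
   ((nat \<Rightarrow> real) \<Rightarrow> complex) \<Rightarrow> 'h op" where
  "wigner_integral A \<phi> S n f =
     (THE X. X \<in> A \<and>
        (\<exists>ts. (\<forall>k. off_diagonal n (ts k)) \<and>
           (\<lambda>k. \<integral>t. (cmod (f t - box_fun n (ts k) t))\<^sup>2 \<partial>Rplus n) \<longlonglongrightarrow> 0 \<and>
           (\<lambda>k. \<phi> (adj (X - box_integral S n (ts k)) o\<^sub>L (X - box_integral S n (ts k))))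
              \<longlonglongrightarrow> 0))"


section \<open>Semicircular families and convergence in distribution\<close>

definition NC2 :: "nat \<Rightarrow> nat set set set" where
  "NC2 n = {\<pi>. partition_on {1..n} \<pi> \<and> (\<forall>B\<in>\<pi>. card B = 2) \<and>
     \<not> (\<exists>B1\<in>\<pi>. \<exists>B2\<in>\<pi>. B1 \<noteq> B2 \<and>
          (\<exists>x1\<in>B1. \<exists>y1\<in>B1. \<exists>x2\<in>B2. \<exists>y2\<in>B2. x1 < x2 \<and> x2 < y1 \<and> y1 < y2))}"

definition symmetric_posdef :: "nat \<Rightarrow> (nat \<Rightarrow> nat \<Rightarrow> real) \<Rightarrow> bool" where
  "symmetric_posdef d c \<longleftrightarrow>
     (\<forall>i\<in>{1..d}. \<forall>j\<in>{1..d}. c i j = c j i) \<and>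
     (\<forall>x::nat \<Rightarrow> real. (\<exists>i\<in>{1..d}. x i \<noteq> 0) \<longrightarrow> 0 < (\<Sum>i=1..d. \<Sum>j=1..d. x i * c i j * x j))"

text \<open>The word \<open>(i\<^sub>1, \<dots>, i\<^sub>n)\<close> is a list, whose \<open>a\<close>-th letter is \<open>w ! (a - 1)\<close>.\<close>

definition semicircular_family ::
  "'h::complex_hilbert_space op set \<Rightarrow> ('h op \<Rightarrow> complex) \<Rightarrow> nat \<Rightarrow> (nat \<Rightarrow> nat \<Rightarrow> real) \<Rightarrow>
   (nat \<Rightarrow> 'h op) \<Rightarrow> bool" where
  "semicircular_family A \<phi> d c s \<longleftrightarrow>
     (\<forall>i\<in>{1..d}. random_variable A (s i)) \<and>
     (\<forall>w. w \<noteq> [] \<and> set w \<subseteq> {1..d} \<longrightarrow>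
        \<phi> (op_prod (map s w)) =
          (\<Sum>\<pi>\<in>NC2 (length w).
             \<Prod>B\<in>\<pi>. complex_of_real (c (w ! (Min B - 1)) (w ! (Max B - 1)))))"

definition converges_in_distribution ::
  "('h::complex_hilbert_space op \<Rightarrow> complex) \<Rightarrow> (nat \<Rightarrow> 'h op) \<Rightarrow> 'h op \<Rightarrow> bool" where
  "converges_in_distribution \<phi> X s \<longleftrightarrow>
     (\<forall>r\<ge>1. (\<lambda>k. \<phi> (op_pow (X k) r)) \<longlonglongrightarrow> \<phi> (op_pow s r))"

definition jointly_converges_in_distribution ::
  "('h::complex_hilbert_space op \<Rightarrow> complex) \<Rightarrow> nat \<Rightarrow> (nat \<Rightarrow> nat \<Rightarrow> 'h op) \<Rightarrow>
   (nat \<Rightarrow> 'h op) \<Rightarrow> bool" where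
  "jointly_converges_in_distribution \<phi> d X s \<longleftrightarrow>
     (\<forall>w. w \<noteq> [] \<and> set w \<subseteq> {1..d} \<longrightarrow>
        (\<lambda>k. \<phi> (op_prod (map (\<lambda>i. X k i) w))) \<longlonglongrightarrow> \<phi> (op_prod (map s w)))"

end

theory Submission
  imports Defs
begin

text \<open>Step functions supported off the diagonals are dense in \<open>L\<^sup>2\<close>, and on a grid of time points their
  Wigner integrals are finite sums of Wick words in free standard semicircular elements, the
  normalised increments. Wick words are orthonormal and multiply by contracting neighbouring letters.
  The product formula bounds \<open>I(f)\<close> on \<open>L\<^sup>2(A, \<phi>)\<close> by a multiple of the norm of \<open>f\<close>; since the
  state is faithful, this is a bound on the operator norm, so \<open>I(f)\<close> exists as a norm limit and
  everything can be computed on grids. There the fourth moment of \<open>I(f)\<close> exceeds its semicircular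
  value by the sum of the squared norms of the proper contractions of \<open>f\<close> with itself, and these
  dominate the mixed contractions of two kernels. Hence condition (3) makes all proper contractions
  vanish in the limit: each \<open>I(f\<^sub>i)\<close> acts on a tensor product of kernels by adding a factor on the
  left or by pairing with the first factor, as a field operator on a full Fock space. The resulting
  moments are the sums over non-crossing pairings.\<close>

section \<open>Operators on complex Hilbert spaces\<close>

text \<open>Nothing ties \<phi> to a vector of the Hilbert space, so L^2(A, \<phi>) need not be the
  space on which the operators act, and estimates in it do not bound operator norms by themselves.
  Boundedness cannot be skipped: \<open>wigner_integral\<close> is a definite description of an
  element of the algebra, so its value is known only once a limit has been found there; and in the
  limit theorem a small 2-norm error stands behind a product of other integrals, which only a
  uniform norm bound keeps under control.

  The estimates on a grid are free of the grid: the number of cells never enters, only the orders of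
  the integrals. Each index k may therefore use a grid of its own.

  The fourth moment formula is for kernels that are exactly mirror symmetric, so the approximating
  step functions are symmetrised. Of the contractions of orders 0 to n, the orders 0 and n each give
  the square of the variance; this is the 2 in condition (3). The other terms are non-negative, so
  they vanish one by one in the limit. Between integrals of different orders no contraction exhausts
  both kernels, and the covariance is 0.\<close>

lemma cinner_add_right: "cinner (x::'h::complex_hilbert_space) (y + z) = cinner x y + cinner x z"
  by (metis cinner_add_left cinner_commute complex_cnj_add)

lemma cinner_scaleC_right: "cinner (x::'h::complex_hilbert_space) (c *\<^sub>C y) = cnj c * cinner x y"
  by (metis cinner_commute cinner_scaleC_left complex_cnj_mult)

lemma minus_eq_scaleC: "- (x::'h::complex_hilbert_space) = (-1) *\<^sub>C x"
  using scaleR_eq_scaleC[of "-1" x] by simp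

lemma cinner_minus_left: "cinner (- x) (y::'h::complex_hilbert_space) = - cinner x y"
  by (simp add: minus_eq_scaleC cinner_scaleC_left)

lemma cinner_minus_right: "cinner x (- y::'h::complex_hilbert_space) = - cinner x y"
  by (simp add: minus_eq_scaleC cinner_scaleC_right)

lemma cinner_diff_left: "cinner (x - z) (y::'h::complex_hilbert_space) = cinner x y - cinner z y"
  by (metis cinner_add_left cinner_minus_left add_uminus_conv_diff)

lemma cinner_diff_right: "cinner y (x - z::'h::complex_hilbert_space) = cinner y x - cinner y z"
  by (metis cinner_add_right cinner_minus_right add_uminus_conv_diff)

lemma cinner_zero_left [simp]: "cinner 0 (y::'h::complex_hilbert_space) = 0"
  using cinner_add_left[of 0 0 y] by simp

lemma cinner_zero_right [simp]: "cinner (y::'h::complex_hilbert_space) 0 = 0"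
  using cinner_add_right[of y 0 0] by simp

lemma cinner_scaleR_left: "cinner (r *\<^sub>R x) (y::'h::complex_hilbert_space) = r * cinner x y"
  by (simp add: scaleR_eq_scaleC cinner_scaleC_left)

lemma cinner_scaleR_right: "cinner x (r *\<^sub>R y::'h::complex_hilbert_space) = r * cinner x y"
  by (simp add: scaleR_eq_scaleC cinner_scaleC_right)

lemma Re_cinner_commute: "Re (cinner x (y::'h::complex_hilbert_space)) = Re (cinner y x)"
  by (metis cinner_commute cnj.sel(1))

lemma Re_cinner_self: "Re (cinner x (x::'h::complex_hilbert_space)) = (norm x)\<^sup>2"
proof -
  have "0 \<le> sqrt (Re (cinner x x))"
    by (metis norm_eq_sqrt_cinner norm_ge_zero)
  then show ?thesis
    by (simp add: norm_eq_sqrt_cinner)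
qed

lemma cinner_self: "cinner x (x::'h::complex_hilbert_space) = complex_of_real ((norm x)\<^sup>2)"
proof -
  have "Im (cinner x x) = 0"
    using cinner_commute[of x x] by (metis Reals_cnj_iff complex_is_Real_iff)
  then show ?thesis
    by (simp add: complex_eq_iff Re_cinner_self)
qed

lemma norm_add_square:
  "(norm (x + y::'h::complex_hilbert_space))\<^sup>2 = (norm x)\<^sup>2 + 2 * Re (cinner x y) + (norm y)\<^sup>2"
  unfolding Re_cinner_self[symmetric]
  by (simp add: cinner_add_left cinner_add_right Re_cinner_commute[of y x])

text \<open>The first-order condition at a minimum, in the form in which the Riesz representation
  uses it: near t = 0 the linear term dominates and would change sign.\<close>

lemma quadratic_nonneg_imp_linear_zero:
  fixes a b :: real
  assumes "\<And>t. 0 \<le> t\<^sup>2 * a + 2 * t * b"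
  shows "b = 0"
proof (rule ccontr)
  assume "b \<noteq> 0"
  define s where "s = \<bar>a\<bar> + 1"
  have s: "s > 0" "a < s" by (auto simp: s_def)
  have "0 \<le> (- b / s)\<^sup>2 * a + 2 * (- b / s) * b" by (rule assms)
  also have "\<dots> = b\<^sup>2 / s\<^sup>2 * (a - 2 * s)"
    using s by (simp add: field_simps power2_eq_square)
  also have "\<dots> < 0"
    using s \<open>b \<noteq> 0\<close> by (intro mult_pos_neg) auto
  finally show False by simp
qed

text \<open>The triangle inequality belongs to the class, and squaring it bounds the real part of
  the inner product. Multiplying \<open>x\<close> by \<open>cnj c\<close> makes the inner product
  real and equal to the square of its modulus.\<close>

lemma cinner_Cauchy_Schwarz: "cmod (cinner x (y::'h::complex_hilbert_space)) \<le> norm x * norm y"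
proof -
  define c where "c = cinner x y"
  have Re: "Re (cinner u v) \<le> norm u * norm v" for u v :: 'h
  proof -
    have "(norm (u + v))\<^sup>2 \<le> (norm u + norm v)\<^sup>2"
      by (intro power_mono norm_triangle_ineq) auto
    then show ?thesis
      by (simp add: norm_add_square power2_sum)
  qed
  show ?thesis
  proof (cases "c = 0")
    case False
    have "Re (cinner (cnj c *\<^sub>C x) y) = (cmod c)\<^sup>2"
      by (simp add: cinner_scaleC_left flip: c_def)
        (metis cmod_power2 power2_eq_square)
    then have "cmod c * cmod c \<le> cmod c * norm x * norm y"
      using Re[of "cnj c *\<^sub>C x" y] by (simp add: norm_scaleC power2_eq_square)
    then show ?thesis
      using False by (simp add: c_def mult.assoc)
  qed (simp add: c_def)
qed

lemma bounded_bilinear_cinner: "bounded_bilinear (\<lambda>x y::'h::complex_hilbert_space. cinner x y)"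
  by (rule bounded_bilinear.intro)
    (auto simp: cinner_add_left cinner_add_right cinner_scaleR_left cinner_scaleR_right scaleR_conv_of_real
      intro!: exI[of _ 1] cinner_Cauchy_Schwarz)

lemmas tendsto_cinner = bounded_bilinear.tendsto[OF bounded_bilinear_cinner]

lemma cinner_eqI:
  assumes "\<And>x. cinner x y = cinner x (z::'h::complex_hilbert_space)"
  shows "y = z"
proof -
  have "cinner (y - z) (y - z) = 0"
    using assms[of "y - z"] by (simp add: cinner_diff_right)
  then show ?thesis
    by (simp add: cinner_self)
qed

text \<open>The representing vector is the minimiser of the functional \<open>J\<close>, bounded
  below by - K^2. The parallelogram law makes a minimising sequence Cauchy, completeness gives the
  minimiser, and its first variation is the representation of the real part of \<open>g\<close>; the
  vector \<i> x supplies the imaginary part.\<close>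

lemma Riesz_representation:
  fixes g :: "'h::complex_hilbert_space \<Rightarrow> complex"
  assumes add: "\<And>x y. g (x + y) = g x + g y"
    and scale: "\<And>c x. g (c *\<^sub>C x) = c * g x"
    and bound: "\<And>x. cmod (g x) \<le> K * norm x"
  shows "\<exists>z. \<forall>x. g x = cinner x z"
proof -
  have scaleR: "g (r *\<^sub>R x) = r * g x" for r x
    by (simp add: scaleR_eq_scaleC scale)
  have bl: "bounded_linear g"
    by (rule bounded_linear_intro[where K = K])
      (auto simp: add scaleR scaleR_conv_of_real mult.commute bound)
  define J where "J z = (norm z)\<^sup>2 - 2 * Re (g z)" for z
  have J_ge: "- K\<^sup>2 \<le> J z" for z
  proof -
    have "Re (g z) \<le> K * norm z"
      using bound[of z] complex_Re_le_cmod[of "g z"] by linarith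
    moreover have "0 \<le> (norm z - K)\<^sup>2" by simp
    ultimately show ?thesis
      by (simp add: J_def power2_diff mult.commute)
  qed
  define m where "m = Inf (range J)"
  have bdd: "bdd_below (range J)"
    using J_ge by (auto intro!: bdd_belowI[of _ "- K\<^sup>2"])
  have m_le: "m \<le> J z" for z
    unfolding m_def by (rule cInf_lower) (auto simp: bdd)
  have "\<exists>z. J z < m + 1 / real (Suc n)" for n
  proof -
    have "m < m + 1 / real (Suc n)" by simp
    then show ?thesis
      unfolding m_def using cInf_lessD[of "range J"] by auto
  qed
  then obtain z where z: "\<And>n. J (z n) < m + 1 / real (Suc n)"
    by metis
  \<comment> \<open>The parallelogram law, with the value of \<open>J\<close> at the midpoint
    bounded below by the infimum.\<close>
  have par: "(norm (u - v))\<^sup>2 \<le> 2 * (J u - m) + 2 * (J v - m)" for u v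
  proof -
    have "m \<le> J ((1/2) *\<^sub>R (u + v))" by (rule m_le)
    also have "\<dots> = (norm (u + v))\<^sup>2 / 4 - Re (g u) - Re (g v)"
    proof -
      have half: "norm ((1/2) *\<^sub>R (u + v)) = norm (u + v) / 2" by simp
      show ?thesis
        unfolding J_def scaleR add half by (simp add: power_divide add_divide_distrib)
    qed
    finally show ?thesis
      using norm_add_square[of u v] norm_add_square[of u "- v"]
      unfolding J_def by (simp add: cinner_minus_right add_divide_distrib)
  qed
  have Cauchy: "Cauchy z"
  proof (rule metric_CauchyI)
    fix e :: real assume "0 < e"
    then obtain M :: nat where M: "real M > 4 / e\<^sup>2" "M > 0"
      by (metis gr0I of_nat_0 reals_Archimedean2 divide_pos_pos less_asym zero_less_numeral zero_less_power)
    have "dist (z i) (z j) < e" if "i \<ge> M" "j \<ge> M" for i j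
    proof -
      have M_less: "1 / real (Suc M) < e\<^sup>2 / 4"
      proof -
        have "4 < real M * e\<^sup>2"
          using M \<open>0 < e\<close> by (simp add: field_simps)
        also have "\<dots> \<le> real (Suc M) * e\<^sup>2"
          using \<open>0 < e\<close> by simp
        finally show ?thesis by (simp add: field_simps)
      qed
      have J_less: "J (z l) < m + e\<^sup>2 / 4" if "l \<ge> M" for l
      proof -
        have "1 / real (Suc l) \<le> 1 / real (Suc M)"
          using that by (intro divide_left_mono) auto
        then have "m + 1 / real (Suc l) \<le> m + e\<^sup>2 / 4"
          using M_less by (intro add_left_mono) (rule less_imp_le, rule le_less_trans)
        then show ?thesis using z[of l] by (rule less_le_trans[rotated])
      qed
      have "(norm (z i - z j))\<^sup>2 < e\<^sup>2"
        using par[of "z i" "z j"] J_less[OF that(1)] J_less[OF that(2)] by (simp add: field_simps)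
      then show ?thesis
        using \<open>0 < e\<close> by (simp add: dist_norm power2_less_imp_less)
    qed
    then show "\<exists>M. \<forall>i\<ge>M. \<forall>j\<ge>M. dist (z i) (z j) < e" by blast
  qed
  then obtain w where w: "z \<longlonglongrightarrow> w"
    using Cauchy_convergent_iff convergent_def by blast
  have "(\<lambda>n. J (z n)) \<longlonglongrightarrow> J w"
    unfolding J_def by (intro tendsto_intros w bounded_linear.tendsto[OF bl])
  moreover have "(\<lambda>n. m + 1 / real (Suc n)) \<longlonglongrightarrow> m + 0"
    using LIMSEQ_inverse_real_of_nat by (intro tendsto_intros) (simp add: inverse_eq_divide)
  ultimately have "J w \<le> m + 0"
    by (rule LIMSEQ_le) (use z in \<open>auto intro!: exI[of _ 0] less_imp_le\<close>)
  then have Jw: "J w \<le> J u" for u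
    using m_le[of u] by simp
  \<comment> \<open>The first variation of \<open>J\<close> at the minimiser, in the direction
    \<open>x\<close>.\<close>
  have Re: "Re (g x) = Re (cinner x w)" for x
  proof -
    have "0 \<le> t\<^sup>2 * (norm x)\<^sup>2 + 2 * t * (Re (cinner x w) - Re (g x))" for t
    proof -
      have "J w \<le> J (w + t *\<^sub>R x)" by (rule Jw)
      also have "\<dots> = J w + 2 * t * (Re (cinner x w) - Re (g x)) + t\<^sup>2 * (norm x)\<^sup>2"
        by (simp add: J_def norm_add_square add scaleR cinner_scaleR_right power_mult_distrib
            Re_cinner_commute[of w x] algebra_simps)
      finally show ?thesis by simp
    qed
    from quadratic_nonneg_imp_linear_zero[OF this] show ?thesis by simp
  qed
  have "g x = cinner x w" for x
  proof (rule complex_eqI)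
    show "Re (g x) = Re (cinner x w)" by (rule Re)
    show "Im (g x) = Im (cinner x w)"
      using Re[of "\<i> *\<^sub>C x"] by (simp add: scale cinner_scaleC_left)
  qed
  then show ?thesis by blast
qed

section \<open>Adjoints and the algebra of bounded operators\<close>

lemma BH_linear: "T \<in> BH \<Longrightarrow> blinfun_apply T (c *\<^sub>C x) = c *\<^sub>C blinfun_apply T x"
  by (simp add: BH_def)

lemma ex_adjoint:
  assumes "T \<in> BH"
  shows "\<exists>T'. T' \<in> BH \<and> (\<forall>x y. cinner (blinfun_apply T x) y = cinner x (blinfun_apply T' y))"
proof -
  have "\<exists>z. \<forall>x. cinner (T x) y = cinner x z" for y
  proof (rule Riesz_representation[where K = "norm T * norm y"])
    show "cmod (cinner (T x) y) \<le> norm T * norm y * norm x" for x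
    proof -
      have "cmod (cinner (T x) y) \<le> norm (T x) * norm y"
        by (rule cinner_Cauchy_Schwarz)
      also have "\<dots> \<le> norm T * norm x * norm y"
        by (intro mult_right_mono norm_blinfun) auto
      finally show ?thesis by (simp add: ac_simps)
    qed
  qed (simp_all add: blinfun.add_right cinner_add_left BH_linear[OF assms] cinner_scaleC_left)
  then obtain t where t: "\<And>x y. cinner (T x) y = cinner x (t y)"
    by metis
  have scaleC: "t (c *\<^sub>C y) = c *\<^sub>C t y" for c y
    by (rule cinner_eqI) (simp add: t[symmetric] cinner_scaleC_right)
  have bl: "bounded_linear t"
  proof (rule bounded_linear_intro[where K = "norm T"])
    show "t (x + y) = t x + t y" for x y
      by (rule cinner_eqI) (simp add: t[symmetric] cinner_add_right)
    show "t (r *\<^sub>R x) = r *\<^sub>R t x" for r x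
      by (simp add: scaleR_eq_scaleC scaleC)
    show "norm (t x) \<le> norm x * norm T" for x
    proof (cases "t x = 0")
      case False
      have "norm (t x) * norm (t x) = cmod (cinner (t x) (t x))"
        by (simp only: cinner_self norm_of_real) (simp add: power2_eq_square)
      also have "\<dots> = cmod (cinner (T (t x)) x)"
        by (simp add: t)
      also have "\<dots> \<le> norm (T (t x)) * norm x"
        by (rule cinner_Cauchy_Schwarz)
      also have "\<dots> \<le> norm T * norm (t x) * norm x"
        by (intro mult_right_mono norm_blinfun) auto
      finally show ?thesis
        using False by (simp add: ac_simps)
    qed simp
  qed
  show ?thesis
    using t scaleC by (intro exI[of _ "Blinfun t"]) (simp add: BH_def bounded_linear_Blinfun_apply[OF bl])
qed

text \<open>\<open>adj\<close> is a definite description; exhibiting one adjoint evaluates it,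
  because the inner product separates vectors.\<close>

lemma adj_eqI:
  assumes "\<And>x y. cinner (blinfun_apply T x) y = cinner x (blinfun_apply T' y)"
  shows "adj T = T'"
  unfolding adj_def
proof (rule the_equality)
  show "T'' = T'" if "\<forall>x y. cinner (blinfun_apply T x) y = cinner x (blinfun_apply T'' y)" for T''
  proof (intro blinfun_eqI cinner_eqI)
    show "cinner x (blinfun_apply T'' y) = cinner x (blinfun_apply T' y)" for x y
      using that assms by metis
  qed
qed (use assms in blast)

lemma adj_in_BH: "T \<in> BH \<Longrightarrow> adj T \<in> BH"
  using ex_adjoint adj_eqI by metis

lemma cinner_adj: "T \<in> BH \<Longrightarrow> cinner (blinfun_apply T x) y = cinner x (blinfun_apply (adj T) y)"
  using ex_adjoint adj_eqI by metis

lemma cinner_adj': "T \<in> BH \<Longrightarrow> cinner (blinfun_apply (adj T) x) y = cinner x (blinfun_apply T y)"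
  by (metis cinner_adj cinner_commute)

lemma adj_adj: "T \<in> BH \<Longrightarrow> adj (adj T) = T"
  by (rule adj_eqI) (rule cinner_adj')

lemma adj_add: "\<lbrakk>T \<in> BH; T' \<in> BH\<rbrakk> \<Longrightarrow> adj (T + T') = adj T + adj T'"
  by (rule adj_eqI) (simp add: blinfun.add_left cinner_add_left cinner_add_right cinner_adj)

lemma adj_compose: "\<lbrakk>T \<in> BH; T' \<in> BH\<rbrakk> \<Longrightarrow> adj (T o\<^sub>L T') = adj T' o\<^sub>L adj T"
  by (rule adj_eqI) (simp add: cinner_adj)

lemma adj_scale_op: "T \<in> BH \<Longrightarrow> adj (scale_op c T) = scale_op (cnj c) (adj T)"
  by (rule adj_eqI) (simp add: scale_op_apply cinner_adj cinner_scaleC_left cinner_scaleC_right)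

lemma adj_id [simp]: "adj id_blinfun = id_blinfun"
  by (rule adj_eqI) simp

lemma adj_zero [simp]: "adj 0 = 0"
  by (rule adj_eqI) simp

lemma scale_op_add_left: "scale_op (a + b) T = scale_op a T + scale_op b T"
  by (rule blinfun_eqI) (simp add: scale_op_apply blinfun.add_left scaleC_add_left)

lemma scale_op_add_right: "scale_op a (T + U) = scale_op a T + scale_op a U"
  by (rule blinfun_eqI) (simp add: scale_op_apply blinfun.add_left scaleC_add_right)

lemma scaleC_one: "1 *\<^sub>C (x::'h::complex_hilbert_space) = x"
  using scaleR_eq_scaleC[of 1 x] by simp

lemma scaleC_zero_left: "0 *\<^sub>C (x::'h::complex_hilbert_space) = 0"
  using scaleR_eq_scaleC[of 0 x] by simp

lemma scaleC_zero_right: "a *\<^sub>C (0::'h::complex_hilbert_space) = 0"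
  using bounded_linear.linear[OF bounded_linear_scaleC[of a]] linear_0 by blast

lemma scale_op_one [simp]: "scale_op 1 T = T"
  by (rule blinfun_eqI) (simp add: scale_op_apply scaleC_one)

lemma scale_op_zero_left [simp]: "scale_op 0 T = 0"
  by (rule blinfun_eqI) (simp add: scale_op_apply scaleC_zero_left)

lemma scale_op_zero_right [simp]: "scale_op a 0 = 0"
  by (rule blinfun_eqI) (simp add: scale_op_apply scaleC_zero_right)

lemma scale_op_scale_op [simp]: "scale_op a (scale_op b T) = scale_op (a * b) T"
  by (rule blinfun_eqI) (simp add: scale_op_apply scaleC_scaleC)

lemma uminus_eq_scale_op: "- T = scale_op (-1) (T::'h::complex_hilbert_space op)"
  by (rule blinfun_eqI) (simp add: scale_op_apply blinfun.minus_left flip: minus_eq_scaleC)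

lemma diff_eq_scale_op: "T - U = T + scale_op (-1) (U::'h::complex_hilbert_space op)"
  by (metis uminus_eq_scale_op add_uminus_conv_diff)

lemma scaleR_eq_scale_op: "r *\<^sub>R (T::'h::complex_hilbert_space op) = scale_op (complex_of_real r) T"
  by (rule blinfun_eqI) (simp add: scale_op_apply scaleR_eq_scaleC blinfun.scaleR_left)

lemma scale_op_diff_right: "scale_op a (T - U) = scale_op a T - scale_op a U"
  by (simp add: diff_eq_scale_op scale_op_add_right mult.commute)

lemma compose_scale_op_left: "scale_op a T o\<^sub>L U = scale_op a (T o\<^sub>L U)"
  by (rule blinfun_eqI) (simp add: scale_op_apply)

lemma compose_scale_op_right: "T \<in> BH \<Longrightarrow> T o\<^sub>L scale_op a U = scale_op a (T o\<^sub>L U)"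
  by (rule blinfun_eqI) (simp add: scale_op_apply BH_linear)

lemma norm_scale_op: "norm (scale_op a T) = cmod a * norm T"
proof (rule antisym)
  have le: "norm (scale_op a T) \<le> cmod a * norm T" for a and T :: "'h::complex_hilbert_space op"
    by (rule norm_blinfun_bound)
      (auto simp: scale_op_apply norm_scaleC mult.assoc intro!: mult_left_mono norm_blinfun)
  show "norm (scale_op a T) \<le> cmod a * norm T" by (rule le)
  show "cmod a * norm T \<le> norm (scale_op a T)"
  proof (cases "a = 0")
    case False
    then show ?thesis
      using le[of "inverse a" "scale_op a T"] by (simp add: norm_inverse norm_divide field_simps)
  qed simp
qed

lemmas compose_add_left = bounded_bilinear.add_left[OF bounded_bilinear_blinfun_compose]
lemmas compose_add_right = bounded_bilinear.add_right[OF bounded_bilinear_blinfun_compose]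
lemmas compose_diff_left = bounded_bilinear.diff_left[OF bounded_bilinear_blinfun_compose]
lemmas compose_diff_right = bounded_bilinear.diff_right[OF bounded_bilinear_blinfun_compose]
lemmas compose_sum_left = bounded_bilinear.sum_left[OF bounded_bilinear_blinfun_compose]
lemmas compose_sum_right = bounded_bilinear.sum_right[OF bounded_bilinear_blinfun_compose]
lemmas tendsto_compose_op = bounded_bilinear.tendsto[OF bounded_bilinear_blinfun_compose]

lemma compose_assoc: "(a o\<^sub>L b) o\<^sub>L c = a o\<^sub>L (b o\<^sub>L c)"
  by (rule blinfun_eqI) simp

lemma compose_id_left [simp]: "id_blinfun o\<^sub>L a = a"
  by (rule blinfun_eqI) simp

lemma compose_id_right [simp]: "a o\<^sub>L id_blinfun = a"
  by (rule blinfun_eqI) simp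

lemma norm_adj_le: "T \<in> BH \<Longrightarrow> norm (adj T) \<le> norm T"
proof (rule norm_blinfun_bound)
  fix x assume T: "T \<in> BH"
  show "norm (adj T x) \<le> norm T * norm x"
  proof (cases "adj T x = 0")
    case False
    have "norm (adj T x) * norm (adj T x) = cmod (cinner (T (adj T x)) x)"
      by (simp add: cinner_adj[OF T] cinner_self power2_eq_square norm_mult)
    also have "\<dots> \<le> norm (T (adj T x)) * norm x"
      by (rule cinner_Cauchy_Schwarz)
    also have "\<dots> \<le> norm T * norm (adj T x) * norm x"
      by (intro mult_right_mono norm_blinfun) auto
    finally show ?thesis
      using False by (simp add: ac_simps)
  qed simp
qed simp

lemma norm_adj: "T \<in> BH \<Longrightarrow> norm (adj T) = norm T"
  by (metis adj_adj adj_in_BH antisym norm_adj_le)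

lemma BH_limit:
  assumes "\<And>k. T k \<in> BH" "T \<longlonglongrightarrow> U"
  shows "U \<in> BH"
proof -
  have "U (c *\<^sub>C x) = c *\<^sub>C U x" for c x
  proof (rule LIMSEQ_unique)
    show "(\<lambda>k. T k (c *\<^sub>C x)) \<longlonglongrightarrow> U (c *\<^sub>C x)"
      by (intro tendsto_intros assms)
    have "(\<lambda>k. c *\<^sub>C T k x) \<longlonglongrightarrow> c *\<^sub>C U x"
      by (intro bounded_linear.tendsto[OF bounded_linear_scaleC] tendsto_intros assms)
    then show "(\<lambda>k. T k (c *\<^sub>C x)) \<longlonglongrightarrow> c *\<^sub>C U x"
      using assms(1) by (simp add: BH_linear)
  qed
  then show ?thesis by (simp add: BH_def)
qed

lemma adj_diff:
  assumes "T \<in> BH" "U \<in> BH" shows "adj (T - U) = adj T - adj U"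
proof -
  have "scale_op (-1) U \<in> BH"
    using assms by (simp add: BH_def scale_op_apply scaleC_scaleC)
  then show ?thesis
    using assms by (simp add: diff_eq_scale_op adj_add adj_scale_op)
qed

section \<open>Norm closedness and norm continuity of the state\<close>

text \<open>The maps that generate the weak operator topology are norm continuous. Hence a weakly
  closed algebra contains the limits of its norm convergent sequences.\<close>

lemma continuous_map_norm_to_weak:
  "continuous_map (top_of_set BH) weak_operator_topology (\<lambda>T::'h::complex_hilbert_space op. T)"
  unfolding weak_operator_topology_def
proof (rule continuous_on_generated_topo)
  fix V :: "'h op set"
  assume "V \<in> {{T \<in> BH. cinner (T x) y \<in> U} |x y U. open U}"
  then obtain x y U where V: "V = {T \<in> BH. cinner (T x) y \<in> U}" and "open U" by blast
  have "continuous_on BH (\<lambda>T::'h op. cinner (T x) y)"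
    by (intro bounded_bilinear.continuous_on[OF bounded_bilinear_cinner] continuous_intros)
  then have "openin (top_of_set BH) (BH \<inter> (\<lambda>T. cinner (blinfun_apply T x) y) -` U)"
    using \<open>open U\<close> by (rule continuous_openin_preimage_gen)
  moreover have "BH \<inter> (\<lambda>T. cinner (blinfun_apply T x) y) -` U = (\<lambda>T. T) -` V \<inter> topspace (top_of_set BH)"
    by (auto simp: V)
  ultimately show "openin (top_of_set BH) ((\<lambda>T. T) -` V \<inter> topspace (top_of_set BH))"
    by simp
next
  \<comment> \<open>Zero vectors together with \<open>U = UNIV\<close> make \<open>BH\<close> itself
    a generator, so the generators cover the carrier.\<close>
  have "(BH :: 'h op set) \<in> {{T \<in> BH. cinner (T x) y \<in> U} |x y U. open U}"
    by (intro CollectI exI[of _ 0] exI[of _ UNIV]) auto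
  then show "(\<lambda>T. T) ` topspace (top_of_set BH) \<subseteq> \<Union> {{T::'h op \<in> BH. cinner (T x) y \<in> U} |x y U. open U}"
    by auto
qed

lemma closedin_weak_imp_limit:
  assumes closed: "closedin weak_operator_topology A" and "A \<subseteq> BH"
    and "\<And>k. T k \<in> A" "T \<longlonglongrightarrow> U"
  shows "U \<in> A"
proof -
  have "closedin (top_of_set BH) {T \<in> topspace (top_of_set BH). T \<in> A}"
    by (rule closedin_continuous_map_preimage[OF continuous_map_norm_to_weak closed])
  also have "{T \<in> topspace (top_of_set BH). T \<in> A} = A"
    using \<open>A \<subseteq> BH\<close> by auto
  finally have "closedin (top_of_set BH) A" .
  then obtain C where C: "closed C" "A = BH \<inter> C"
    by (auto simp: closedin_closed)
  have "U \<in> BH"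
    by (rule BH_limit[of T]) (use assms in auto)
  moreover have "U \<in> C"
  proof (rule closed_sequentially[of C T])
    show "T k \<in> C" for k
      using assms(3)[of k] C by blast
  qed (use C assms in auto)
  ultimately show ?thesis by (simp add: C)
qed

text \<open>The constant is uniform in \<open>T\<close>, since each term is at most
  \<open>norm T\<close> times the sum of the two squared norms. This makes the functionals that
  define the sigma-weak topology bounded.\<close>

lemma norm_summable_cinner:
  fixes \<xi> \<eta> :: "nat \<Rightarrow> 'h::complex_hilbert_space"
  assumes "summable (\<lambda>n. (norm (\<xi> n))\<^sup>2)" "summable (\<lambda>n. (norm (\<eta> n))\<^sup>2)"
  shows "\<exists>C. \<forall>T. summable (\<lambda>n. cinner (blinfun_apply T (\<xi> n)) (\<eta> n)) \<and>
     cmod (\<Sum>n. cinner (blinfun_apply T (\<xi> n)) (\<eta> n)) \<le> norm T * C"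
proof -
  let ?b = "\<lambda>n. (norm (\<xi> n))\<^sup>2 + (norm (\<eta> n))\<^sup>2"
  have sb: "summable ?b"
    using assms by (rule summable_add)
  have le: "cmod (cinner (blinfun_apply T (\<xi> n)) (\<eta> n)) \<le> norm T * ?b n" for T :: "'h op" and n
  proof -
    have "cmod (cinner (T (\<xi> n)) (\<eta> n)) \<le> norm (T (\<xi> n)) * norm (\<eta> n)"
      by (rule cinner_Cauchy_Schwarz)
    also have "\<dots> \<le> norm T * norm (\<xi> n) * norm (\<eta> n)"
      by (intro mult_right_mono norm_blinfun) auto
    also have "\<dots> = norm T * (norm (\<xi> n) * norm (\<eta> n))" by simp
    also have "\<dots> \<le> norm T * ?b n"
    proof (intro mult_left_mono)
      have "0 \<le> (norm (\<xi> n) - norm (\<eta> n))\<^sup>2 + (norm (\<xi> n))\<^sup>2 + (norm (\<eta> n))\<^sup>2"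
        by simp
      then show "norm (\<xi> n) * norm (\<eta> n) \<le> ?b n"
        by (simp add: power2_diff)
    qed simp
    finally show ?thesis .
  qed
  have s: "summable (\<lambda>n. cmod (cinner (blinfun_apply T (\<xi> n)) (\<eta> n)))" for T :: "'h op"
    by (rule summable_comparison_test'[where g = "\<lambda>n. norm T * ?b n" and N = 0])
      (use sb le in \<open>auto intro: summable_mult\<close>)
  have "cmod (\<Sum>n. cinner (blinfun_apply T (\<xi> n)) (\<eta> n)) \<le> norm T * (\<Sum>n. ?b n)" for T :: "'h op"
  proof -
    have "cmod (\<Sum>n. cinner (blinfun_apply T (\<xi> n)) (\<eta> n)) \<le> (\<Sum>n. cmod (cinner (blinfun_apply T (\<xi> n)) (\<eta> n)))"
      by (rule summable_norm[OF s])
    also have "\<dots> \<le> (\<Sum>n. norm T * ?b n)"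
      by (intro suminf_le le s summable_mult sb)
    also have "\<dots> = norm T * (\<Sum>n. ?b n)"
      by (rule suminf_mult[OF sb])
    finally show ?thesis .
  qed
  then show ?thesis
    using summable_norm_cancel[OF s] by blast
qed

lemma continuous_map_norm_to_sigma_weak:
  "continuous_map (top_of_set BH) sigma_weak_topology (\<lambda>T::'h::complex_hilbert_space op. T)"
  unfolding sigma_weak_topology_def
proof (rule continuous_on_generated_topo)
  fix V :: "'h op set"
  assume "V \<in> {{T \<in> BH. (\<Sum>n. cinner (T (\<xi> n)) (\<eta> n)) \<in> U} | \<xi> \<eta> U.
          summable (\<lambda>n::nat. (norm (\<xi> n))\<^sup>2) \<and> summable (\<lambda>n. (norm (\<eta> n))\<^sup>2) \<and> open U}"
  then obtain \<xi> \<eta> U where V: "V = {T \<in> BH. (\<Sum>n. cinner (T (\<xi> n)) (\<eta> n)) \<in> U}" and "open U"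
    and s: "summable (\<lambda>n::nat. (norm (\<xi> n))\<^sup>2)" "summable (\<lambda>n. (norm (\<eta> n))\<^sup>2)" by blast
  let ?g = "\<lambda>T::'h op. \<Sum>n. cinner (T (\<xi> n)) (\<eta> n)"
  obtain C where sm: "\<And>T. summable (\<lambda>n. cinner (blinfun_apply T (\<xi> n)) (\<eta> n))"
    and C: "\<And>T. cmod (?g T) \<le> norm T * C"
    using norm_summable_cinner[OF s] by blast
  have "bounded_linear ?g"
    by (rule bounded_linear_intro[where K = C])
      (auto simp: blinfun.add_left blinfun.scaleR_left cinner_add_left cinner_scaleR_left C scaleR_conv_of_real
        suminf_add[OF sm sm] suminf_mult[OF sm])
  then have "continuous_on BH ?g"
    by (rule linear_continuous_on)
  then have "openin (top_of_set BH) (BH \<inter> ?g -` U)"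
    using \<open>open U\<close> by (rule continuous_openin_preimage_gen)
  moreover have "BH \<inter> ?g -` U = (\<lambda>T. T) -` V \<inter> topspace (top_of_set BH)"
    by (auto simp: V)
  ultimately show "openin (top_of_set BH) ((\<lambda>T. T) -` V \<inter> topspace (top_of_set BH))"
    by simp
next
  have "(BH :: 'h op set) \<in> {{T \<in> BH. (\<Sum>n. cinner (T (\<xi> n)) (\<eta> n)) \<in> U} | \<xi> \<eta> U.
          summable (\<lambda>n::nat. (norm (\<xi> n))\<^sup>2) \<and> summable (\<lambda>n. (norm (\<eta> n))\<^sup>2) \<and> open U}"
    by (intro CollectI exI[of _ "\<lambda>_. 0"] exI[of _ UNIV]) auto
  then show "(\<lambda>T. T) ` topspace (top_of_set BH) \<subseteq> \<Union> {{T::'h op \<in> BH. (\<Sum>n. cinner (T (\<xi> n)) (\<eta> n)) \<in> U} | \<xi> \<eta> U.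
          summable (\<lambda>n::nat. (norm (\<xi> n))\<^sup>2) \<and> summable (\<lambda>n. (norm (\<eta> n))\<^sup>2) \<and> open U}"
    by auto
qed

section \<open>The 2-norm of a tracial state\<close>

lemma op_prod_Nil [simp]: "op_prod [] = id_blinfun"
  by (simp add: op_prod_def)

lemma op_prod_Cons [simp]: "op_prod (T # Ts) = T o\<^sub>L op_prod Ts"
  by (simp add: op_prod_def)

lemma op_prod_append: "op_prod (Ts @ Us) = op_prod Ts o\<^sub>L op_prod Us"
  by (induction Ts) (simp_all add: compose_assoc)

lemma op_pow_0 [simp]: "op_pow T 0 = id_blinfun"
  by (simp add: op_pow_def)

lemma op_pow_Suc: "op_pow T (Suc m) = T o\<^sub>L op_pow T m"
  by (simp add: op_pow_def)

lemma op_pow_add: "op_pow T (m + n) = op_pow T m o\<^sub>L op_pow T n"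
  by (simp add: op_pow_def replicate_add op_prod_append)

lemma op_pow_Suc': "op_pow T (Suc m) = op_pow T m o\<^sub>L T"
  using op_pow_add[of T m 1] by (simp add: op_pow_Suc)

lemma commute_op_pow:
  assumes "T o\<^sub>L M = M o\<^sub>L T" shows "op_pow T m o\<^sub>L M = M o\<^sub>L op_pow T m"
proof (induction m)
  case (Suc m)
  then show ?case
    by (metis assms compose_assoc op_pow_Suc)
qed simp

text \<open>Polarisation at \<open>x\<close> and at the multiple \<open>y\<close> of
  \<open>E x\<close> that has the same norm as \<open>x\<close>; the parallelogram law bounds the
  two quadratic forms. It stands in for functional calculus when the norm of a self-adjoint operator
  has to be read off its quadratic form.\<close>

lemma norm_le_if_numerical_radius_le:
  fixes E :: "'h::complex_hilbert_space op"
  assumes E: "E \<in> BH" "adj E = E" and le: "\<And>x. \<bar>Re (cinner (blinfun_apply E x) x)\<bar> \<le> (norm x)\<^sup>2"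
  shows "norm E \<le> 1"
proof (rule norm_blinfun_bound)
  fix x
  show "norm (E x) \<le> 1 * norm x"
  proof (cases "E x = 0")
    case False
    then have x: "norm x > 0"
      by (metis blinfun.zero_right zero_less_norm_iff)
    define r where "r = norm x / norm (E x)"
    have r: "r > 0" using x False by (simp add: r_def)
    define y where "y = r *\<^sub>R E x"
    have sym: "Re (cinner (E y) x) = Re (cinner (E x) y)"
      by (metis E(1,2) cinner_adj Re_cinner_commute)
    have "4 * Re (cinner (E x) y) =
        Re (cinner (E (x + y)) (x + y)) - Re (cinner (E (x - y)) (x - y))"
      by (simp add: blinfun.add_right blinfun.diff_right cinner_add_left cinner_add_right
          cinner_diff_left cinner_diff_right sym)
    also have "\<dots> \<le> (norm (x + y))\<^sup>2 + (norm (x - y))\<^sup>2"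
      using le[of "x + y"] le[of "x - y"] by linarith
    also have "\<dots> = 2 * (norm x)\<^sup>2 + 2 * (norm y)\<^sup>2"
      using norm_add_square[of x y] norm_add_square[of x "- y"] by (simp add: cinner_minus_right)
    also have "norm y = norm x"
      using r False by (simp add: y_def r_def)
    finally have "Re (cinner (E x) y) \<le> (norm x)\<^sup>2" by simp
    also have "Re (cinner (E x) y) = r * (norm (E x))\<^sup>2"
      by (simp add: y_def cinner_scaleR_right Re_cinner_self)
    also have "\<dots> = norm x * norm (E x)"
      using False by (simp add: r_def power2_eq_square)
    finally show ?thesis
      using x by (simp add: power2_eq_square)
  qed simp
qed simp

context tracial_W_prob_space
begin

section \<open>Closure properties of the algebra and linearity of the state\<close>

lemma unital: "unital_subalgebra A"
  using von_neumann by (simp add: von_neumann_algebra_def)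

lemma A_sub_BH: "A \<subseteq> BH"
  using unital by (simp add: unital_subalgebra_def)

lemma A_BH: "X \<in> A \<Longrightarrow> X \<in> BH"
  using A_sub_BH by blast

lemma A_id: "id_blinfun \<in> A"
  using unital by (simp add: unital_subalgebra_def)

lemma A_add: "\<lbrakk>X \<in> A; Y \<in> A\<rbrakk> \<Longrightarrow> X + Y \<in> A"
  using unital by (simp add: unital_subalgebra_def)

lemma A_compose: "\<lbrakk>X \<in> A; Y \<in> A\<rbrakk> \<Longrightarrow> X o\<^sub>L Y \<in> A"
  using unital by (simp add: unital_subalgebra_def)

lemma A_scale: "X \<in> A \<Longrightarrow> scale_op a X \<in> A"
  using unital by (simp add: unital_subalgebra_def)

lemma A_scaleR: "X \<in> A \<Longrightarrow> r *\<^sub>R X \<in> A"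
  by (simp add: scaleR_eq_scale_op A_scale)

lemma A_adj: "X \<in> A \<Longrightarrow> adj X \<in> A"
  using von_neumann by (simp add: von_neumann_algebra_def)

lemma A_zero: "0 \<in> A"
  using A_scale[OF A_id, of 0] by simp

lemma A_diff: "\<lbrakk>X \<in> A; Y \<in> A\<rbrakk> \<Longrightarrow> X - Y \<in> A"
  by (simp add: diff_eq_scale_op A_add A_scale)

lemma A_sum: "(\<And>i. i \<in> I \<Longrightarrow> X i \<in> A) \<Longrightarrow> sum X I \<in> A"
  by (induction I rule: infinite_finite_induct) (auto simp: A_zero A_add)

lemma A_pow: "X \<in> A \<Longrightarrow> op_pow X m \<in> A"
  by (induction m) (auto simp: A_id op_pow_Suc A_compose)

lemma A_prod: "set Xs \<subseteq> A \<Longrightarrow> op_prod Xs \<in> A"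
  by (induction Xs) (auto simp: A_id A_compose)

lemmas A_intros = A_id A_add A_compose A_scale A_scaleR A_adj A_zero A_diff A_sum A_pow

lemma A_limit: "\<lbrakk>\<And>k. T k \<in> A; T \<longlonglongrightarrow> U\<rbrakk> \<Longrightarrow> U \<in> A"
  using closedin_weak_imp_limit[OF _ A_sub_BH] von_neumann
  by (auto simp: von_neumann_algebra_def)

lemma state_zero: "\<phi> 0 = 0"
  using state_scale[OF A_id, of 0] by simp

lemma state_diff: "\<lbrakk>X \<in> A; Y \<in> A\<rbrakk> \<Longrightarrow> \<phi> (X - Y) = \<phi> X - \<phi> Y"
  by (simp add: diff_eq_scale_op state_add A_scale state_scale)

lemma state_sum: "(\<And>i. i \<in> I \<Longrightarrow> X i \<in> A) \<Longrightarrow> \<phi> (sum X I) = (\<Sum>i\<in>I. \<phi> (X i))"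
  by (induction I rule: infinite_finite_induct) (auto simp: state_zero state_add A_sum)

lemma state_scaleR: "X \<in> A \<Longrightarrow> \<phi> (r *\<^sub>R X) = r * \<phi> X"
  by (simp add: scaleR_eq_scale_op state_scale)

text \<open>On the algebra the norm topology is finer than the sigma-weak one, so the state is norm
  continuous at 0, and rescaling turns continuity into a bound.\<close>

lemma state_bounded: "\<exists>K>0. \<forall>T\<in>A. cmod (\<phi> T) \<le> K * norm T"
proof -
  have "continuous_map (subtopology (top_of_set BH) A) (subtopology sigma_weak_topology A) (\<lambda>T. T)"
    using continuous_map_norm_to_sigma_weak A_sub_BH
    by (auto simp: continuous_map_in_subtopology intro: continuous_map_from_subtopology)
  then have "continuous_map (subtopology (top_of_set BH) A) euclidean (\<phi> \<circ> (\<lambda>T. T))"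
    using state_weakly_continuous by (rule continuous_map_compose)
  then have "continuous_on A \<phi>"
    using A_sub_BH by (simp add: subtopology_subtopology o_def Int_absorb1)
  then obtain \<delta> where \<delta>: "\<delta> > 0" "\<And>T. T \<in> A \<Longrightarrow> dist T 0 < \<delta> \<Longrightarrow> dist (\<phi> T) (\<phi> 0) < 1"
    unfolding continuous_on_iff using A_zero by (metis zero_less_one)
  have "cmod (\<phi> T) \<le> (2 / \<delta>) * norm T" if T: "T \<in> A" for T
  proof (cases "T = 0")
    case False
    define r where "r = \<delta> / (2 * norm T)"
    have r: "r > 0" using False \<delta> by (simp add: r_def)
    have "norm (r *\<^sub>R T) = \<delta> / 2"
      using False \<delta> r by (simp add: r_def)
    then have "dist (r *\<^sub>R T) 0 < \<delta>" using \<delta> by simp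
    from \<delta>(2)[OF A_scaleR[OF T] this] have "r * cmod (\<phi> T) < 1"
      using r by (simp add: state_zero state_scaleR T norm_mult)
    then show ?thesis
      using False \<delta> by (simp add: r_def field_simps)
  qed (simp add: state_zero)
  then show ?thesis
    using \<delta> by (intro exI[of _ "2 / \<delta>"]) auto
qed

text \<open>The norm of L^2(A, \<phi>), used on elements of \<open>A\<close> only; the completion is
  never formed.\<close>

definition n2 :: "'h op \<Rightarrow> real" where
  "n2 X = sqrt (Re (\<phi> (adj X o\<^sub>L X)))"

lemma state_adj_self: "X \<in> A \<Longrightarrow> \<phi> (adj X o\<^sub>L X) = complex_of_real ((n2 X)\<^sup>2)"
  using state_positive[of X] by (auto simp: n2_def complex_nonneg_Reals_iff complex_eq_iff)

lemma n2_nonneg: "X \<in> A \<Longrightarrow> 0 \<le> n2 X"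
  using state_positive[of X] by (auto simp: n2_def complex_nonneg_Reals_iff)

lemma n2_eq_0: "X \<in> A \<Longrightarrow> n2 X = 0 \<Longrightarrow> X = 0"
  using state_adj_self[of X] state_faithful[of X] by simp

lemma n2_zero [simp]: "n2 0 = 0"
  by (simp add: n2_def state_zero)

text \<open>Positivity makes the state hermitian: its value at
  \<open>adj (X + a) o\<^sub>L (X + a)\<close> is real for every scalar a, and a = 1 and a = \<i>
  give the imaginary and the real part of the claim.\<close>

lemma state_adj:
  assumes X: "X \<in> A" shows "\<phi> (adj X) = cnj (\<phi> X)"
proof -
  have real: "Im (\<phi> (adj U o\<^sub>L U)) = 0" if "U \<in> A" for U
    using state_adj_self[OF that] by simp
  have e: "adj (X + scale_op a id_blinfun) o\<^sub>L (X + scale_op a id_blinfun) =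
     (adj X o\<^sub>L X) + scale_op a (adj X) + scale_op (cnj a) X + scale_op (cnj a * a) id_blinfun" for a
    using X by (simp add: adj_add adj_scale_op A_BH A_intros compose_add_left compose_add_right
        compose_scale_op_left compose_scale_op_right ac_simps)
  have Im: "Im (a * \<phi> (adj X) + cnj a * \<phi> X) = 0" for a
  proof -
    have "X + scale_op a id_blinfun \<in> A" using X by (intro A_intros)
    from real[OF this] show ?thesis
      unfolding e using X real[OF X] by (simp add: state_add state_scale A_intros state_unital)
  qed
  show ?thesis
    using Im[of 1] Im[of \<i>] by (simp add: complex_eq_iff)
qed

lemma state_adj_compose:
  assumes "X \<in> A" "Y \<in> A" shows "\<phi> (adj X o\<^sub>L Y) = cnj (\<phi> (adj Y o\<^sub>L X))"
  using assms by (simp add: A_intros A_BH adj_adj adj_compose flip: state_adj)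

lemma n2_add_square:
  assumes "X \<in> A" "Y \<in> A"
  shows "(n2 (X + Y))\<^sup>2 = (n2 X)\<^sup>2 + 2 * Re (\<phi> (adj Y o\<^sub>L X)) + (n2 Y)\<^sup>2"
proof -
  have "complex_of_real ((n2 (X + Y))\<^sup>2) = \<phi> (adj (X + Y) o\<^sub>L (X + Y))"
    using assms by (simp add: state_adj_self A_intros)
  also have "\<dots> = of_real ((n2 X)\<^sup>2) + \<phi> (adj Y o\<^sub>L X) + cnj (\<phi> (adj Y o\<^sub>L X)) + of_real ((n2 Y)\<^sup>2)"
    using assms
    by (simp add: adj_add A_BH compose_add_left compose_add_right state_add A_intros state_adj_self
        state_adj_compose[of X Y])
  finally have "Re (complex_of_real ((n2 (X + Y))\<^sup>2)) =
      Re (of_real ((n2 X)\<^sup>2) + \<phi> (adj Y o\<^sub>L X) + cnj (\<phi> (adj Y o\<^sub>L X)) + of_real ((n2 Y)\<^sup>2))"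
    by (rule arg_cong)
  then show ?thesis by (simp only: plus_complex.sel Re_complex_of_real complex_cnj cnj.sel)
qed

lemma n2_scale: "X \<in> A \<Longrightarrow> n2 (scale_op a X) = cmod a * n2 X"
proof -
  assume X: "X \<in> A"
  have "complex_of_real ((n2 (scale_op a X))\<^sup>2) = \<phi> (adj (scale_op a X) o\<^sub>L scale_op a X)"
    using X by (simp add: state_adj_self A_intros)
  also have "\<dots> = (a * cnj a) * of_real ((n2 X)\<^sup>2)"
    using X by (simp add: adj_scale_op A_BH compose_scale_op_left compose_scale_op_right A_intros
        state_scale state_adj_self)
  also have "\<dots> = complex_of_real ((cmod a * n2 X)\<^sup>2)"
    by (simp add: power_mult_distrib complex_norm_square[unfolded of_real_power])
  finally have "(n2 (scale_op a X))\<^sup>2 = (cmod a * n2 X)\<^sup>2"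
    by (simp only: of_real_eq_iff)
  then show ?thesis
    using X by (simp add: n2_nonneg A_intros)
qed

lemma state_Cauchy_Schwarz:
  assumes X: "X \<in> A" and Y: "Y \<in> A"
  shows "cmod (\<phi> (adj Y o\<^sub>L X)) \<le> n2 X * n2 Y"
proof (cases "n2 Y = 0")
  case True
  then have "Y = 0" by (rule n2_eq_0[OF Y])
  then show ?thesis using X by (simp add: state_zero n2_nonneg)
next
  case False
  define a where "a = \<phi> (adj Y o\<^sub>L X)"
  \<comment> \<open>The multiple \<open>t * a\<close> of \<open>Y\<close> minimises the 2-norm of
    the sum with \<open>X\<close>.\<close>
  define t where "t = - 1 / (n2 Y)\<^sup>2"
  have "0 \<le> (n2 (X + scale_op (t * a) Y))\<^sup>2" by simp
  also have "\<dots> = (n2 X)\<^sup>2 + 2 * Re (cnj (t * a) * a) + (cmod (t * a) * n2 Y)\<^sup>2"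
    using X Y by (simp add: n2_add_square A_intros n2_scale adj_scale_op A_BH compose_scale_op_left
        state_scale flip: a_def)
  also have "Re (cnj (t * a) * a) = t * (cmod a)\<^sup>2"
    by (simp add: cmod_power2) (simp add: power2_eq_square algebra_simps)
  also have "(cmod (t * a) * n2 Y)\<^sup>2 = - t * (cmod a)\<^sup>2"
    using False by (simp add: t_def norm_mult norm_divide power_mult_distrib power_divide field_simps power2_eq_square)
  finally have "(cmod a)\<^sup>2 \<le> (n2 X)\<^sup>2 * (n2 Y)\<^sup>2"
    using False by (simp add: t_def divide_simps mult.commute)
  then have "(cmod a)\<^sup>2 \<le> (n2 X * n2 Y)\<^sup>2"
    by (simp add: power_mult_distrib)
  then show ?thesis
    unfolding a_def by (rule power2_le_imp_le) (simp add: n2_nonneg X Y)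
qed

lemma n2_triangle:
  assumes X: "X \<in> A" and Y: "Y \<in> A"
  shows "n2 (X + Y) \<le> n2 X + n2 Y"
proof (rule power2_le_imp_le)
  have "Re (\<phi> (adj Y o\<^sub>L X)) \<le> n2 X * n2 Y"
    using state_Cauchy_Schwarz[OF X Y] complex_Re_le_cmod order_trans by blast
  then show "(n2 (X + Y))\<^sup>2 \<le> (n2 X + n2 Y)\<^sup>2"
    using X Y by (simp add: n2_add_square power2_sum)
qed (use X Y in \<open>simp add: n2_nonneg\<close>)

lemma n2_sum:
  "(\<And>i. i \<in> I \<Longrightarrow> X i \<in> A) \<Longrightarrow> n2 (sum X I) \<le> (\<Sum>i\<in>I. n2 (X i))"
proof (induction I rule: infinite_finite_induct)
  case (insert i I)
  then show ?case
    using n2_triangle[of "X i" "sum X I"] by (auto simp: A_sum)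
qed auto

lemma n2_uminus: "X \<in> A \<Longrightarrow> n2 (- X) = n2 X"
  by (simp add: uminus_eq_scale_op n2_scale)

lemma n2_minus_commute: "\<lbrakk>X \<in> A; Y \<in> A\<rbrakk> \<Longrightarrow> n2 (X - Y) = n2 (Y - X)"
  by (metis n2_uminus minus_diff_eq A_diff)

lemma n2_triangle_diff: "\<lbrakk>X \<in> A; Y \<in> A; Z \<in> A\<rbrakk> \<Longrightarrow> n2 (X - Z) \<le> n2 (X - Y) + n2 (Y - Z)"
  using n2_triangle[of "X - Y" "Y - Z"] by (simp add: A_diff)

lemma n2_adj: "X \<in> A \<Longrightarrow> n2 (adj X) = n2 X"
  by (simp add: n2_def adj_adj A_BH state_tracial A_adj)

lemma n2_le_norm: "\<exists>K>0. \<forall>T\<in>A. n2 T \<le> K * norm T"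
proof -
  obtain K where K: "K > 0" "\<And>T. T \<in> A \<Longrightarrow> cmod (\<phi> T) \<le> K * norm T"
    using state_bounded by blast
  have "n2 T \<le> sqrt K * norm T" if T: "T \<in> A" for T
  proof (rule power2_le_imp_le)
    have "(n2 T)\<^sup>2 = cmod (\<phi> (adj T o\<^sub>L T))"
      by (simp add: state_adj_self T norm_power del: of_real_power)
    also have "\<dots> \<le> K * norm (adj T o\<^sub>L T)"
      by (intro K A_intros T)
    also have "\<dots> \<le> K * (norm T * norm T)"
      using K norm_blinfun_compose[of "adj T" T] norm_adj[OF A_BH[OF T]] by simp
    finally show "(n2 T)\<^sup>2 \<le> (sqrt K * norm T)\<^sup>2"
      using K by (simp add: power_mult_distrib) (simp add: power2_eq_square)
  qed (use K in simp)
  then show ?thesis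
    using K by (intro exI[of _ "sqrt K"]) auto
qed

text \<open>Limits in 2-norm are unique by faithfulness. This is what makes the definite description
  in \<open>wigner_integral\<close> independent of the approximating sequence.\<close>

lemma n2_tendsto_zero_unique:
  assumes "X \<in> A" "Y \<in> A" "\<And>k. U k \<in> A" "\<And>k. V k \<in> A"
    and "(\<lambda>k. n2 (X - U k)) \<longlonglongrightarrow> 0" "(\<lambda>k. n2 (Y - V k)) \<longlonglongrightarrow> 0" "(\<lambda>k. n2 (U k - V k)) \<longlonglongrightarrow> 0"
  shows "X = Y"
proof -
  have "n2 (X - Y) \<le> n2 (X - U k) + n2 (U k - V k) + n2 (Y - V k)" for k
  proof -
    have "n2 (X - Y) \<le> n2 (X - U k) + n2 (U k - Y)"
      using assms by (intro n2_triangle_diff)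
    also have "n2 (U k - Y) \<le> n2 (U k - V k) + n2 (V k - Y)"
      using assms by (intro n2_triangle_diff)
    also have "n2 (V k - Y) = n2 (Y - V k)"
      using assms by (intro n2_minus_commute)
    finally show ?thesis by simp
  qed
  moreover have "(\<lambda>k. n2 (X - U k) + n2 (U k - V k) + n2 (Y - V k)) \<longlonglongrightarrow> 0 + 0 + 0"
    by (intro tendsto_add assms)
  ultimately have "n2 (X - Y) \<le> 0"
    by (intro tendsto_lowerbound[of _ "0::real" sequentially]) auto
  then have "X - Y = 0"
    using assms by (intro n2_eq_0 A_diff antisym n2_nonneg)
  then show ?thesis by simp
qed

section \<open>The operator norm is determined by the state\<close>

text \<open>The iteration \<open>Y \<mapsto> (Z + Y\<^sup>2)/2\<close> is dominated in norm by the scalar iteration for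
  \<open>Z = 1\<close>, which increases; its fixed point satisfies \<open>(1 - Y)\<^sup>2 = 1 - Z\<close>.\<close>

lemma ex_operator_sqrt:
  assumes Z: "Z \<in> A" "adj Z = Z" "norm Z \<le> 1"
  shows "\<exists>Y. Y \<in> A \<and> adj Y = Y \<and> norm Y \<le> 1 \<and>
     (id_blinfun - Y) o\<^sub>L (id_blinfun - Y) = id_blinfun - Z \<and>
     (\<forall>T. T o\<^sub>L Z = Z o\<^sub>L T \<longrightarrow> T o\<^sub>L Y = Y o\<^sub>L T)"
proof -
  define y where "y = rec_nat 0 (\<lambda>_ Y. (1/2) *\<^sub>R (Z + (Y o\<^sub>L Y)))"
  have y0: "y 0 = 0" and ySuc: "y (Suc n) = (1/2) *\<^sub>R (Z + (y n o\<^sub>L y n))" for n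
    by (simp_all add: y_def)
  define r where "r = rec_nat 0 (\<lambda>_ x. (1 + x\<^sup>2) / (2::real))"
  have r0: "r 0 = 0" and rSuc: "r (Suc n) = (1 + (r n)\<^sup>2) / 2" for n
    by (simp_all add: r_def)
  have r_bounds: "0 \<le> r n \<and> r n \<le> 1" for n
    by (induction n) (auto simp: r0 rSuc power_le_one)
  have r_mono: "r n \<le> r (Suc n)" for n
  proof -
    have "0 \<le> (1 - r n)\<^sup>2" by simp
    then show ?thesis by (simp add: rSuc power2_diff)
  qed
  have y_A: "y n \<in> A" for n
    by (induction n) (auto simp: y0 ySuc intro!: A_intros Z)
  have y_norm: "norm (y n) \<le> r n" for n
  proof (induction n)
    case (Suc n)
    have "norm (Z + (y n o\<^sub>L y n)) \<le> norm Z + norm (y n) * norm (y n)"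
      by (meson add_left_mono norm_blinfun_compose norm_triangle_ineq order_trans)
    also have "norm (y n) * norm (y n) \<le> r n * r n"
      using Suc r_bounds by (intro mult_mono) auto
    finally show ?case
      using Z by (simp add: ySuc rSuc power2_eq_square)
  qed (simp add: y0 r0)
  have step: "norm (y (Suc n) - y n) \<le> r (Suc n) - r n" for n
  proof (induction n)
    case 0
    then show ?case using y_norm[of 1] by (simp add: y0 r0)
  next
    case (Suc n)
    let ?a = "y (Suc n)" and ?b = "y n"
    have "y (Suc (Suc n)) - y (Suc n) = (1/2) *\<^sub>R ((?a o\<^sub>L (?a - ?b)) + ((?a - ?b) o\<^sub>L ?b))"
      by (subst ySuc, subst (3) ySuc) (simp add: compose_diff_left compose_diff_right algebra_simps)
    then have "norm (y (Suc (Suc n)) - y (Suc n)) \<le> (norm ?a * norm (?a - ?b) + norm (?a - ?b) * norm ?b) / 2"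
      by (simp add: norm_triangle_le add_mono norm_blinfun_compose)
    also have "\<dots> \<le> (r (Suc n) * (r (Suc n) - r n) + (r (Suc n) - r n) * r n) / 2"
      using Suc y_norm r_bounds r_mono by (intro divide_right_mono add_mono mult_mono) auto
    also have "\<dots> = r (Suc (Suc n)) - r (Suc n)"
    proof -
      have "2 * r (Suc m) = 1 + (r m)\<^sup>2" for m
        by (simp add: rSuc)
      then have "2 * (r (Suc (Suc n)) - r (Suc n)) = (r (Suc n))\<^sup>2 - (r n)\<^sup>2"
        by (simp only: right_diff_distrib add_diff_cancel_left)
      moreover have "r (Suc n) * (r (Suc n) - r n) + (r (Suc n) - r n) * r n = (r (Suc n))\<^sup>2 - (r n)\<^sup>2"
        by (simp add: power2_eq_square algebra_simps)
      ultimately show ?thesis by (metis mult_2 nonzero_mult_div_cancel_left zero_neq_numeral)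
    qed
    finally show ?case .
  qed
  have diff: "norm (y (n + k) - y n) \<le> r (n + k) - r n" for n k
  proof (induction k)
    case (Suc k)
    have "norm (y (n + Suc k) - y n) \<le> norm (y (Suc (n + k)) - y (n + k)) + norm (y (n + k) - y n)"
      by (simp add: norm_diff_triangle_ineq dist_norm[symmetric] dist_triangle)
    then show ?case using Suc step[of "n + k"] by simp
  qed simp
  have "incseq r" using r_mono by (intro incseq_SucI)
  then obtain l where "r \<longlonglongrightarrow> l"
    using incseq_convergent[of r 1] r_bounds by blast
  then have Cr: "Cauchy r" by (rule LIMSEQ_imp_Cauchy)
  have "Cauchy y"
  proof (rule metric_CauchyI)
    fix e :: real assume "0 < e"
    then obtain M where M: "\<And>i j. \<lbrakk>i \<ge> M; j \<ge> M\<rbrakk> \<Longrightarrow> dist (r i) (r j) < e"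
      using metric_CauchyD[OF Cr] by blast
    have *: "dist (y i) (y j) < e" if "M \<le> j" "j \<le> i" for i j
      using diff[of j "i - j"] M[of i j] that by (simp add: dist_norm)
    have "dist (y i) (y j) < e" if "M \<le> i" "M \<le> j" for i j
      using *[of i j] *[of j i] that by (cases "j \<le> i") (auto simp: dist_commute)
    then show "\<exists>M. \<forall>i\<ge>M. \<forall>j\<ge>M. dist (y i) (y j) < e" by blast
  qed
  then obtain Y where Y: "y \<longlonglongrightarrow> Y"
    using Cauchy_convergent_iff convergent_def by blast
  have Y_A: "Y \<in> A" using A_limit[OF y_A Y] .
  have "(\<lambda>n. y (Suc n)) \<longlonglongrightarrow> (1/2) *\<^sub>R (Z + (Y o\<^sub>L Y))"
    unfolding ySuc by (intro tendsto_intros tendsto_compose_op Y)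
  then have fixpt: "Y = (1/2) *\<^sub>R (Z + (Y o\<^sub>L Y))"
    using LIMSEQ_Suc[OF Y] LIMSEQ_unique by blast
  have "2 *\<^sub>R Y = 2 *\<^sub>R ((1/2) *\<^sub>R (Z + (Y o\<^sub>L Y)))"
    by (subst fixpt[symmetric]) (rule refl)
  then have "2 *\<^sub>R Y = Z + (Y o\<^sub>L Y)"
    unfolding scaleR_scaleR by simp
  then have sq: "(id_blinfun - Y) o\<^sub>L (id_blinfun - Y) = id_blinfun - Z"
    by (simp add: compose_diff_left compose_diff_right scaleR_2 algebra_simps)
  have comm: "T o\<^sub>L Y = Y o\<^sub>L T" if T: "T o\<^sub>L Z = Z o\<^sub>L T" for T
  proof -
    have "T o\<^sub>L y n = y n o\<^sub>L T" for n
    proof (induction n)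
      case (Suc n)
      then have "T o\<^sub>L (y n o\<^sub>L y n) = (y n o\<^sub>L y n) o\<^sub>L T"
        by (metis compose_assoc)
      then show ?case
        by (simp add: ySuc bounded_bilinear.scaleR_left[OF bounded_bilinear_blinfun_compose]
            bounded_bilinear.scaleR_right[OF bounded_bilinear_blinfun_compose] compose_add_left compose_add_right T)
    qed (simp add: y0)
    moreover have "(\<lambda>n. T o\<^sub>L y n) \<longlonglongrightarrow> (T o\<^sub>L Y)" "(\<lambda>n. y n o\<^sub>L T) \<longlonglongrightarrow> (Y o\<^sub>L T)"
      by (intro tendsto_compose_op tendsto_const Y)+
    ultimately show ?thesis using LIMSEQ_unique by fastforce
  qed
  have "adj Y = Y"
  proof (rule adj_eqI)
    fix u v
    have "adj (y n) = y n" for n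
      by (induction n) (auto simp: y0 ySuc Z y_A A_BH A_intros adj_add adj_compose adj_scale_op scaleR_eq_scale_op)
    then have "cinner (y n u) v = cinner u (y n v)" for n
      using cinner_adj[OF A_BH[OF y_A]] by metis
    moreover have "(\<lambda>n. cinner (y n u) v) \<longlonglongrightarrow> cinner (Y u) v" "(\<lambda>n. cinner u (y n v)) \<longlonglongrightarrow> cinner u (Y v)"
      by (intro tendsto_cinner tendsto_intros Y)+
    ultimately show "cinner (Y u) v = cinner u (Y v)" using LIMSEQ_unique by fastforce
  qed
  moreover have "norm Y \<le> 1"
    using y_norm r_bounds by (intro LIMSEQ_le_const2[OF tendsto_norm[OF Y]]) (meson order_trans)
  ultimately show ?thesis using Y_A sq comm by blast
qed

text \<open>Faithfulness enters through \<open>V = \<bar>D\<bar> + D\<close> with \<open>D = P - c\<close>, a multiple of the positive part of \<open>D\<close>: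
  if the norm of \<open>P = T\<^sup>* T\<close> exceeds \<open>c\<close> then \<open>V\<close> is non-zero, and \<open>P V = (c + \<bar>D\<bar>) V\<close> forces
  \<open>P\<^sup>m V\<close> to grow like \<open>c\<^sup>m\<close> in 2-norm. In the proof \<open>D\<close> is rescaled to a contraction \<open>D'\<close>, and
  \<open>M = \<bar>D'\<bar>\<close>.\<close>

lemma norm_square_le_of_n2_growth:
  assumes T: "T \<in> A" and B: "0 \<le> B"
    and growth: "\<And>m. n2 (op_pow (adj T o\<^sub>L T) m) \<le> B ^ m"
  shows "(norm T)\<^sup>2 \<le> B"
proof (rule ccontr)
  assume "\<not> (norm T)\<^sup>2 \<le> B"
  then obtain c where c: "B < c" "c < (norm T)\<^sup>2" "0 < c"
    using B dense by (metis le_less_trans not_le)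
  define P where "P = adj T o\<^sub>L T"
  have P: "P \<in> A" "adj P = P"
    using T by (auto simp: P_def A_intros adj_compose adj_adj A_BH)
  define D where "D = P - scale_op c id_blinfun"
  have D: "D \<in> A" "adj D = D"
    using P by (auto simp: D_def A_intros adj_diff adj_scale_op A_BH)
  \<comment> \<open>The summand 1 keeps \<open>N\<close> positive even if \<open>D\<close> is
    zero.\<close>
  define N where "N = norm D + 1"
  have N: "N > 0" "norm D \<le> N" by (auto simp: N_def add_nonneg_pos)
  define D' where "D' = scale_op (1 / N) D"
  have D': "D' \<in> A" "adj D' = D'"
    using D by (auto simp: D'_def A_intros adj_scale_op A_BH)
  have D'_norm: "norm D' \<le> 1"
    using N by (simp add: D'_def norm_scale_op norm_divide)
  have P_eq: "P = scale_op c id_blinfun + scale_op N D'"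
    using N by (simp add: D'_def D_def)
  \<comment> \<open>For this \<open>Z\<close> the operator square root gives \<open>M\<close> with
    \<open>M o\<^sub>L M = D' o\<^sub>L D'\<close>. Its hypothesis that \<open>Z\<close> is a
    contraction is verified through the quadratic form.\<close>
  define Z where "Z = id_blinfun - (D' o\<^sub>L D')"
  have Z: "Z \<in> A" "adj Z = Z"
    using D' by (auto simp: Z_def A_intros adj_diff adj_compose A_BH)
  have "\<bar>Re (cinner (Z x) x)\<bar> \<le> (norm x)\<^sup>2" for x
  proof -
    have "cinner (D' (D' x)) x = cinner (D' x) (D' x)"
      using cinner_adj[OF A_BH[OF D'(1)], of "D' x" x] D' by simp
    then have "Re (cinner (Z x) x) = (norm x)\<^sup>2 - (norm (D' x))\<^sup>2"
      by (simp add: Z_def blinfun.diff_left cinner_diff_left Re_cinner_self)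
    moreover have "norm (D' x) \<le> norm x"
      using norm_blinfun[of D' x] D'_norm by (meson mult_left_le_one_le norm_ge_zero order_trans)
    then have "(norm (D' x))\<^sup>2 \<le> (norm x)\<^sup>2" by (simp add: power_mono)
    ultimately show ?thesis by simp
  qed
  then have "norm Z \<le> 1"
    by (rule norm_le_if_numerical_radius_le[OF A_BH[OF Z(1)] Z(2)])
  from ex_operator_sqrt[OF Z this] obtain Y where Y: "Y \<in> A" "adj Y = Y" "norm Y \<le> 1"
    and Ysq: "(id_blinfun - Y) o\<^sub>L (id_blinfun - Y) = id_blinfun - Z"
    and Ycomm: "\<And>T. T o\<^sub>L Z = Z o\<^sub>L T \<Longrightarrow> T o\<^sub>L Y = Y o\<^sub>L T"
    by blast
  \<comment> \<open>A second root provides a self-adjoint \<open>R\<close> with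
    \<open>R o\<^sub>L R = M\<close>. It witnesses that \<open>M\<close> is positive, both for
    \<open>V \<noteq> 0\<close> and for the sign of the cross term in the lower bound.\<close>
  from ex_operator_sqrt[OF Y] obtain W where W: "W \<in> A" "adj W = W"
    and Wsq: "(id_blinfun - W) o\<^sub>L (id_blinfun - W) = id_blinfun - Y"
    by blast
  define M where "M = id_blinfun - Y"
  define R where "R = id_blinfun - W"
  have M: "M \<in> A" and R: "R \<in> A" "adj R = R"
    using Y W by (auto simp: M_def R_def A_intros adj_diff A_BH)
  have MM: "M o\<^sub>L M = D' o\<^sub>L D'" and RR: "R o\<^sub>L R = M"
    using Ysq Wsq by (auto simp: M_def R_def Z_def)
  have "D' o\<^sub>L Z = Z o\<^sub>L D'"
    by (simp add: Z_def compose_diff_left compose_diff_right compose_assoc)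
  then have MD: "D' o\<^sub>L M = M o\<^sub>L D'"
    by (simp add: M_def compose_diff_left compose_diff_right Ycomm)
  then have PM: "P o\<^sub>L M = M o\<^sub>L P"
    using M by (simp add: P_eq compose_add_left compose_add_right compose_scale_op_left
        compose_scale_op_right A_BH)
  define V where "V = M + D'"
  have V: "V \<in> A" using M D' by (simp add: V_def A_intros)
  \<comment> \<open>If \<open>V\<close> were 0 then \<open>D'\<close> would be minus a square, so
    \<open>P\<close> would be at most c in the sense of quadratic forms and \<open>norm T\<close> at
    most the root of c.\<close>
  have "V \<noteq> 0"
  proof
    assume "V = 0"
    then have D'R: "D' = - (R o\<^sub>L R)"
      by (simp add: V_def RR eq_neg_iff_add_eq_0 add.commute)
    have "norm T \<le> sqrt c"
    proof (rule norm_blinfun_bound)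
      fix x
      have "cinner (P x) x = of_real ((norm (T x))\<^sup>2)"
        using T by (simp add: P_def cinner_adj' A_BH cinner_self)
      moreover have RR_x: "cinner (R (R x)) x = of_real ((norm (R x))\<^sup>2)"
        by (simp only: cinner_adj[OF A_BH[OF R(1)], of "R x" x] R(2) cinner_self)
      have "cinner (P x) x = of_real (c * (norm x)\<^sup>2 - N * (norm (R x))\<^sup>2)"
        unfolding P_eq D'R
        by (simp add: blinfun.add_left blinfun.minus_left scale_op_apply cinner_add_left
            cinner_scaleC_left cinner_minus_left cinner_self RR_x)
      ultimately have "(norm (T x))\<^sup>2 = c * (norm x)\<^sup>2 - N * (norm (R x))\<^sup>2"
        by (metis of_real_eq_iff)
      also have "\<dots> \<le> (sqrt c * norm x)\<^sup>2"
        using N c by (simp add: power_mult_distrib)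
      finally show "norm (T x) \<le> sqrt c * norm x"
        by (rule power2_le_imp_le) (use c in simp)
    qed (use c in simp)
    then have "(norm T)\<^sup>2 \<le> c"
      using c by (metis norm_ge_zero power_mono real_sqrt_pow2 less_imp_le)
    then show False using c by simp
  qed
  then have Vpos: "n2 V > 0"
    using V n2_eq_0 n2_nonneg by (metis order_le_less)
  have PV: "P o\<^sub>L V = scale_op c V + scale_op N (M o\<^sub>L V)"
    using V D' M by (simp add: P_eq compose_add_left compose_scale_op_left V_def compose_add_right MM MD
        scale_op_add_right ac_simps)
  \<comment> \<open>\<open>P\<close> acts on the range of \<open>V\<close> as c plus a positive
    operator commuting with the powers of \<open>P\<close>. The cross term in the squared 2-norm is
    therefore non-negative and may be dropped.\<close>
  have lower: "c ^ m * n2 V \<le> n2 (op_pow P m o\<^sub>L V)" for m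
  proof (induction m)
    case (Suc m)
    define Q where "Q = op_pow P m o\<^sub>L V"
    have Q: "Q \<in> A" using P V by (simp add: Q_def A_intros)
    have "op_pow P (Suc m) o\<^sub>L V = op_pow P m o\<^sub>L (P o\<^sub>L V)"
      by (simp add: op_pow_Suc' compose_assoc)
    also have "\<dots> = scale_op c Q + scale_op N (op_pow P m o\<^sub>L M o\<^sub>L V)"
      using P by (simp add: PV compose_add_right compose_scale_op_right A_BH A_intros Q_def compose_assoc)
    also have "op_pow P m o\<^sub>L M o\<^sub>L V = M o\<^sub>L Q"
      by (simp add: commute_op_pow[OF PM] Q_def compose_assoc)
    finally have eq: "op_pow P (Suc m) o\<^sub>L V = scale_op N (M o\<^sub>L Q) + scale_op c Q"
      by (simp add: add.commute)
    have "adj Q o\<^sub>L (M o\<^sub>L Q) = adj (R o\<^sub>L Q) o\<^sub>L (R o\<^sub>L Q)"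
      using R Q by (simp add: adj_compose A_BH compose_assoc flip: RR)
    then have "\<phi> (adj Q o\<^sub>L (M o\<^sub>L Q)) = of_real ((n2 (R o\<^sub>L Q))\<^sup>2)"
      using R Q by (simp add: state_adj_self A_intros)
    then have "(n2 (op_pow P (Suc m) o\<^sub>L V))\<^sup>2 = (N * n2 (M o\<^sub>L Q))\<^sup>2 + 2 * (c * N * (n2 (R o\<^sub>L Q))\<^sup>2) + (c * n2 Q)\<^sup>2"
      unfolding eq using Q M N c
      by (simp add: n2_add_square A_intros n2_scale adj_scale_op A_BH compose_scale_op_left
          compose_scale_op_right state_scale)
    then have "(c * n2 Q)\<^sup>2 \<le> (n2 (op_pow P (Suc m) o\<^sub>L V))\<^sup>2"
      using N c by simp
    then have "c * n2 Q \<le> n2 (op_pow P (Suc m) o\<^sub>L V)"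
      by (rule power2_le_imp_le) (use P V in \<open>simp add: n2_nonneg A_intros\<close>)
    moreover have "c * (c ^ m * n2 V) \<le> c * n2 Q"
      using Suc c by (intro mult_left_mono) (auto simp: Q_def)
    ultimately show ?case by (simp add: mult.assoc)
  qed simp
  have adjP: "adj (op_pow P m) = op_pow P m" for m
  proof (induction m)
    case (Suc m)
    then show ?case
      using P by (simp add: op_pow_Suc adj_compose A_BH A_intros) (metis op_pow_Suc op_pow_Suc')
  qed simp
  \<comment> \<open>Traciality brings the two factors with \<open>V\<close> together, so that
    Cauchy-Schwarz leaves the 2-norm of the power 2 m of \<open>P\<close>, to which the growth
    hypothesis applies.\<close>
  have upper: "(n2 (op_pow P m o\<^sub>L V))\<^sup>2 \<le> B ^ (2 * m) * n2 (V o\<^sub>L adj V)" for m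
  proof -
    let ?Q = "op_pow P m"
    have "complex_of_real ((n2 (?Q o\<^sub>L V))\<^sup>2) = \<phi> (adj (?Q o\<^sub>L V) o\<^sub>L (?Q o\<^sub>L V))"
      using P V by (simp add: state_adj_self A_intros)
    also have "\<dots> = \<phi> (adj V o\<^sub>L (op_pow P (2 * m) o\<^sub>L V))"
      using P V by (simp add: adj_compose A_BH A_intros adjP compose_assoc mult_2 op_pow_add)
    also have "\<dots> = \<phi> ((op_pow P (2 * m) o\<^sub>L V) o\<^sub>L adj V)"
      using P V by (intro state_tracial A_intros)
    also have "\<dots> = \<phi> (adj (op_pow P (2 * m)) o\<^sub>L (V o\<^sub>L adj V))"
      by (simp add: adjP compose_assoc)
    finally have "(n2 (?Q o\<^sub>L V))\<^sup>2 = cmod (\<phi> (adj (op_pow P (2 * m)) o\<^sub>L (V o\<^sub>L adj V)))"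
      by (metis norm_of_real abs_power2)
    also have "\<dots> \<le> n2 (V o\<^sub>L adj V) * n2 (op_pow P (2 * m))"
      using P V by (intro state_Cauchy_Schwarz A_intros)
    also have "\<dots> \<le> n2 (V o\<^sub>L adj V) * B ^ (2 * m)"
      using V growth by (intro mult_left_mono) (auto simp: P_def n2_nonneg A_intros)
    finally show ?thesis by (simp add: mult.commute)
  qed
  have le: "(n2 V)\<^sup>2 \<le> ((B / c)\<^sup>2) ^ m * n2 (V o\<^sub>L adj V)" for m
  proof -
    have "(c ^ m * n2 V)\<^sup>2 \<le> (n2 (op_pow P m o\<^sub>L V))\<^sup>2"
      using lower c V by (intro power_mono) (auto simp: n2_nonneg)
    also note upper
    finally have "(c\<^sup>2) ^ m * (n2 V)\<^sup>2 \<le> (B\<^sup>2) ^ m * n2 (V o\<^sub>L adj V)"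
      by (simp add: power_mult_distrib power_mult[symmetric] mult.commute)
    then show ?thesis
      using c by (simp add: power_divide field_simps)
  qed
  have "(B / c)\<^sup>2 < 1"
    using c B by (simp add: power_less_one_iff abs_square_less_1)
  then have "(\<lambda>m. ((B / c)\<^sup>2) ^ m * n2 (V o\<^sub>L adj V)) \<longlonglongrightarrow> 0"
    by (intro tendsto_mult_left_zero LIMSEQ_power_zero) simp
  then have "(n2 V)\<^sup>2 \<le> 0"
    by (rule LIMSEQ_le_const) (use le in auto)
  then show False using Vpos by simp
qed

end

section \<open>Words and contractions\<close>

definition words :: "nat \<Rightarrow> nat \<Rightarrow> nat list set" where
  "words N n = {v. set v \<subseteq> {..<N} \<and> length v = n}"

definition wordsle :: "nat \<Rightarrow> nat \<Rightarrow> nat list set" where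
  "wordsle N M = {v. set v \<subseteq> {..<N} \<and> length v \<le> M}"

lemma finite_words [simp]: "finite (words N n)"
  unfolding words_def by (rule finite_lists_length_eq) simp

lemma finite_wordsle [simp]: "finite (wordsle N M)"
  unfolding wordsle_def by (rule finite_lists_length_le) simp

lemma words_0 [simp]: "words N 0 = {[]}"
  by (auto simp: words_def)

lemma words_subset_wordsle: "n \<le> M \<Longrightarrow> words N n \<subseteq> wordsle N M"
  by (auto simp: words_def wordsle_def)

lemma sum_words_append:
  "(\<Sum>u\<in>words N (a + b). F u) = (\<Sum>p\<in>words N a. \<Sum>s\<in>words N b. F (p @ s))"
  unfolding sum.cartesian_product
  by (rule sum.reindex_bij_witness[where i = "\<lambda>(p, s). p @ s" and j = "\<lambda>u. (take a u, drop a u)"])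
    (auto simp: words_def dest: in_set_takeD in_set_dropD)

lemma sum_words_rev: "(\<Sum>s\<in>words N r. F (rev s)) = (\<Sum>s\<in>words N r. F s)"
  by (rule sum.reindex_bij_witness[where i = rev and j = rev]) (auto simp: words_def)

lemma sum_wordsle_append:
  "(\<Sum>w | w \<in> wordsle N (a + M) \<and> a \<le> length w. F w) =
     (\<Sum>p\<in>words N a. \<Sum>q\<in>wordsle N M. F (p @ q))"
  unfolding sum.cartesian_product
  by (rule sum.reindex_bij_witness[where i = "\<lambda>(p, s). p @ s" and j = "\<lambda>u. (take a u, drop a u)"])
    (auto simp: words_def wordsle_def dest: in_set_takeD in_set_dropD)

text \<open>A coefficient function on words stands for a (finite) sum of elementary tensors in the
  full Fock space: \<open>supp N M\<close> bounds the tensor degree, \<open>hom N n\<close> fixes it.\<close>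

definition supp :: "nat \<Rightarrow> nat \<Rightarrow> (nat list \<Rightarrow> complex) \<Rightarrow> bool" where
  "supp N M f \<longleftrightarrow> (\<forall>v. v \<notin> wordsle N M \<longrightarrow> f v = 0)"

definition homog :: "nat \<Rightarrow> nat \<Rightarrow> (nat list \<Rightarrow> complex) \<Rightarrow> bool" where
  "homog N n f \<longleftrightarrow> (\<forall>v. v \<notin> words N n \<longrightarrow> f v = 0)"

text \<open>The last \<open>r\<close> variables of \<open>f\<close> are paired, in reverse order, with the first \<open>r\<close> of \<open>g\<close>.\<close>

definition contr ::
  "nat \<Rightarrow> nat \<Rightarrow> nat \<Rightarrow> (nat list \<Rightarrow> complex) \<Rightarrow> (nat list \<Rightarrow> complex) \<Rightarrow> nat list \<Rightarrow> complex" where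
  "contr N n r f g w =
     (if n - r \<le> length w then \<Sum>s\<in>words N r. f (take (n - r) w @ s) * g (rev s @ drop (n - r) w) else 0)"

text \<open>The squared norm of the Fock space vector with coefficients \<open>f\<close>, cut off at
  degree \<open>M\<close>.\<close>

definition sq :: "nat \<Rightarrow> nat \<Rightarrow> (nat list \<Rightarrow> complex) \<Rightarrow> real" where
  "sq N M f = (\<Sum>v\<in>wordsle N M. (cmod (f v))\<^sup>2)"

text \<open>The coefficients of the adjoint operator; \<open>star f = f\<close> is the discrete form
  of mirror symmetry.\<close>

definition star :: "(nat list \<Rightarrow> complex) \<Rightarrow> nat list \<Rightarrow> complex" where
  "star f v = cnj (f (rev v))"

lemma sq_nonneg: "0 \<le> sq N M f"
  by (simp add: sq_def sum_nonneg)

lemma homog_imp_supp: "homog N n f \<Longrightarrow> n \<le> M \<Longrightarrow> supp N M f"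
  using words_subset_wordsle by (fastforce simp: homog_def supp_def)

lemma sq_mono: "supp N M f \<Longrightarrow> M \<le> M' \<Longrightarrow> sq N M' f = sq N M f"
  unfolding sq_def
  by (rule sum.mono_neutral_right[OF finite_wordsle]) (auto simp: supp_def wordsle_def)

lemma sq_homog: "homog N n f \<Longrightarrow> n \<le> M \<Longrightarrow> sq N M f = (\<Sum>v\<in>words N n. (cmod (f v))\<^sup>2)"
  unfolding sq_def
  by (rule sum.mono_neutral_right[OF finite_wordsle]) (auto simp: homog_def words_def wordsle_def)

lemma homog_star: "homog N n f \<Longrightarrow> homog N n (star f)"
  by (auto simp: homog_def star_def words_def)

lemma set_subset_take_drop: "set (take k w) \<subseteq> S \<Longrightarrow> set (drop k w) \<subseteq> S \<Longrightarrow> set w \<subseteq> S"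
  by (metis Un_least append_take_drop_id set_append)

text \<open>The degree bound n + M is not sharp for r > 0, but it is common to all r, so that the
  contractions in a product can be added.\<close>

lemma supp_contr:
  assumes "homog N n f" "supp N M g" "r \<le> n" shows "supp N (n + M) (contr N n r f g)"
  unfolding supp_def
proof (intro allI impI)
  fix w assume w: "w \<notin> wordsle N (n + M)"
  show "contr N n r f g w = 0"
  proof (cases "n - r \<le> length w")
    case True
    have "f (take (n - r) w @ s) * g (rev s @ drop (n - r) w) = 0" if "s \<in> words N r" for s
    proof (rule ccontr)
      assume "\<not> ?thesis"
      then have "take (n - r) w @ s \<in> words N n" "rev s @ drop (n - r) w \<in> wordsle N M"
        using assms by (auto simp: homog_def supp_def)
      then have "w \<in> wordsle N (n + M)"
        using True set_subset_take_drop[of "n - r" w "{..<N}"] \<open>r \<le> n\<close>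
        by (auto simp: words_def wordsle_def)
      with w show False by simp
    qed
    then show ?thesis unfolding contr_def by (simp add: sum.neutral)
  qed (simp add: contr_def)
qed

lemma homog_contr:
  assumes "homog N n f" "homog N m g" "r \<le> n" shows "homog N (n + m - 2 * r) (contr N n r f g)"
  unfolding homog_def
proof (intro allI impI)
  fix w assume w: "w \<notin> words N (n + m - 2 * r)"
  show "contr N n r f g w = 0"
  proof (cases "n - r \<le> length w")
    case True
    have "f (take (n - r) w @ s) * g (rev s @ drop (n - r) w) = 0" if "s \<in> words N r" for s
    proof (rule ccontr)
      assume "\<not> ?thesis"
      then have *: "take (n - r) w @ s \<in> words N n" "rev s @ drop (n - r) w \<in> words N m"
        using assms by (auto simp: homog_def)
      then have "set w \<subseteq> {..<N}"
        using set_subset_take_drop[of "n - r" w "{..<N}"] unfolding words_def by auto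
      moreover have "r + (length w - (n - r)) = m"
        using *(2) that by (simp add: words_def)
      then have "length w = n + m - 2 * r"
        using True \<open>r \<le> n\<close> by linarith
      ultimately show False using w by (simp add: words_def)
    qed
    then show ?thesis unfolding contr_def by (simp add: sum.neutral)
  qed (simp add: contr_def)
qed

lemma cmod_sum_mult_square:
  "(cmod (\<Sum>i\<in>I. a i * b i))\<^sup>2 \<le> (\<Sum>i\<in>I. (cmod (a i))\<^sup>2) * (\<Sum>i\<in>I. (cmod (b i))\<^sup>2)"
proof -
  have "cmod (\<Sum>i\<in>I. a i * b i) \<le> (\<Sum>i\<in>I. \<bar>cmod (a i)\<bar> * \<bar>cmod (b i)\<bar>)"
    by (rule order_trans[OF norm_sum]) (simp add: norm_mult)
  also have "\<dots> \<le> L2_set (\<lambda>i. cmod (a i)) I * L2_set (\<lambda>i. cmod (b i)) I"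
    by (rule L2_set_mult_ineq)
  finally have "(cmod (\<Sum>i\<in>I. a i * b i))\<^sup>2 \<le> (L2_set (\<lambda>i. cmod (a i)) I * L2_set (\<lambda>i. cmod (b i)) I)\<^sup>2"
    by (intro power_mono) auto
  then show ?thesis
    by (simp add: power_mult_distrib L2_set_def sum_nonneg)
qed

text \<open>Each output word is cut into the free letters \<open>p\<close> of \<open>f\<close> and
  the free letters \<open>q\<close> of \<open>g\<close>. The range of \<open>q\<close> comes from
  writing n + M as (n - r) + (M + r).\<close>

lemma sq_contr_sum:
  assumes f: "homog N n f" and g: "supp N M g" and r: "r \<le> n"
  shows "sq N (n + M) (contr N n r f g) =
    (\<Sum>p\<in>words N (n - r). \<Sum>q\<in>wordsle N (M + r). (cmod (\<Sum>s\<in>words N r. f (p @ s) * g (rev s @ q)))\<^sup>2)"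
proof -
  have "sq N (n + M) (contr N n r f g) =
      (\<Sum>w | w \<in> wordsle N (n + M) \<and> n - r \<le> length w. (cmod (contr N n r f g w))\<^sup>2)"
    unfolding sq_def by (rule sum.mono_neutral_right) (auto simp: contr_def)
  also have "\<dots> = (\<Sum>w | w \<in> wordsle N ((n - r) + (M + r)) \<and> n - r \<le> length w. (cmod (contr N n r f g w))\<^sup>2)"
    using r by simp
  also have "\<dots> = (\<Sum>p\<in>words N (n - r). \<Sum>q\<in>wordsle N (M + r). (cmod (\<Sum>s\<in>words N r. f (p @ s) * g (rev s @ q)))\<^sup>2)"
    unfolding sum_wordsle_append by (intro sum.cong refl) (simp add: contr_def words_def)
  finally show ?thesis .
qed

text \<open>Cauchy-Schwarz in the contracted letters \<open>s\<close>. The words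
  \<open>p @ s\<close> run through the arguments of \<open>f\<close> once, and the words
  \<open>rev s @ q\<close> are distinct arguments of \<open>g\<close>; hence no constant arises and
  the number of letters does not enter.\<close>

lemma sq_contr_le:
  assumes f: "homog N n f" and g: "supp N M g" and r: "r \<le> n"
  shows "sq N (n + M) (contr N n r f g) \<le> sq N n f * sq N M g"
proof -
  let ?F = "\<lambda>p. \<Sum>s\<in>words N r. (cmod (f (p @ s)))\<^sup>2"
  let ?G = "\<lambda>q. \<Sum>s\<in>words N r. (cmod (g (rev s @ q)))\<^sup>2"
  have "sq N (n + M) (contr N n r f g) \<le> (\<Sum>p\<in>words N (n - r). \<Sum>q\<in>wordsle N (M + r). ?F p * ?G q)"
    unfolding sq_contr_sum[OF assms] by (intro sum_mono cmod_sum_mult_square)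
  also have "\<dots> = (\<Sum>p\<in>words N (n - r). ?F p) * (\<Sum>q\<in>wordsle N (M + r). ?G q)"
    by (simp add: sum_product)
  also have "(\<Sum>p\<in>words N (n - r). ?F p) = sq N n f"
    using r sum_words_append[of "\<lambda>v. (cmod (f v))\<^sup>2" N "n - r" r] by (simp add: sq_homog[OF f])
  also have "(\<Sum>q\<in>wordsle N (M + r). ?G q) =
      (\<Sum>s\<in>words N r. \<Sum>q\<in>wordsle N (M + r). (cmod (g (rev s @ q)))\<^sup>2)"
    by (rule sum.swap)
  also have "\<dots> = (\<Sum>s\<in>words N r. \<Sum>q\<in>wordsle N (M + r). (cmod (g (s @ q)))\<^sup>2)"
    by (rule sum_words_rev)
  also have "\<dots> = (\<Sum>w | w \<in> wordsle N (r + (M + r)) \<and> r \<le> length w. (cmod (g w))\<^sup>2)"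
    by (rule sum_wordsle_append[symmetric])
  also have "\<dots> \<le> sq N (r + (M + r)) g"
    unfolding sq_def by (rule sum_mono2) auto
  also have "\<dots> = sq N M g"
    by (rule sq_mono[OF g]) simp
  finally show ?thesis
    by (simp add: mult_left_mono sq_nonneg)
qed

section \<open>Wick products\<close>

text \<open>A run of \<open>k\<close> equal letters gives the \<open>k\<close>-th Chebyshev polynomial of the second kind.\<close>

fun wick :: "(nat \<Rightarrow> 'h::complex_hilbert_space op) \<Rightarrow> nat list \<Rightarrow> 'h op" where
  "wick X [] = id_blinfun"
| "wick X [i] = X i"
| "wick X (i # j # v) = (X i o\<^sub>L wick X (j # v)) - (if i = j then wick X v else 0)"

lemma unital_subalgebra_diff:
  "\<lbrakk>unital_subalgebra B; U \<in> B; V \<in> B\<rbrakk> \<Longrightarrow> U - V \<in> B"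
  by (simp add: diff_eq_scale_op unital_subalgebra_def)

lemma wick_in_subalgebra:
  assumes B: "unital_subalgebra B" and "\<And>i. i \<in> set v \<Longrightarrow> X i \<in> B"
  shows "wick X v \<in> B"
  using assms(2)
proof (induction X v rule: wick.induct)
  case (1 X)
  then show ?case using B by (simp add: unital_subalgebra_def)
next
  case (3 X i j v)
  then have "X i o\<^sub>L wick X (j # v) \<in> B"
    using B by (simp add: unital_subalgebra_def)
  with 3 show ?case
    using unital_subalgebra_diff[OF B] by auto
qed simp

text \<open>The recursion of \<open>wick\<close> contracts at the left end of a word only. Here it
  is carried to a seam in the middle: equal letters at the seam contribute the product of the
  shortened words.\<close>

lemma wick_snoc_compose_Cons:
  "wick X (u @ [i]) o\<^sub>L wick X (j # v) =
     wick X (u @ i # j # v) + (if i = j then wick X u o\<^sub>L wick X v else 0)"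
proof (induction X u rule: wick.induct)
  case (2 X k)
  then show ?case
    by (simp add: compose_diff_left compose_diff_right compose_assoc)
next
  case (3 X k l u)
  have "wick X ((k # l # u) @ [i]) o\<^sub>L wick X (j # v) =
      (X k o\<^sub>L (wick X ((l # u) @ [i]) o\<^sub>L wick X (j # v)))
      - (if k = l then wick X (u @ [i]) o\<^sub>L wick X (j # v) else 0)"
    by (simp add: compose_diff_left compose_assoc)
  also have "\<dots> = wick X ((k # l # u) @ i # j # v) + (if i = j then wick X (k # l # u) o\<^sub>L wick X v else 0)"
    using 3 by (auto simp: compose_diff_left compose_add_right compose_assoc)
  finally show ?case .
qed simp

lemma wick_snoc_snoc:
  "wick X (u @ [j, i]) = (wick X (u @ [j]) o\<^sub>L X i) - (if j = i then wick X u else 0)"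
  using wick_snoc_compose_Cons[of X u j i "[]"] by simp

definition match :: "nat list \<Rightarrow> nat list \<Rightarrow> nat \<Rightarrow> bool" where
  "match u v r \<longleftrightarrow> r \<le> length u \<and> r \<le> length v \<and> take r v = take r (rev u)"

text \<open>At the seam the neighbouring letters are either kept, which ends the process, or
  contracted, which exposes the next pair. The index r counts these nested contractions, and
  \<open>match\<close> says that r of them are possible.\<close>

lemma wick_product:
  "wick X u o\<^sub>L wick X v =
     (\<Sum>r\<le>length u. if match u v r then wick X (take (length u - r) u @ drop r v) else 0)"
proof (induction u arbitrary: v rule: rev_induct)
  case (snoc i u)
  show ?case
  proof (cases v)
    case Nil
    have "(\<Sum>r\<le>length (u @ [i]). if match (u @ [i]) v r then wick X (take (length (u @ [i]) - r) (u @ [i]) @ drop r v) else 0)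
        = (\<Sum>r\<in>{0}. if match (u @ [i]) v r then wick X (take (length (u @ [i]) - r) (u @ [i]) @ drop r v) else 0)"
      by (rule sum.mono_neutral_right) (auto simp: match_def Nil)
    then show ?thesis by (simp add: Nil match_def)
  next
    case (Cons j w)
    have m: "match (u @ [i]) (j # w) (Suc r) \<longleftrightarrow> i = j \<and> match u w r" for r
      by (auto simp: match_def)
    have "(\<Sum>r\<le>length (u @ [i]). if match (u @ [i]) v r then wick X (take (length (u @ [i]) - r) (u @ [i]) @ drop r v) else 0)
       = wick X (u @ i # j # w) + (\<Sum>r\<le>length u. if i = j \<and> match u w r then wick X (take (length u - r) u @ drop r w) else 0)"
      unfolding Cons length_append_singleton sum.atMost_Suc_shift m
      by (intro arg_cong2[where f = "(+)"] sum.cong) (auto simp: match_def)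
    also have "\<dots> = wick X (u @ i # j # w) + (if i = j then wick X u o\<^sub>L wick X w else 0)"
      using snoc.IH[of w] by auto
    finally show ?thesis
      by (simp add: Cons wick_snoc_compose_Cons)
  qed
qed (simp add: match_def)

text \<open>Freeness and the semicircle law are condensed into \<open>wick_centred\<close>: every
  non-empty Wick word has expectation 0. Together with the purely algebraic
  \<open>wick_product\<close> this determines all joint moments.\<close>

locale free_semicircular_system = tracial_W_prob_space A \<phi>
  for A :: "'h::complex_hilbert_space op set" and \<phi> +
  fixes X :: "nat \<Rightarrow> 'h op" and N :: nat
  assumes X_in: "i < N \<Longrightarrow> X i \<in> A"
    and X_self_adjoint: "i < N \<Longrightarrow> adj (X i) = X i"
    and wick_centred: "\<lbrakk>set v \<subseteq> {..<N}; v \<noteq> []\<rbrakk> \<Longrightarrow> \<phi> (wick X v) = 0"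
begin

lemma wick_A: "set v \<subseteq> {..<N} \<Longrightarrow> wick X v \<in> A"
  by (rule wick_in_subalgebra[OF unital]) (auto intro: X_in)

lemma adj_wick: "set v \<subseteq> {..<N} \<Longrightarrow> adj (wick X v) = wick X (rev v)"
proof (induction v rule: induct_list012)
  case (3 i j v)
  have "adj (wick X (i # j # v)) =
      (adj (wick X (j # v)) o\<^sub>L adj (X i)) - (if i = j then adj (wick X v) else 0)"
    using 3 wick_A[of "j # v"] wick_A[of v]
    by (simp add: adj_diff adj_compose A_BH A_intros X_in)
  also have "\<dots> = (wick X (rev v @ [j]) o\<^sub>L X i) - (if j = i then wick X (rev v) else 0)"
    using 3 by (auto simp: X_self_adjoint)
  also have "\<dots> = wick X (rev v @ [j, i])"
    by (rule wick_snoc_snoc[symmetric])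
  finally show ?case by simp
qed (auto simp: X_self_adjoint)

text \<open>Of the words produced by \<open>wick_product\<close> only the empty one has a non-zero
  expectation, and it arises exactly when all letters of both words contract. Since
  \<open>rev\<close> gives the adjoint, this is orthonormality.\<close>

lemma state_wick_compose:
  assumes "set u \<subseteq> {..<N}" "set v \<subseteq> {..<N}"
  shows "\<phi> (wick X u o\<^sub>L wick X v) = (if v = rev u then 1 else 0)"
proof -
  have in_A: "wick X (take (length u - r) u @ drop r v) \<in> A" for r
    by (rule wick_A) (use assms set_take_subset set_drop_subset in fastforce)
  have "\<phi> (wick X u o\<^sub>L wick X v) =
      (\<Sum>r\<le>length u. \<phi> (if match u v r then wick X (take (length u - r) u @ drop r v) else 0))"
    unfolding wick_product by (rule state_sum) (use in_A A_zero in auto)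
  also have "\<dots> = (\<Sum>r\<le>length u. if r = length u then if v = rev u then 1 else 0 else 0)"
  proof (rule sum.cong)
    fix r assume "r \<in> {..length u}"
    have "\<phi> (wick X (take (length u - r) u @ drop r v)) = 0"
      if "match u v r" "r \<noteq> length u \<or> v \<noteq> rev u"
    proof (rule wick_centred)
      show "set (take (length u - r) u @ drop r v) \<subseteq> {..<N}"
        using assms set_take_subset set_drop_subset by fastforce
      show "take (length u - r) u @ drop r v \<noteq> []"
        using that by (auto simp: match_def)
    qed
    then show "\<phi> (if match u v r then wick X (take (length u - r) u @ drop r v) else 0) =
        (if r = length u then if v = rev u then 1 else 0 else 0)"
      using \<open>r \<in> {..length u}\<close> by (auto simp: state_zero state_unital match_def)
  qed simp
  also have "\<dots> = (if v = rev u then 1 else 0)" by simp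
  finally show ?thesis .
qed

text \<open>The discrete Wigner integral: the operator with coefficients \<open>f\<close> in the
  orthonormal Wick words of degree at most \<open>M\<close>.\<close>

definition J :: "nat \<Rightarrow> (nat list \<Rightarrow> complex) \<Rightarrow> 'h op" where
  "J M f = (\<Sum>v\<in>wordsle N M. scale_op (f v) (wick X v))"

lemma wick_A': "v \<in> wordsle N M \<Longrightarrow> wick X v \<in> A"
  by (rule wick_A) (simp add: wordsle_def)

lemma J_A: "J M f \<in> A"
  unfolding J_def by (intro A_sum A_scale) (rule wick_A')

lemma J_mono: "supp N M f \<Longrightarrow> M \<le> M' \<Longrightarrow> J M' f = J M f"
  unfolding J_def
  by (rule sum.mono_neutral_right[OF finite_wordsle]) (auto simp: supp_def wordsle_def)

lemma J_homog: "homog N n f \<Longrightarrow> n \<le> M \<Longrightarrow> J M f = (\<Sum>v\<in>words N n. scale_op (f v) (wick X v))"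
  unfolding J_def
  by (rule sum.mono_neutral_right[OF finite_wordsle]) (auto simp: homog_def words_def wordsle_def)

lemma J_add: "J M (\<lambda>v. f v + g v) = J M f + J M g"
  by (simp add: J_def scale_op_add_left sum.distrib)

lemma scale_op_sum: "scale_op a (sum F I) = (\<Sum>i\<in>I. scale_op a (F i))"
  by (induction I rule: infinite_finite_induct) (auto simp: scale_op_add_right)

lemma J_scale: "J M (\<lambda>v. a * f v) = scale_op a (J M f)"
  by (simp add: J_def scale_op_sum)

lemma scale_op_sum_left: "scale_op (sum a I) T = (\<Sum>i\<in>I. scale_op (a i) T)"
  by (induction I rule: infinite_finite_induct) (auto simp: scale_op_add_left)

lemma J_sum: "J M (\<lambda>v. \<Sum>r\<in>R. f r v) = (\<Sum>r\<in>R. J M (f r))"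
  by (simp add: J_def scale_op_sum_left) (rule sum.swap)

lemma adj_sum: "(\<And>i. i \<in> I \<Longrightarrow> F i \<in> A) \<Longrightarrow> adj (sum F I) = (\<Sum>i\<in>I. adj (F i))"
proof (induction I rule: infinite_finite_induct)
  case (insert i I)
  then show ?case by (simp add: adj_add A_BH A_sum)
qed auto

lemma adj_J: "adj (J M f) = J M (star f)"
proof -
  have "adj (J M f) = (\<Sum>v\<in>wordsle N M. scale_op (cnj (f v)) (wick X (rev v)))"
    unfolding J_def
    by (subst adj_sum) (auto simp: A_scale wick_A' adj_scale_op A_BH adj_wick wordsle_def wick_A intro!: sum.cong)
  also have "\<dots> = J M (star f)"
    unfolding J_def star_def
    by (rule sum.reindex_bij_witness[where i = rev and j = rev]) (auto simp: wordsle_def)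
  finally show ?thesis .
qed

lemma state_J_compose: "\<phi> (J M f o\<^sub>L J M g) = (\<Sum>v\<in>wordsle N M. f (rev v) * g v)"
proof -
  have "\<phi> (J M f o\<^sub>L J M g) =
      (\<Sum>v\<in>wordsle N M. \<Sum>u\<in>wordsle N M. f u * g v * \<phi> (wick X u o\<^sub>L wick X v))"
  proof -
    have in_A: "scale_op (f u * g v) (wick X u o\<^sub>L wick X v) \<in> A"
      if "u \<in> wordsle N M" "v \<in> wordsle N M" for u v
      using that by (intro A_intros wick_A')
    have "J M f o\<^sub>L J M g =
        (\<Sum>v\<in>wordsle N M. \<Sum>u\<in>wordsle N M. scale_op (f u * g v) (wick X u o\<^sub>L wick X v))"
      unfolding J_def compose_sum_left compose_sum_right
      by (intro sum.cong refl) (simp add: compose_scale_op_left compose_scale_op_right A_BH wick_A')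
    also have "\<phi> \<dots> = (\<Sum>v\<in>wordsle N M. \<phi> (\<Sum>u\<in>wordsle N M. scale_op (f u * g v) (wick X u o\<^sub>L wick X v)))"
      by (intro state_sum A_sum in_A)
    also have "\<dots> = (\<Sum>v\<in>wordsle N M. \<Sum>u\<in>wordsle N M. \<phi> (scale_op (f u * g v) (wick X u o\<^sub>L wick X v)))"
      by (intro sum.cong refl state_sum in_A)
    also have "\<dots> = (\<Sum>v\<in>wordsle N M. \<Sum>u\<in>wordsle N M. f u * g v * \<phi> (wick X u o\<^sub>L wick X v))"
      by (intro sum.cong refl state_scale A_compose wick_A')
    finally show ?thesis .
  qed
  also have "\<dots> = (\<Sum>v\<in>wordsle N M. \<Sum>u\<in>wordsle N M. if u = rev v then f u * g v else 0)"
  proof (intro sum.cong refl)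
    fix v u assume "v \<in> wordsle N M" "u \<in> wordsle N M"
    then have "\<phi> (wick X u o\<^sub>L wick X v) = (if v = rev u then 1 else 0)"
      by (intro state_wick_compose) (auto simp: wordsle_def)
    moreover have "v = rev u \<longleftrightarrow> u = rev v" by auto
    ultimately show "f u * g v * \<phi> (wick X u o\<^sub>L wick X v) = (if u = rev v then f u * g v else 0)"
      by simp
  qed
  also have "\<dots> = (\<Sum>v\<in>wordsle N M. f (rev v) * g v)"
  proof (rule sum.cong)
    fix v assume "v \<in> wordsle N M"
    then have "rev v \<in> wordsle N M" by (simp add: wordsle_def)
    then show "(\<Sum>u\<in>wordsle N M. if u = rev v then f u * g v else 0) = f (rev v) * g v"
      by simp
  qed simp
  finally show ?thesis .
qed

text \<open>The Wigner isometry on a grid.\<close>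

lemma n2_J: "(n2 (J M f))\<^sup>2 = sq N M f"
proof -
  have "complex_of_real ((n2 (J M f))\<^sup>2) = \<phi> (J M (star f) o\<^sub>L J M f)"
    by (simp only: state_adj_self[OF J_A, symmetric] adj_J)
  also have "\<dots> = complex_of_real (sq N M f)"
    by (simp add: state_J_compose sq_def star_def complex_norm_square[unfolded of_real_power] mult.commute)
  finally show ?thesis by (simp only: of_real_eq_iff)
qed

lemma n2_J': "n2 (J M f) = sqrt (sq N M f)"
  using n2_J n2_nonneg[OF J_A] by (metis real_sqrt_unique)

text \<open>The products of Wick words are sorted by the number r of contracted letters: an argument
  of \<open>f\<close> splits as \<open>p @ s\<close>, the matching argument of \<open>g\<close> as
  \<open>rev s @ q\<close>, and \<open>p @ q\<close> remains. This is the multiplication formula for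
  Wigner integrals.\<close>

lemma J_product:
  assumes f: "homog N n f" and g: "supp N M g"
  shows "J n f o\<^sub>L J M g = (\<Sum>r\<le>n. J (n + M) (contr N n r f g))"
proof -
  have "J n f o\<^sub>L J M g =
      (\<Sum>u\<in>words N n. \<Sum>v\<in>wordsle N M. scale_op (f u * g v) (wick X u o\<^sub>L wick X v))"
    unfolding J_homog[OF f order_refl] unfolding J_def compose_sum_left compose_sum_right
    by (subst sum.swap, intro sum.cong refl)
      (simp add: compose_scale_op_left compose_scale_op_right A_BH wick_A wick_A' words_def)
  also have "\<dots> = (\<Sum>u\<in>words N n. \<Sum>v\<in>wordsle N M. \<Sum>r\<le>n. scale_op (f u * g v)
      (if match u v r then wick X (take (n - r) u @ drop r v) else 0))"
    unfolding wick_product scale_op_sum by (intro sum.cong refl) (auto simp: words_def)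
  also have "\<dots> = (\<Sum>u\<in>words N n. \<Sum>r\<le>n. \<Sum>v\<in>wordsle N M. scale_op (f u * g v)
      (if match u v r then wick X (take (n - r) u @ drop r v) else 0))"
    by (rule sum.cong[OF refl], rule sum.swap)
  also have "\<dots> = (\<Sum>r\<le>n. \<Sum>u\<in>words N n. \<Sum>v\<in>wordsle N M. scale_op (f u * g v)
      (if match u v r then wick X (take (n - r) u @ drop r v) else 0))"
    by (rule sum.swap)
  also have "\<dots> = (\<Sum>r\<le>n. J (n + M) (contr N n r f g))"
  proof (rule sum.cong)
    fix r assume "r \<in> {..n}"
    then have r: "r \<le> n" by simp
    \<comment> \<open>For fixed \<open>p\<close> and \<open>s\<close> the words that match are those
      beginning with \<open>rev s\<close>. The sum over the rest \<open>q\<close> is then enlarged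
      to a range common to all \<open>s\<close>; the new terms vanish because \<open>g\<close> has
      degree at most \<open>M\<close>.\<close>
    have inner: "(\<Sum>v\<in>wordsle N M. scale_op (f (p @ s) * g v)
        (if match (p @ s) v r then wick X (take (n - r) (p @ s) @ drop r v) else 0)) =
       (\<Sum>q\<in>wordsle N (M + r). scale_op (f (p @ s) * g (rev s @ q)) (wick X (p @ q)))"
      if p: "p \<in> words N (n - r)" and s: "s \<in> words N r" for p s
    proof -
      have m: "match (p @ s) v r \<longleftrightarrow> r \<le> length v \<and> take r v = rev s" for v
        using p s r by (auto simp: match_def words_def)
      have t: "take (n - r) (p @ s) = p"
        using p by (simp add: words_def)
      have "(\<Sum>v\<in>wordsle N M. scale_op (f (p @ s) * g v)
          (if match (p @ s) v r then wick X (take (n - r) (p @ s) @ drop r v) else 0)) =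
        (\<Sum>v | v \<in> wordsle N M \<and> r \<le> length v \<and> take r v = rev s. scale_op (f (p @ s) * g v) (wick X (p @ drop r v)))"
        unfolding m t by (rule sum.mono_neutral_cong_right) auto
      also have "\<dots> = (\<Sum>q | q \<in> wordsle N (M + r) \<and> rev s @ q \<in> wordsle N M.
          scale_op (f (p @ s) * g (rev s @ q)) (wick X (p @ q)))"
        by (rule sum.reindex_bij_witness[where i = "\<lambda>q. rev s @ q" and j = "drop r"])
          (use s in \<open>auto simp: words_def wordsle_def dest: in_set_dropD\<close>,
           (metis append_take_drop_id)+)
      also have "\<dots> = (\<Sum>q\<in>wordsle N (M + r). scale_op (f (p @ s) * g (rev s @ q)) (wick X (p @ q)))"
        by (rule sum.mono_neutral_left) (use g in \<open>auto simp: supp_def\<close>)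
      finally show ?thesis .
    qed
    have "(\<Sum>u\<in>words N n. \<Sum>v\<in>wordsle N M. scale_op (f u * g v)
        (if match u v r then wick X (take (n - r) u @ drop r v) else 0)) =
      (\<Sum>p\<in>words N (n - r). \<Sum>s\<in>words N r. \<Sum>q\<in>wordsle N (M + r).
         scale_op (f (p @ s) * g (rev s @ q)) (wick X (p @ q)))"
    proof -
      have "n = (n - r) + r" using r by simp
      then have "words N n = words N ((n - r) + r)" by simp
      then show ?thesis
        by (simp only: sum_words_append) (intro sum.cong refl inner)
    qed
    also have "\<dots> = (\<Sum>p\<in>words N (n - r). \<Sum>q\<in>wordsle N (M + r).
        scale_op (\<Sum>s\<in>words N r. f (p @ s) * g (rev s @ q)) (wick X (p @ q)))"
      unfolding scale_op_sum_left by (rule sum.cong[OF refl], rule sum.swap)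
    also have "\<dots> = (\<Sum>p\<in>words N (n - r). \<Sum>q\<in>wordsle N (M + r).
        scale_op (contr N n r f g (p @ q)) (wick X (p @ q)))"
      by (intro sum.cong refl) (auto simp: contr_def words_def)
    also have "\<dots> = (\<Sum>w | w \<in> wordsle N ((n - r) + (M + r)) \<and> n - r \<le> length w.
        scale_op (contr N n r f g w) (wick X w))"
      by (rule sum_wordsle_append[symmetric])
    also have "\<dots> = J (n + M) (contr N n r f g)"
      unfolding J_def using r by (intro sum.mono_neutral_left) (auto simp: contr_def)
    finally show "(\<Sum>u\<in>words N n. \<Sum>v\<in>wordsle N M. scale_op (f u * g v)
        (if match u v r then wick X (take (n - r) u @ drop r v) else 0)) = J (n + M) (contr N n r f g)" .
  qed simp
  finally show ?thesis .
qed

text \<open>The factor n + 1 counts the contractions of orders 0 to n. It does not grow with the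
  degree \<open>M\<close> of the second factor, which is why the bound can be iterated.\<close>

lemma n2_J_compose_le:
  assumes f: "homog N n f" and g: "supp N M g"
  shows "n2 (J n f o\<^sub>L J M g) \<le> (real n + 1) * n2 (J n f) * n2 (J M g)"
proof -
  have "n2 (J n f o\<^sub>L J M g) \<le> (\<Sum>r\<le>n. n2 (J (n + M) (contr N n r f g)))"
    unfolding J_product[OF assms] by (rule n2_sum) (rule J_A)
  also have "\<dots> \<le> (\<Sum>r\<le>n. n2 (J n f) * n2 (J M g))"
    unfolding n2_J'
    by (intro sum_mono) (simp add: real_sqrt_mult[symmetric] sq_contr_le[OF assms])
  finally show ?thesis by (simp add: algebra_simps)
qed

lemma supp_sum: "(\<And>r. r \<in> R \<Longrightarrow> supp N M (f r)) \<Longrightarrow> supp N M (\<lambda>v. \<Sum>r\<in>R. f r v)"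
  by (auto simp: supp_def)

lemma J_product_ex:
  assumes f: "homog N n f" and g: "supp N M g"
  shows "\<exists>h. supp N (n + M) h \<and> J n f o\<^sub>L J M g = J (n + M) h"
  using supp_sum[of "{..n}" "n + M" "\<lambda>r. contr N n r f g"] supp_contr[OF assms]
  by (auto simp: J_product[OF assms] J_sum[symmetric])

text \<open>The vacuum vector, from which the powers of an operator are built up.\<close>

definition delta :: "nat list \<Rightarrow> complex" where
  "delta v = (if v = [] then 1 else 0)"

lemma supp_delta: "supp N M delta"
  by (simp add: supp_def delta_def wordsle_def)

lemma J_delta: "J M delta = id_blinfun"
proof -
  have "J M delta = (\<Sum>v\<in>{[]}. scale_op (delta v) (wick X v))"
    unfolding J_def by (rule sum.mono_neutral_right[OF finite_wordsle]) (auto simp: delta_def wordsle_def)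
  then show ?thesis by (simp add: delta_def)
qed

text \<open>The Haagerup inequality of Biane and Speicher: the bound on the 2-norm iterates to all powers of
  \<open>T\<^sup>* T\<close>, whose growth determines the operator norm of \<open>T\<close>.\<close>

lemma norm_J_le:
  assumes f: "homog N n f"
  shows "norm (J n f) \<le> (real n + 1) * n2 (J n f)"
proof -
  define C where "C = (real n + 1) * n2 (J n f)"
  have C: "C \<ge> 0" by (simp add: C_def n2_nonneg J_A)
  have n2_star: "n2 (J n (star f)) = n2 (J n f)"
    by (metis adj_J n2_adj J_A)
  \<comment> \<open>Every power raises the degree by 2 n, while the constant \<open>C\<close> stays
    the same.\<close>
  have pow: "\<exists>M h. supp N M h \<and> op_pow (adj (J n f) o\<^sub>L J n f) m = J M h \<and> n2 (J M h) \<le> (C\<^sup>2) ^ m" for m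
  proof (induction m)
    case 0
    have "n2 (J 0 delta) = 1"
      unfolding J_delta by (simp add: n2_def state_unital)
    then show ?case
      by (intro exI[of _ 0] exI[of _ delta]) (simp add: supp_delta J_delta)
  next
    case (Suc m)
    then obtain M h where h: "supp N M h" "op_pow (adj (J n f) o\<^sub>L J n f) m = J M h" "n2 (J M h) \<le> (C\<^sup>2) ^ m"
      by blast
    obtain h1 where h1: "supp N (n + M) h1" "J n f o\<^sub>L J M h = J (n + M) h1"
      using J_product_ex[OF f h(1)] by blast
    obtain h2 where h2: "supp N (n + (n + M)) h2" "J n (star f) o\<^sub>L J (n + M) h1 = J (n + (n + M)) h2"
      using J_product_ex[OF homog_star[OF f] h1(1)] by blast
    have "op_pow (adj (J n f) o\<^sub>L J n f) (Suc m) = J (n + (n + M)) h2"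
      by (simp only: op_pow_Suc h(2) compose_assoc h1(2)) (simp only: adj_J h2)
    moreover have "n2 (J (n + (n + M)) h2) \<le> (C\<^sup>2) ^ Suc m"
    proof -
      have "n2 (J (n + (n + M)) h2) \<le> C * n2 (J (n + M) h1)"
        using n2_J_compose_le[OF homog_star[OF f] h1(1)] by (simp add: h2 C_def n2_star)
      also have "n2 (J (n + M) h1) \<le> C * n2 (J M h)"
        using n2_J_compose_le[OF f h(1)] by (simp add: h1 C_def)
      also have "C * n2 (J M h) \<le> C * (C\<^sup>2) ^ m"
        using C h by (intro mult_left_mono)
      finally show ?thesis
        using C by (simp add: mult_left_mono power2_eq_square mult.assoc)
    qed
    ultimately show ?case using h2(1) by blast
  qed
  have "(norm (J n f))\<^sup>2 \<le> C\<^sup>2"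
  proof (rule norm_square_le_of_n2_growth[OF J_A])
    show "n2 (op_pow (adj (J n f) o\<^sub>L J n f) m) \<le> (C\<^sup>2) ^ m" for m
      using pow[of m] by auto
  qed simp
  then show ?thesis
    using C unfolding C_def[symmetric] by (rule power2_le_imp_le)
qed

end

section \<open>Contraction estimates\<close>

lemma sq_contr_0:
  assumes f: "homog N n f" and g: "supp N M g"
  shows "sq N (n + M) (contr N n 0 f g) = sq N n f * sq N M g"
proof -
  have "sq N (n + M) (contr N n 0 f g) =
      (\<Sum>p\<in>words N n. \<Sum>q\<in>wordsle N M. (cmod (f p))\<^sup>2 * (cmod (g q))\<^sup>2)"
    unfolding sq_contr_sum[OF f g le0] by (simp add: norm_mult power_mult_distrib)
  then show ?thesis
    by (simp add: sq_homog[OF f] sq_def[of N M] sum_product)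
qed

lemma starD: "star f = f \<Longrightarrow> f (rev v) = cnj (f v)"
  by (metis complex_cnj_cnj star_def)

lemma contr_full:
  "contr N n n f g [] = (\<Sum>s\<in>words N n. f s * g (rev s))"
  by (simp add: contr_def)

lemma sq_contr_full:
  assumes f: "homog N n f" and g: "homog N n g"
  shows "sq N (n + n) (contr N n n f g) = (cmod (contr N n n f g []))\<^sup>2"
proof -
  have "homog N 0 (contr N n n f g)"
    using homog_contr[OF f g order_refl] by simp
  then have "sq N (n + n) (contr N n n f g) = (\<Sum>v\<in>words N 0. (cmod (contr N n n f g v))\<^sup>2)"
    by (rule sq_homog) simp
  then show ?thesis by simp
qed

lemma contr_full_self:
  assumes f: "homog N n f" "star f = f"
  shows "contr N n n f f [] = of_real (sq N n f)"
proof -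
  have "contr N n n f f [] = (\<Sum>s\<in>words N n. f s * cnj (f s))"
    using f by (simp add: contr_full starD)
  then show ?thesis
    by (simp add: sq_homog[OF f(1) order_refl] complex_norm_square[unfolded of_real_power])
qed

text \<open>Expanding the square and summing first over the free variables of \<open>f\<close> and of \<open>g\<close> leaves, by mirror
  symmetry, the inner product of a self-contraction of \<open>f\<close> with one of \<open>g\<close>.\<close>

lemma sq_contr_le_self_contr:
  assumes f: "homog N n f" "star f = f" and g: "homog N m g" "star g = g"
    and r: "r \<le> n" "r \<le> m"
  shows "sq N (n + m) (contr N n r f g) \<le>
    sqrt (sq N (n + n) (contr N n (n - r) f f)) * sqrt (sq N (m + m) (contr N m (m - r) g g))"
proof -
  \<comment> \<open>Gram matrices in the contracted letters: \<open>F s s'\<close> is the sum of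
    \<open>f (p @ s) * cnj (f (p @ s'))\<close> over the free letters \<open>p\<close>, and mirror
    symmetry rewrites it as a contraction of \<open>f\<close> with itself of order n - r.
    \<open>G\<close> does the same for \<open>g\<close>.\<close>
  define F where "F s s' = contr N n (n - r) f f (rev s' @ s)" for s s'
  define G where "G s s' = contr N m (m - r) g g (rev s @ s')" for s s'
  define W where "W = words N r \<times> words N r"
  have F: "F s s' = (\<Sum>p\<in>words N (n - r). f (p @ s) * cnj (f (p @ s')))"
    if "s \<in> words N r" "s' \<in> words N r" for s s'
  proof -
    have "F s s' = (\<Sum>p\<in>words N (n - r). f (rev s' @ p) * f (rev p @ s))"
      using that r by (simp add: F_def contr_def words_def)
    also have "\<dots> = (\<Sum>p\<in>words N (n - r). f (rev s' @ rev p) * f (rev (rev p) @ s))"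
      by (rule sum_words_rev[symmetric])
    also have "\<dots> = (\<Sum>p\<in>words N (n - r). f (p @ s) * cnj (f (p @ s')))"
      by (intro sum.cong refl) (simp add: starD[OF f(2), of "_ @ _", simplified] mult.commute)
    finally show ?thesis .
  qed
  have G: "G s s' = (\<Sum>q\<in>words N (m - r). g (rev s @ q) * cnj (g (rev s' @ q)))"
    if "s \<in> words N r" "s' \<in> words N r" for s s'
  proof -
    have "G s s' = (\<Sum>q\<in>words N (m - r). g (rev s @ q) * g (rev q @ s'))"
      using that r by (simp add: G_def contr_def words_def)
    also have "\<dots> = (\<Sum>q\<in>words N (m - r). g (rev s @ q) * cnj (g (rev s' @ q)))"
      using starD[OF g(2), of "rev s' @ _"] by (intro sum.cong refl) simp
    finally show ?thesis .
  qed
  have "complex_of_real (sq N (n + m) (contr N n r f g)) =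
     (\<Sum>p\<in>words N (n - r). \<Sum>q\<in>wordsle N (m + r). complex_of_real ((cmod (\<Sum>s\<in>words N r. f (p @ s) * g (rev s @ q)))\<^sup>2))"
    using sq_contr_sum[OF f(1) homog_imp_supp[OF g(1) order_refl] r(1)] by simp
  also have "\<dots> = (\<Sum>p\<in>words N (n - r). \<Sum>q\<in>words N (m - r). complex_of_real ((cmod (\<Sum>s\<in>words N r. f (p @ s) * g (rev s @ q)))\<^sup>2))"
  proof (rule sum.cong[OF refl], rule sum.mono_neutral_right)
    show "words N (m - r) \<subseteq> wordsle N (m + r)"
      by (rule words_subset_wordsle) simp
    fix p
    show "\<forall>q\<in>wordsle N (m + r) - words N (m - r).
        complex_of_real ((cmod (\<Sum>s\<in>words N r. f (p @ s) * g (rev s @ q)))\<^sup>2) = 0"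
    proof
      fix q assume q: "q \<in> wordsle N (m + r) - words N (m - r)"
      have "g (rev s @ q) = 0" if "s \<in> words N r" for s
        using q that g(1) by (auto simp: homog_def words_def wordsle_def)
      then show "complex_of_real ((cmod (\<Sum>s\<in>words N r. f (p @ s) * g (rev s @ q)))\<^sup>2) = 0"
        by simp
    qed
  qed simp
  also have "\<dots> = (\<Sum>p\<in>words N (n - r). \<Sum>q\<in>words N (m - r). \<Sum>(s, s')\<in>W.
      (f (p @ s) * cnj (f (p @ s'))) * (g (rev s @ q) * cnj (g (rev s' @ q))))"
    unfolding complex_norm_square cnj_sum sum_product W_def sum.cartesian_product[symmetric]
    by (intro sum.cong refl) (simp add: ac_simps)
  also have "\<dots> = (\<Sum>p\<in>words N (n - r). \<Sum>(s, s')\<in>W. \<Sum>q\<in>words N (m - r).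
      (f (p @ s) * cnj (f (p @ s'))) * (g (rev s @ q) * cnj (g (rev s' @ q))))"
    unfolding case_prod_beta by (rule sum.cong[OF refl], rule sum.swap)
  also have "\<dots> = (\<Sum>(s, s')\<in>W. \<Sum>p\<in>words N (n - r). \<Sum>q\<in>words N (m - r).
      (f (p @ s) * cnj (f (p @ s'))) * (g (rev s @ q) * cnj (g (rev s' @ q))))"
    unfolding case_prod_beta by (rule sum.swap)
  also have "\<dots> = (\<Sum>(s, s')\<in>W. F s s' * G s s')"
    by (rule sum.cong) (auto simp: W_def F G sum_product)
  finally have eq: "complex_of_real (sq N (n + m) (contr N n r f g)) = (\<Sum>z\<in>W. F (fst z) (snd z) * G (fst z) (snd z))"
    by (simp add: case_prod_beta)
  then have "(cmod (complex_of_real (sq N (n + m) (contr N n r f g))))\<^sup>2 \<le>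
      (\<Sum>z\<in>W. (cmod (F (fst z) (snd z)))\<^sup>2) * (\<Sum>z\<in>W. (cmod (G (fst z) (snd z)))\<^sup>2)"
    using cmod_sum_mult_square[of "\<lambda>z. F (fst z) (snd z)" "\<lambda>z. G (fst z) (snd z)" W] by metis
  also have "(\<Sum>z\<in>W. (cmod (F (fst z) (snd z)))\<^sup>2) \<le> sq N (n + n) (contr N n (n - r) f f)"
  proof -
    have "(\<Sum>z\<in>W. (cmod (F (fst z) (snd z)))\<^sup>2) =
        (\<Sum>s\<in>words N r. \<Sum>s'\<in>words N r. (cmod (contr N n (n - r) f f (rev s' @ s)))\<^sup>2)"
      unfolding W_def F_def sum.cartesian_product by (simp add: case_prod_beta)
    also have "\<dots> = (\<Sum>s\<in>words N r. \<Sum>s'\<in>words N r. (cmod (contr N n (n - r) f f (s' @ s)))\<^sup>2)"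
      by (intro sum.cong refl sum_words_rev)
    also have "\<dots> = (\<Sum>s'\<in>words N r. \<Sum>s\<in>words N r. (cmod (contr N n (n - r) f f (s' @ s)))\<^sup>2)"
      by (rule sum.swap)
    also have "\<dots> = (\<Sum>w\<in>words N (r + r). (cmod (contr N n (n - r) f f w))\<^sup>2)"
      by (rule sum_words_append[symmetric])
    also have "\<dots> \<le> sq N (n + n) (contr N n (n - r) f f)"
      unfolding sq_def using r by (intro sum_mono2 words_subset_wordsle) auto
    finally show ?thesis .
  qed
  also have "(\<Sum>z\<in>W. (cmod (G (fst z) (snd z)))\<^sup>2) \<le> sq N (m + m) (contr N m (m - r) g g)"
  proof -
    have "(\<Sum>z\<in>W. (cmod (G (fst z) (snd z)))\<^sup>2) =
        (\<Sum>s\<in>words N r. \<Sum>s'\<in>words N r. (cmod (contr N m (m - r) g g (rev s @ s')))\<^sup>2)"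
      unfolding W_def G_def sum.cartesian_product by (simp add: case_prod_beta)
    also have "\<dots> = (\<Sum>s\<in>words N r. \<Sum>s'\<in>words N r. (cmod (contr N m (m - r) g g (s @ s')))\<^sup>2)"
      by (rule sum_words_rev)
    also have "\<dots> = (\<Sum>w\<in>words N (r + r). (cmod (contr N m (m - r) g g w))\<^sup>2)"
      by (rule sum_words_append[symmetric])
    also have "\<dots> \<le> sq N (m + m) (contr N m (m - r) g g)"
      unfolding sq_def using r by (intro sum_mono2 words_subset_wordsle) auto
    finally show ?thesis .
  qed
  finally have "(sq N (n + m) (contr N n r f g))\<^sup>2 \<le>
      sq N (n + n) (contr N n (n - r) f f) * sq N (m + m) (contr N m (m - r) g g)"
    by (simp add: sq_nonneg mult_right_mono sum_nonneg mult_left_mono)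
  then have "sqrt ((sq N (n + m) (contr N n r f g))\<^sup>2) \<le>
      sqrt (sq N (n + n) (contr N n (n - r) f f) * sq N (m + m) (contr N m (m - r) g g))"
    by (rule real_sqrt_le_mono)
  then show ?thesis
    by (simp add: real_sqrt_mult sq_nonneg)
qed

text \<open>\<open>contr\<close> of order 0 is the tensor product. With at most m contracted letters
  only the first factor is reached, and \<open>h\<close> is a spectator.\<close>

lemma contr_tensor_le:
  assumes "r \<le> n" "r \<le> m"
  shows "contr N n r f (contr N m 0 g h) = contr N (n + m - 2 * r) 0 (contr N n r f g) h"
proof
  fix w
  show "contr N n r f (contr N m 0 g h) w = contr N (n + m - 2 * r) 0 (contr N n r f g) h w"
  proof (cases "n + m - 2 * r \<le> length w")
    case True
    have inner: "contr N m 0 g h (rev s @ drop (n - r) w) =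
        g (rev s @ drop (n - r) (take (n + m - 2 * r) w)) * h (drop (n + m - 2 * r) w)"
      if "s \<in> words N r" for s
    proof -
      have s: "length s = r" using that by (simp add: words_def)
      have e: "n + m - 2 * r - (n - r) = m - r" "m - r + (n - r) = n + m - 2 * r"
        using assms by auto
      have "m \<le> r + (length w - (n - r))" using True assms by linarith
      then show ?thesis
        using s assms by (simp add: contr_def drop_take e)
    qed
    have "contr N n r f (contr N m 0 g h) w =
       (\<Sum>s\<in>words N r. f (take (n - r) w @ s) * (g (rev s @ drop (n - r) (take (n + m - 2 * r) w)) * h (drop (n + m - 2 * r) w)))"
    proof -
      have "n - r \<le> length w" using True assms by linarith
      then show ?thesis
        unfolding contr_def[of N n r f "contr N m 0 g h"] by (auto simp: inner intro!: sum.cong)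
    qed
    moreover have "min (n - r) (n + m - 2 * r) = n - r" "n - r \<le> n + m - 2 * r"
      using assms by auto
    ultimately show ?thesis
      using True by (simp add: contr_def[of N "n + m - 2 * r"] contr_def[of N n r f g] sum_distrib_right mult.assoc min.absorb2)
  next
    case False
    have "contr N m 0 g h (rev s @ drop (n - r) w) = 0" if "s \<in> words N r" "n - r \<le> length w" for s
      using that False assms by (auto simp: contr_def words_def)
    then show ?thesis
      using False by (auto simp: contr_def[of N n r f "contr N m 0 g h"] contr_def[of N "n + m - 2 * r"] intro!: sum.neutral)
  qed
qed

text \<open>The contraction uses up \<open>g\<close> and continues into \<open>h\<close>: the last m
  letters of \<open>f\<close> are paired with \<open>g\<close>, the r - m letters before them with
  the beginning of \<open>h\<close>.\<close>

lemma contr_tensor_ge: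
  assumes "m \<le> r" "r \<le> n"
  shows "contr N n r f (contr N m 0 g h) = contr N (n - m) (r - m) (contr N n m f g) h"
proof
  fix w
  have e: "n - m - (r - m) = n - r" using assms by simp
  show "contr N n r f (contr N m 0 g h) w = contr N (n - m) (r - m) (contr N n m f g) h w"
  proof (cases "n - r \<le> length w")
    case True
    have "contr N n r f (contr N m 0 g h) w =
        (\<Sum>s\<in>words N ((r - m) + m). f (take (n - r) w @ s) * contr N m 0 g h (rev s @ drop (n - r) w))"
      using True assms by (simp add: contr_def[of N n r])
    also have "\<dots> = (\<Sum>s1\<in>words N (r - m). \<Sum>s2\<in>words N m. f (take (n - r) w @ s1 @ s2) *
        (g (rev s2) * h (rev s1 @ drop (n - r) w)))"
    proof -
      have "contr N m 0 g h (rev (s1 @ s2) @ drop (n - r) w) = g (rev s2) * h (rev s1 @ drop (n - r) w)"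
        if "s2 \<in> words N m" for s1 s2
      proof -
        have "length s2 = m" using that by (simp add: words_def)
        then show ?thesis by (simp add: contr_def)
      qed
      then show ?thesis
        unfolding sum_words_append by (intro sum.cong refl) simp
    qed
    also have "\<dots> = contr N (n - m) (r - m) (contr N n m f g) h w"
      using True assms unfolding contr_def[of N "n - m"] e
      by (auto simp: contr_def words_def sum_distrib_right mult.assoc intro!: sum.cong)
    finally show ?thesis .
  next
    case False
    then show ?thesis
      unfolding contr_def[of N n r] contr_def[of N "n - m" "r - m"] e by simp
  qed
qed

text \<open>Whether the contraction stops inside \<open>g\<close> or goes on into \<open>h\<close>,
  it factors through a contraction of \<open>f\<close> with \<open>g\<close> alone. Estimates for
  long tensors are thus reduced to pairs of kernels.\<close>

lemma sq_contr_tensor_le: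
  assumes f: "homog N n f" and g: "homog N m g" and h: "homog N l h" and r: "r \<le> n"
  shows "sq N (n + (m + l)) (contr N n r f (contr N m 0 g h)) \<le>
     sq N (n + m) (contr N n (min r m) f g) * sq N l h"
proof -
  let ?r = "min r m"
  have r': "?r \<le> n" using r by simp
  have c: "homog N (n + m - 2 * ?r) (contr N n ?r f g)"
    by (rule homog_contr[OF f g r'])
  have sqc: "sq N (n + m - 2 * ?r) (contr N n ?r f g) = sq N (n + m) (contr N n ?r f g)"
    using sq_homog[OF c] by simp
  show ?thesis
  proof (cases "r \<le> m")
    case True
    have eq: "contr N n r f (contr N m 0 g h) = contr N (n + m - 2 * r) 0 (contr N n r f g) h"
      by (rule contr_tensor_le) (use r True in auto)
    have "supp N (n + m - 2 * r + l) (contr N (n + m - 2 * r) 0 (contr N n r f g) h)"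
      using supp_contr[OF c homog_imp_supp[OF h order_refl] le0] True by (simp add: min_def)
    then have "sq N (n + (m + l)) (contr N n r f (contr N m 0 g h)) =
        sq N (n + m - 2 * r + l) (contr N (n + m - 2 * r) 0 (contr N n r f g) h)"
      unfolding eq by (rule sq_mono) simp
    also have "\<dots> = sq N (n + m - 2 * r) (contr N n r f g) * sq N l h"
      using sq_contr_0[OF c homog_imp_supp[OF h order_refl]] True by (simp add: min_def)
    finally show ?thesis using sqc True by (simp add: min_def)
  next
    case False
    then have m: "?r = m" "n + m - 2 * m = n - m" "m \<le> n" "m \<le> r" using r by auto
    have eq: "contr N n r f (contr N m 0 g h) = contr N (n - m) (r - m) (contr N n m f g) h"
      by (rule contr_tensor_ge) (use r m in auto)
    have c': "homog N (n - m) (contr N n m f g)" using c m by simp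
    have le: "r - m \<le> n - m" using r by simp
    have "supp N (n - m + l) (contr N (n - m) (r - m) (contr N n m f g) h)"
      using supp_contr[OF c' homog_imp_supp[OF h order_refl] le] .
    then have "sq N (n + (m + l)) (contr N n r f (contr N m 0 g h)) =
        sq N (n - m + l) (contr N (n - m) (r - m) (contr N n m f g) h)"
      unfolding eq by (rule sq_mono) simp
    also have "\<dots> \<le> sq N (n - m) (contr N n m f g) * sq N l h"
      by (rule sq_contr_le[OF c' homog_imp_supp[OF h order_refl] le])
    finally show ?thesis using sqc m by simp
  qed
qed

lemma contr_0_0: "homog N 0 f \<Longrightarrow> contr N 0 0 f h w = f [] * h w"
  by (simp add: contr_def)

section \<open>Tensor words\<close>

text \<open>The tensor product of the kernels named by a word, \<open>contr\<close> of order 0 being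
  the tensor product and the vacuum the empty one.\<close>

fun tens :: "nat \<Rightarrow> (nat \<Rightarrow> nat) \<Rightarrow> (nat \<Rightarrow> nat list \<Rightarrow> complex) \<Rightarrow> nat list \<Rightarrow> nat list \<Rightarrow> complex" where
  "tens N n f [] = (\<lambda>v. if v = [] then 1 else 0)"
| "tens N n f (i # w) = contr N (n i) 0 (f i) (tens N n f w)"

lemma homog_tens: "(\<And>i. i \<in> set w \<Longrightarrow> homog N (n i) (f i)) \<Longrightarrow> homog N (sum_list (map n w)) (tens N n f w)"
proof (induction w)
  case (Cons i w)
  then show ?case
    using homog_contr[of N "n i" "f i" "sum_list (map n w)" "tens N n f w" 0] by simp
qed (simp add: homog_def)

lemma sq_tens: "(\<And>i. i \<in> set w \<Longrightarrow> homog N (n i) (f i)) \<Longrightarrow>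
  sq N (sum_list (map n w)) (tens N n f w) = (\<Prod>i\<leftarrow>w. sq N (n i) (f i))"
proof (induction w)
  case Nil
  have "homog N 0 (tens N n f [])" by (simp add: homog_def)
  from sq_homog[OF this, of 0] show ?case by simp
next
  case (Cons i w)
  then show ?case
    using sq_contr_0[of N "n i" "f i" "sum_list (map n w)" "tens N n f w"]
      homog_imp_supp[OF homog_tens[of w N n f] order_refl] by simp
qed

context free_semicircular_system
begin

lemma contr_full_state:
  assumes "homog N n f" "homog N n g"
  shows "contr N n n f g [] = \<phi> (J n f o\<^sub>L J n g)"
proof -
  have "(\<Sum>s\<in>words N n. f s * g (rev s)) = (\<Sum>s\<in>words N n. f (rev s) * g (rev (rev s)))"
    by (rule sum_words_rev[symmetric])
  also have "\<dots> = (\<Sum>v\<in>wordsle N n. f (rev v) * g v)"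
    by (rule sum.mono_neutral_cong_left[OF finite_wordsle]) (use assms in \<open>auto simp: words_def wordsle_def homog_def\<close>)
  finally show ?thesis
    by (simp add: state_J_compose contr_full)
qed

text \<open>Words of different lengths are never reverses of each other, so integrals of different
  orders are orthogonal.\<close>

lemma state_J_compose_distinct_degree:
  assumes "homog N n f" "homog N m g" "n \<noteq> m"
  shows "\<phi> (J n f o\<^sub>L J m g) = 0"
proof -
  define M where "M = max n m"
  have "J n f = J M f" "J m g = J M g"
    using J_mono[OF homog_imp_supp[OF assms(1) order_refl], of M]
      J_mono[OF homog_imp_supp[OF assms(2) order_refl], of M] by (simp_all add: M_def)
  moreover have "f (rev v) * g v = 0" for v
  proof (cases "length v = m")
    case True
    then have "rev v \<notin> words N n" using assms(3) by (simp add: words_def)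
    then show ?thesis using assms(1) by (simp add: homog_def)
  next
    case False
    then show ?thesis using assms(2) by (simp add: homog_def words_def)
  qed
  ultimately show ?thesis by (simp only: state_J_compose sum.neutral_const)
qed

text \<open>By self-adjointness the fourth moment is the squared 2-norm of the square. The
  contraction of order r has degree 2 n - 2 r, so different orders are orthogonal and their squared
  norms add; the orders 0 and n give one square of the variance each.\<close>

lemma fourth_moment:
  assumes f: "homog N n f" "star f = f" and n: "n \<ge> 1"
  shows "\<phi> (op_pow (J n f) 4) =
    of_real (2 * (sq N n f)\<^sup>2 + (\<Sum>r\<in>{1..<n}. sq N (n + n) (contr N n r f f)))"
proof -
  let ?Y = "J n f"
  have s: "supp N n f" by (rule homog_imp_supp[OF f(1) order_refl])
  have adjY: "adj ?Y = ?Y" by (simp add: adj_J f)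
  have "op_pow ?Y 4 = (?Y o\<^sub>L ?Y) o\<^sub>L (?Y o\<^sub>L ?Y)"
    by (simp add: numeral_eq_Suc op_pow_Suc compose_assoc)
  also have "\<dots> = adj (?Y o\<^sub>L ?Y) o\<^sub>L (?Y o\<^sub>L ?Y)"
    by (simp add: adj_compose A_BH J_A adjY)
  finally have "\<phi> (op_pow ?Y 4) = of_real ((n2 (?Y o\<^sub>L ?Y))\<^sup>2)"
    by (simp only: state_adj_self[OF A_compose[OF J_A J_A]])
  also have "(n2 (?Y o\<^sub>L ?Y))\<^sup>2 = sq N (n + n) (\<lambda>w. \<Sum>r\<le>n. contr N n r f f w)"
    by (simp add: J_product[OF f(1) s] n2_J J_sum[symmetric])
  also have "\<dots> = (\<Sum>r\<le>n. sq N (n + n) (contr N n r f f))"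
  proof -
    have h: "homog N (n + n - 2 * r) (contr N n r f f)" if "r \<le> n" for r
      by (rule homog_contr[OF f(1) f(1) that])
    have "(cmod (\<Sum>r\<le>n. contr N n r f f w))\<^sup>2 = (\<Sum>r\<le>n. (cmod (contr N n r f f w))\<^sup>2)" for w
    proof (cases "\<exists>r\<le>n. contr N n r f f w \<noteq> 0")
      case True
      then obtain r where r: "r \<le> n" "contr N n r f f w \<noteq> 0" by blast
      have lw: "length w = n + n - 2 * r"
        using h[OF r(1)] r(2) by (auto simp: homog_def words_def)
      have z: "contr N n r' f f w = 0" if "r' \<le> n" "r' \<noteq> r" for r'
      proof (rule ccontr)
        assume "contr N n r' f f w \<noteq> 0"
        then have "length w = n + n - 2 * r'"
          using h[OF that(1)] by (auto simp: homog_def words_def)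
        then show False using lw that r(1) by linarith
      qed
      have "(\<Sum>r\<le>n. contr N n r f f w) = (\<Sum>r\<in>{r}. contr N n r f f w)"
        by (rule sum.mono_neutral_right) (use r z in auto)
      moreover have "(\<Sum>r\<le>n. (cmod (contr N n r f f w))\<^sup>2) = (\<Sum>r\<in>{r}. (cmod (contr N n r f f w))\<^sup>2)"
        by (rule sum.mono_neutral_right) (use r z in auto)
      ultimately show ?thesis by simp
    qed auto
    then show ?thesis
      unfolding sq_def by (simp add: sum.swap[of _ "wordsle N (n + n)"])
  qed
  also have "{..n} = insert 0 (insert n {1..<n})" using n by auto
  also have "(\<Sum>r\<in>insert 0 (insert n {1..<n}). sq N (n + n) (contr N n r f f)) =
      sq N (n + n) (contr N n 0 f f) + (sq N (n + n) (contr N n n f f) + (\<Sum>r\<in>{1..<n}. sq N (n + n) (contr N n r f f)))"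
    using n by (subst sum.insert, simp, simp, subst sum.insert) simp_all
  also have "sq N (n + n) (contr N n 0 f f) = (sq N n f)\<^sup>2"
    by (simp add: sq_contr_0[OF f(1) s] power2_eq_square)
  also have "sq N (n + n) (contr N n n f f) = (sq N n f)\<^sup>2"
    by (simp add: sq_contr_full[OF f(1) f(1)] contr_full_self[OF f])
  finally show ?thesis by simp
qed

text \<open>In the product formula r = 0 is creation and a full contraction, with r = n i = n j, is
  annihilation with the covariance as its factor. Every other r contracts \<open>f i\<close> with
  \<open>f j\<close> in at least one variable without exhausting both kernels; these terms form the
  error.\<close>

lemma n2_J_compose_tens:
  assumes h: "\<And>l. l \<in> insert i (set (j # w)) \<Longrightarrow> homog N (n l) (f l)"
    and n: "\<And>l. l \<in> insert i (set (j # w)) \<Longrightarrow> n l \<ge> 1"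
  defines "T \<equiv> \<lambda>w. J (sum_list (map n w)) (tens N n f w)"
  shows "n2 ((J (n i) (f i) o\<^sub>L T (j # w)) - T (i # j # w)
      - scale_op (\<phi> (J (n i) (f i) o\<^sub>L J (n j) (f j))) (T w)) \<le>
    (\<Sum>r | r \<in> {1..n i} \<and> \<not> (r = n i \<and> r = n j).
        sqrt (sq N (n i + n j) (contr N (n i) (min r (n j)) (f i) (f j)) * (\<Prod>l\<leftarrow>w. sq N (n l) (f l))))"
proof -
  let ?l = "sum_list (map n w)"
  let ?c = "\<lambda>r. contr N (n i) r (f i) (contr N (n j) 0 (f j) (tens N n f w))"
  let ?M = "n i + (n j + ?l)"
  let ?R = "{r \<in> {1..n i}. \<not> (r = n i \<and> r = n j)}"
  have hi: "homog N (n i) (f i)" and hj: "homog N (n j) (f j)" and hw: "homog N ?l (tens N n f w)"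
    using h by (auto intro: homog_tens)
  have ni: "n i \<ge> 1" using n by simp
  have hjw: "homog N (n j + ?l) (contr N (n j) 0 (f j) (tens N n f w))"
    using homog_contr[OF hj hw le0] by simp
  have prod: "J (n i) (f i) o\<^sub>L T (j # w) = (\<Sum>r\<le>n i. J ?M (?c r))"
    using J_product[OF hi homog_imp_supp[OF hjw order_refl]] by (simp add: T_def)
  have T0: "J ?M (?c 0) = T (i # j # w)" by (simp add: T_def)
  \<comment> \<open>A full contraction of \<open>f i\<close> with \<open>f j\<close> has degree 0;
    its only coefficient, at the empty word, is the covariance.\<close>
  have full: "J ?M (?c (n i)) = scale_op (\<phi> (J (n i) (f i) o\<^sub>L J (n j) (f j))) (T w)" if e: "n i = n j"
  proof -
    have "?c (n i) = contr N 0 0 (contr N (n i) (n i) (f i) (f j)) (tens N n f w)"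
      using contr_tensor_le[of "n i" "n i" "n j" N "f i" "f j" "tens N n f w"] e by simp
    also have "\<dots> = (\<lambda>v. contr N (n i) (n i) (f i) (f j) [] * tens N n f w v)"
      using homog_contr[OF hi hj, of "n i"] e by (intro ext contr_0_0) simp
    finally have c: "?c (n i) = (\<lambda>v. \<phi> (J (n i) (f i) o\<^sub>L J (n j) (f j)) * tens N n f w v)"
      using contr_full_state[of "n i" "f i" "f j"] hi hj e by simp
    show ?thesis
      unfolding c J_scale T_def using J_mono[OF homog_imp_supp[OF hw order_refl], of ?M] by simp
  qed
  have "(\<Sum>r\<le>n i. J ?M (?c r)) = J ?M (?c 0) + (\<Sum>r\<in>{1..n i}. J ?M (?c r))"
    using sum.atLeast_Suc_atMost[of 0 "n i" "\<lambda>r. J ?M (?c r)"] by (simp add: atMost_atLeast0)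
  also have "(\<Sum>r\<in>{1..n i}. J ?M (?c r)) =
      (\<Sum>r\<in>?R. J ?M (?c r)) + scale_op (\<phi> (J (n i) (f i) o\<^sub>L J (n j) (f j))) (T w)"
  proof (cases "n i = n j")
    case True
    have ins: "{1..n i} = insert (n i) ?R" using True ni by auto
    have "(\<Sum>r\<in>{1..n i}. J ?M (?c r)) = (\<Sum>r\<in>insert (n i) ?R. J ?M (?c r))"
      by (rule sum.cong[OF ins refl])
    also have "\<dots> = J ?M (?c (n i)) + (\<Sum>r\<in>?R. J ?M (?c r))"
      using True by (intro sum.insert) auto
    finally show ?thesis by (simp only: full[OF True] add.commute)
  next
    case False
    have "?R = {1..n i}" using False by auto
    moreover have "\<phi> (J (n i) (f i) o\<^sub>L J (n j) (f j)) = 0"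
      by (rule state_J_compose_distinct_degree[OF hi hj False])
    ultimately show ?thesis by simp
  qed
  finally have "(J (n i) (f i) o\<^sub>L T (j # w)) - T (i # j # w)
      - scale_op (\<phi> (J (n i) (f i) o\<^sub>L J (n j) (f j))) (T w) = (\<Sum>r\<in>?R. J ?M (?c r))"
    unfolding prod T0 by simp
  then have "n2 ((J (n i) (f i) o\<^sub>L T (j # w)) - T (i # j # w)
      - scale_op (\<phi> (J (n i) (f i) o\<^sub>L J (n j) (f j))) (T w)) \<le> (\<Sum>r\<in>?R. n2 (J ?M (?c r)))"
    using n2_sum[of ?R "\<lambda>r. J ?M (?c r)"] J_A by simp
  also have "\<dots> \<le> (\<Sum>r\<in>?R. sqrt (sq N (n i + n j) (contr N (n i) (min r (n j)) (f i) (f j)) * (\<Prod>l\<leftarrow>w. sq N (n l) (f l))))"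
  proof (rule sum_mono)
    fix r assume "r \<in> ?R"
    then have r: "r \<le> n i" by simp
    have "sq N ?M (?c r) \<le> sq N (n i + n j) (contr N (n i) (min r (n j)) (f i) (f j)) * sq N ?l (tens N n f w)"
      by (rule sq_contr_tensor_le[OF hi hj hw r])
    also have "sq N ?l (tens N n f w) = (\<Prod>l\<leftarrow>w. sq N (n l) (f l))"
      by (rule sq_tens) (use h in auto)
    finally show "n2 (J ?M (?c r)) \<le> sqrt (sq N (n i + n j) (contr N (n i) (min r (n j)) (f i) (f j)) * (\<Prod>l\<leftarrow>w. sq N (n l) (f l)))"
      by (simp add: n2_J')
  qed
  finally show ?thesis .
qed

lemma state_J_homog: "homog N n f \<Longrightarrow> n \<ge> 1 \<Longrightarrow> \<phi> (J n f) = 0"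
proof -
  assume f: "homog N n f" "n \<ge> 1"
  have "\<phi> (J n f) = (\<Sum>v\<in>words N n. \<phi> (scale_op (f v) (wick X v)))"
    unfolding J_homog[OF f(1) order_refl]
    by (rule state_sum) (auto intro!: A_scale wick_A simp: words_def)
  also have "\<dots> = 0"
  proof (intro sum.neutral ballI)
    fix v assume v: "v \<in> words N n"
    then have "\<phi> (wick X v) = 0" "wick X v \<in> A"
      using f by (auto simp: words_def intro!: wick_centred wick_A)
    then show "\<phi> (scale_op (f v) (wick X v)) = 0" by (simp add: state_scale)
  qed
  finally show ?thesis .
qed

end

section \<open>Non-crossing pairings and stacks\<close>

text \<open>\<open>vac c u w\<close> is the vacuum expectation of the word \<open>rev u\<close> in field operators
  \<open>l(e\<^sub>i) + l(e\<^sub>i)\<^sup>*\<close> applied to the tensor \<open>w\<close> in a full Fock space with Gram matrix \<open>c\<close>: each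
  letter is either pushed on the stack \<open>w\<close> or contracted with its top.\<close>

fun vac :: "(nat \<Rightarrow> nat \<Rightarrow> complex) \<Rightarrow> nat list \<Rightarrow> nat list \<Rightarrow> complex" where
  "vac c [] w = (if w = [] then 1 else 0)"
| "vac c (i # u) [] = vac c u [i]"
| "vac c (i # u) (j # w) = vac c u (i # j # w) + c i j * vac c u w"

text \<open>Allows letters to be replaced by their positions, so that words can be compared with
  pairings of positions.\<close>

lemma vac_map: "vac c (map h u) (map h w) = vac (\<lambda>i j. c (h i) (h j)) u w"
proof (induction "\<lambda>i j. c (h i) (h j)" u w rule: vac.induct)
  case (2 i u)
  then show ?case by simp
next
  case (3 i u j w)
  then show ?case by simp
qed simp

lemma sum_triangle_shift:
  fixes F :: "nat \<Rightarrow> nat \<Rightarrow> 'a::comm_monoid_add"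
  shows "(\<Sum>p<n. \<Sum>q<n - Suc p. F p (Suc p + q)) = (\<Sum>q<n. \<Sum>p<q. F p q)"
  unfolding sum.Sigma[OF finite_lessThan ballI[OF finite_lessThan]]
  by (rule sum.reindex_bij_witness[where i = "\<lambda>(q, p). (p, q - Suc p)" and j = "\<lambda>(p, q). (Suc p + q, p)"]) auto

text \<open>The top letter \<open>j\<close> can leave the stack only by contraction with a letter at
  some place p of \<open>u\<close>, and by then the letters before p must have cancelled among
  themselves. In the induction the first letter of \<open>u\<close> either meets \<open>j\<close> at
  once, the term p = 0, or is pushed and has to leave before \<open>j\<close> does.\<close>

lemma vac_pop:
  "vac c u (j # w) = (\<Sum>p<length u. vac c (take p u) [] * c (u ! p) j * vac c (drop (Suc p) u) w)"
proof (induction "length u" arbitrary: u j w rule: less_induct)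
  case less
  show ?case
  proof (cases u)
    case Nil
    then show ?thesis by simp
  next
    case (Cons i v)
    let ?n = "length v"
    let ?F = "\<lambda>p q. vac c (take p v) [] * c (v ! p) i * vac c (take (q - Suc p) (drop (Suc p) v)) [] *
        c (v ! q) j * vac c (drop (Suc q) v) w"
    have "vac c v (i # j # w) = (\<Sum>p<?n. vac c (take p v) [] * c (v ! p) i * vac c (drop (Suc p) v) (j # w))"
      using less[of v i "j # w"] Cons by simp
    also have "\<dots> = (\<Sum>p<?n. \<Sum>q<?n - Suc p. ?F p (Suc p + q))"
    proof (rule sum.cong)
      fix p assume "p \<in> {..<?n}"
      then have "vac c (drop (Suc p) v) (j # w) = (\<Sum>q<?n - Suc p. vac c (take q (drop (Suc p) v)) [] *
          c (drop (Suc p) v ! q) j * vac c (drop (Suc q) (drop (Suc p) v)) w)"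
        using less[of "drop (Suc p) v" j w] Cons by simp
      also have "\<dots> = (\<Sum>q<?n - Suc p. vac c (take q (drop (Suc p) v)) [] *
          c (v ! (Suc p + q)) j * vac c (drop (Suc (Suc p + q)) v) w)"
        using \<open>p \<in> {..<?n}\<close> by (intro sum.cong refl) (simp add: add.commute)
      finally show "vac c (take p v) [] * c (v ! p) i * vac c (drop (Suc p) v) (j # w) =
          (\<Sum>q<?n - Suc p. ?F p (Suc p + q))"
        by (simp add: sum_distrib_left mult.assoc)
    qed simp
    also have "\<dots> = (\<Sum>q<?n. \<Sum>p<q. ?F p q)"
      by (rule sum_triangle_shift)
    \<comment> \<open>With the place q of the partner of \<open>j\<close> fixed, the inner sum is
      the same formula for the letter \<open>i\<close>, now in the shorter word
      \<open>take q v\<close>.\<close>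
    also have "\<dots> = (\<Sum>q<?n. vac c (take q v) [i] * c (v ! q) j * vac c (drop (Suc q) v) w)"
    proof (rule sum.cong)
      fix q assume q: "q \<in> {..<?n}"
      then have "vac c (take q v) [i] = (\<Sum>p<q. vac c (take p (take q v)) [] * c (take q v ! p) i *
          vac c (drop (Suc p) (take q v)) [])"
        using less[of "take q v" i "[]"] Cons by (simp add: min_def)
      also have "\<dots> = (\<Sum>p<q. vac c (take p v) [] * c (v ! p) i * vac c (take (q - Suc p) (drop (Suc p) v)) [])"
        by (intro sum.cong refl) (simp add: drop_take min_def)
      finally show "(\<Sum>p<q. ?F p q) = vac c (take q v) [i] * c (v ! q) j * vac c (drop (Suc q) v) w"
        by (simp add: sum_distrib_right)
    qed simp
    finally have "vac c u (j # w) = c i j * vac c v w +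
        (\<Sum>q<?n. vac c (take q v) [i] * c (v ! q) j * vac c (drop (Suc q) v) w)"
      using Cons by simp
    also have "\<dots> = (\<Sum>p<Suc ?n. vac c (take p u) [] * c (u ! p) j * vac c (drop (Suc p) u) w)"
      unfolding sum.lessThan_Suc_shift using Cons by simp
    finally show ?thesis using Cons by simp
  qed
qed

section \<open>Non-crossing pairings of an interval and their recursion\<close>

definition crossing :: "nat set set \<Rightarrow> bool" where
  "crossing \<pi> \<longleftrightarrow> (\<exists>B1\<in>\<pi>. \<exists>B2\<in>\<pi>. B1 \<noteq> B2 \<and>
     (\<exists>x1\<in>B1. \<exists>y1\<in>B1. \<exists>x2\<in>B2. \<exists>y2\<in>B2. x1 < x2 \<and> x2 < y1 \<and> y1 < y2))"

lemma crossingI: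
  "\<lbrakk>B \<in> \<pi>; C \<in> \<pi>; B \<noteq> C; x \<in> B; y \<in> B; u \<in> C; v \<in> C; x < u; u < y; y < v\<rbrakk> \<Longrightarrow> crossing \<pi>"
  unfolding crossing_def by blast

text \<open>Stated for arbitrary sets of points, because the recursion passes to the parts on either
  side of a block.\<close>

definition NCP :: "nat set \<Rightarrow> nat set set set" where
  "NCP S = {\<pi>. partition_on S \<pi> \<and> (\<forall>B\<in>\<pi>. card B = 2) \<and> \<not> crossing \<pi>}"

definition pairing_sum :: "(nat \<Rightarrow> nat \<Rightarrow> complex) \<Rightarrow> nat set \<Rightarrow> complex" where
  "pairing_sum g S = (\<Sum>\<pi>\<in>NCP S. \<Prod>B\<in>\<pi>. g (Min B) (Max B))"

lemma NC2_eq: "NC2 n = NCP {1..<Suc n}"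
  by (simp add: NC2_def NCP_def crossing_def atLeastLessThanSuc_atLeastAtMost)

lemma NCP_empty: "NCP {} = {{}}"
  by (auto simp: NCP_def partition_on_def crossing_def)

lemma finite_NCP: "finite S \<Longrightarrow> finite (NCP S)"
  by (rule finite_subset[of _ "Pow (Pow S)"]) (auto simp: NCP_def partition_on_def)

lemma NCP_finite: "finite S \<Longrightarrow> \<pi> \<in> NCP S \<Longrightarrow> finite \<pi>"
  by (auto simp: NCP_def intro: finite_elements)

lemma NCP_block:
  assumes "\<pi> \<in> NCP S" "x \<in> S"
  shows "\<exists>y. y \<noteq> x \<and> y \<in> S \<and> {x, y} \<in> \<pi>"
proof -
  obtain B where B: "B \<in> \<pi>" "x \<in> B"
    using assms by (auto simp: NCP_def partition_on_def)
  then have "card B = 2" "B \<subseteq> S" using assms by (auto simp: NCP_def partition_on_def)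
  then obtain u v where "B = {u, v}" "u \<noteq> v" by (auto simp: card_2_iff)
  then show ?thesis using B \<open>B \<subseteq> S\<close> by (cases "x = u") (auto simp: insert_commute)
qed

lemma NCP_block_eq: "\<lbrakk>\<pi> \<in> NCP S; B \<in> \<pi>; C \<in> \<pi>; x \<in> B; x \<in> C\<rbrakk> \<Longrightarrow> B = C"
  by (auto simp: NCP_def partition_on_def disjoint_def)

lemma NCP_subset: "\<lbrakk>\<pi> \<in> NCP S; B \<in> \<pi>\<rbrakk> \<Longrightarrow> B \<subseteq> S \<and> B \<noteq> {}"
  by (auto simp: NCP_def partition_on_def)

text \<open>Since \<open>b\<close> is the last point, a block with one point below \<open>p\<close>
  and one between \<open>p\<close> and \<open>b\<close> would cross \<open>{p, b}\<close>.\<close>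

lemma NCP_side:
  assumes \<pi>: "\<pi> \<in> NCP {a..<Suc b}" and pb: "{p, b} \<in> \<pi>" "p < b" and C: "C \<in> \<pi>" "C \<noteq> {p, b}"
  shows "C \<subseteq> {a..<p} \<or> C \<subseteq> {Suc p..<b}"
proof -
  have "card C = 2" "C \<subseteq> {a..<Suc b}" using \<pi> C by (auto simp: NCP_def partition_on_def)
  then obtain u v where "C = {u, v}" "u \<noteq> v" by (auto simp: card_2_iff)
  then obtain x y where xy: "C = {x, y}" "x < y"
    by (metis insert_commute linorder_neqE_nat)
  have "p \<notin> C" "b \<notin> C"
    using NCP_block_eq[OF \<pi> C(1) pb(1)] C(2) by auto
  then have ne: "x \<noteq> p" "y \<noteq> p" "x < b" "y < b" "a \<le> x"
    using xy \<open>C \<subseteq> {a..<Suc b}\<close> by auto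
  have "\<not> (x < p \<and> p < y \<and> y < b)"
  proof
    assume "x < p \<and> p < y \<and> y < b"
    then have "crossing \<pi>"
      using C pb xy by (intro crossingI[of C \<pi> "{p, b}" x y p b]) auto
    then show False using \<pi> by (simp add: NCP_def)
  qed
  then show ?thesis using ne xy by auto
qed

lemma NCP_restrict:
  assumes \<pi>: "\<pi> \<in> NCP S" and T: "\<And>x. x \<in> T \<Longrightarrow> \<exists>B\<in>\<pi>. x \<in> B \<and> B \<subseteq> T"
  shows "{B \<in> \<pi>. B \<subseteq> T} \<in> NCP T"
proof -
  have "partition_on T {B \<in> \<pi>. B \<subseteq> T}"
    using \<pi> T by (fastforce simp: NCP_def partition_on_def disjoint_def)
  moreover have "\<not> crossing {B \<in> \<pi>. B \<subseteq> T}"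
    using \<pi> unfolding NCP_def crossing_def by blast
  ultimately show ?thesis using \<pi> by (auto simp: NCP_def)
qed

text \<open>The two families are separated by \<open>p\<close>, and no point lies beyond
  \<open>b\<close>; a crossing would therefore have to occur inside one of them.\<close>

lemma NCP_insert:
  assumes "a \<le> p" "p < b" and 1: "\<pi>1 \<in> NCP {Suc p..<b}" and 2: "\<pi>2 \<in> NCP {a..<p}"
  shows "insert {p, b} (\<pi>1 \<union> \<pi>2) \<in> NCP {a..<Suc b}"
proof -
  have P1: "\<Union>\<pi>1 = {Suc p..<b}" and P2: "\<Union>\<pi>2 = {a..<p}"
    using 1 2 by (auto simp: NCP_def partition_on_def)
  have sub1: "B \<subseteq> {Suc p..<b}" if "B \<in> \<pi>1" for B using that P1 by blast
  have sub2: "B \<subseteq> {a..<p}" if "B \<in> \<pi>2" for B using that P2 by blast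
  have U: "\<Union>(insert {p, b} (\<pi>1 \<union> \<pi>2)) = {a..<Suc b}"
    using assms P1 P2 by auto
  have dis: "B \<inter> C = {}" if "B \<in> \<pi>1" "C \<in> \<pi>2" for B C
    using sub1[OF that(1)] sub2[OF that(2)] by fastforce
  have d1: "{p, b} \<inter> B = {}" if "B \<in> \<pi>1 \<union> \<pi>2" for B
    using that sub1[of B] sub2[of B] assms(1,2) by fastforce
  have "disjoint (insert {p, b} (\<pi>1 \<union> \<pi>2))"
    unfolding disjoint_def
  proof (intro ballI impI)
    fix B C assume BC: "B \<in> insert {p, b} (\<pi>1 \<union> \<pi>2)" "C \<in> insert {p, b} (\<pi>1 \<union> \<pi>2)" "B \<noteq> C"
    have "disjoint \<pi>1" "disjoint \<pi>2"
      using 1 2 by (auto simp: NCP_def partition_on_def)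
    then show "B \<inter> C = {}"
      using BC dis d1 by (metis Int_commute Un_iff disjointD insertE)
  qed
  then have "partition_on {a..<Suc b} (insert {p, b} (\<pi>1 \<union> \<pi>2))"
    using 1 2 U unfolding NCP_def partition_on_def by auto
  moreover have "\<not> crossing (insert {p, b} (\<pi>1 \<union> \<pi>2))"
  proof
    assume "crossing (insert {p, b} (\<pi>1 \<union> \<pi>2))"
    then obtain B C x y u v where *: "B \<in> insert {p, b} (\<pi>1 \<union> \<pi>2)" "C \<in> insert {p, b} (\<pi>1 \<union> \<pi>2)"
      "B \<noteq> C" "x \<in> B" "y \<in> B" "u \<in> C" "v \<in> C" "x < u" "u < y" "y < v"
      unfolding crossing_def by blast
    have in1: "z \<in> B' \<Longrightarrow> B' \<in> \<pi>1 \<Longrightarrow> p < z \<and> z < b" for z B' using sub1 by fastforce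
    have in2: "z \<in> B' \<Longrightarrow> B' \<in> \<pi>2 \<Longrightarrow> z < p" for z B' using sub2 by fastforce
    have "\<not> crossing \<pi>1" "\<not> crossing \<pi>2"
      using 1 2 by (auto simp: NCP_def)
    then have "\<not> (B \<in> \<pi>1 \<and> C \<in> \<pi>1)" "\<not> (B \<in> \<pi>2 \<and> C \<in> \<pi>2)"
      using crossingI[OF _ _ *(3-)] by blast+
    then consider "B = {p, b}" "C \<in> \<pi>1" | "B = {p, b}" "C \<in> \<pi>2" | "C = {p, b}" "B \<in> \<pi>1"
      | "C = {p, b}" "B \<in> \<pi>2" | "B \<in> \<pi>1" "C \<in> \<pi>2" | "B \<in> \<pi>2" "C \<in> \<pi>1"
      using *(1-3) by (metis Un_iff insertE)
    then show False
    proof cases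
      case 1
      then show ?thesis using *(4-) in1[of u C] in1[of v C] assms(2) by auto
    next
      case 2
      then show ?thesis using *(4-) in2[of u C] assms(2) by auto
    next
      case 3
      then show ?thesis using *(4-) in1[of x B] in1[of y B] assms(2) by auto
    next
      case 4
      then show ?thesis using *(4-) in2[of y B] assms(2) by auto
    next
      case 5
      then show ?thesis using *(4-) in1[of x B] in2[of u C] by auto
    next
      case 6
      then show ?thesis using *(4-) in2[of y B] in1[of u C] by auto
    qed
  qed
  ultimately show ?thesis
    using assms 1 2 by (auto simp: NCP_def)
qed

text \<open>A non-crossing pairing amounts to the partner \<open>p\<close> of the last point, a
  pairing of the points under the arc and a pairing of the points before it: the Catalan recursion
  with weights.\<close>

lemma pairing_sum_Suc:
  assumes "a \<le> b"
  shows "pairing_sum g {a..<Suc b} =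
    (\<Sum>p\<in>{a..<b}. g p b * pairing_sum g {Suc p..<b} * pairing_sum g {a..<p})"
proof -
  let ?w = "\<lambda>\<pi>. \<Prod>B\<in>\<pi>. g (Min B) (Max B)"
  define partner where "partner \<pi> = (THE p. {p, b} \<in> \<pi>)" for \<pi> :: "nat set set"
  let ?S = "SIGMA p : {a..<b}. NCP {Suc p..<b} \<times> NCP {a..<p}"
  have partner: "{partner \<pi>, b} \<in> \<pi>" "a \<le> partner \<pi>" "partner \<pi> < b" if \<pi>: "\<pi> \<in> NCP {a..<Suc b}" for \<pi>
  proof -
    obtain p where p: "p \<noteq> b" "p \<in> {a..<Suc b}" "{b, p} \<in> \<pi>"
      using NCP_block[OF \<pi>, of b] assms by auto
    have "partner \<pi> = p"
      unfolding partner_def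
    proof (rule the_equality)
      show "{p, b} \<in> \<pi>" using p by (simp add: insert_commute)
      show "q = p" if "{q, b} \<in> \<pi>" for q
        using NCP_block_eq[OF \<pi> that p(3), of b] p(1) by (auto simp: doubleton_eq_iff)
    qed
    then show "{partner \<pi>, b} \<in> \<pi>" "a \<le> partner \<pi>" "partner \<pi> < b"
      using p by (auto simp: insert_commute)
  qed
  have partner_eq: "partner \<pi> = p" if "\<pi> \<in> NCP {a..<Suc b}" "{p, b} \<in> \<pi>" for \<pi> p
    using NCP_block_eq[OF that(1) that(2) partner(1)[OF that(1)], of b] partner(3)[OF that(1)]
    by (auto simp: doubleton_eq_iff)
  have weight: "?w (insert {p, b} (\<pi>1 \<union> \<pi>2)) = g p b * ?w \<pi>1 * ?w \<pi>2"
    if "p \<in> {a..<b}" "\<pi>1 \<in> NCP {Suc p..<b}" "\<pi>2 \<in> NCP {a..<p}" for p \<pi>1 \<pi>2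
  proof -
    have fin: "finite \<pi>1" "finite \<pi>2" using that NCP_finite by blast+
    have "\<pi>1 \<inter> \<pi>2 = {}"
      using NCP_subset[OF that(2)] NCP_subset[OF that(3)] by fastforce
    moreover have "{p, b} \<notin> \<pi>1 \<union> \<pi>2"
      using NCP_subset[OF that(2)] NCP_subset[OF that(3)] by fastforce
    moreover have "Min {p, b} = p" "Max {p, b} = b" using that by auto
    ultimately show ?thesis
      using fin by (simp add: prod.union_disjoint mult.assoc)
  qed
  have "pairing_sum g {a..<Suc b} = (\<Sum>(p, \<pi>1, \<pi>2)\<in>?S. g p b * ?w \<pi>1 * ?w \<pi>2)"
    unfolding pairing_sum_def
  proof (rule sum.reindex_bij_witness[symmetric, where
        i = "\<lambda>\<pi>. (partner \<pi>, {B \<in> \<pi>. B \<subseteq> {Suc (partner \<pi>)..<b}}, {B \<in> \<pi>. B \<subseteq> {a..<partner \<pi>}})"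
        and j = "\<lambda>(p, \<pi>1, \<pi>2). insert {p, b} (\<pi>1 \<union> \<pi>2)"], goal_cases)
    case (1 z)
    then obtain p \<pi>1 \<pi>2 where z: "z = (p, \<pi>1, \<pi>2)" and p: "a \<le> p" "p < b"
      and \<pi>: "\<pi>1 \<in> NCP {Suc p..<b}" "\<pi>2 \<in> NCP {a..<p}" by auto
    let ?\<pi> = "insert {p, b} (\<pi>1 \<union> \<pi>2)"
    have "partner ?\<pi> = p"
      by (rule partner_eq[OF NCP_insert[OF p \<pi>]]) simp
    moreover have "{B \<in> ?\<pi>. B \<subseteq> {Suc p..<b}} = \<pi>1"
      using NCP_subset[OF \<pi>(1)] NCP_subset[OF \<pi>(2)] by fastforce
    moreover have "{B \<in> ?\<pi>. B \<subseteq> {a..<p}} = \<pi>2"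
      using NCP_subset[OF \<pi>(1)] NCP_subset[OF \<pi>(2)] p by fastforce
    ultimately show ?case by (simp add: z)
  next
    case (2 z)
    then show ?case by (auto intro: NCP_insert)
  next
    case (3 \<pi>)
    note p = partner[OF 3]
    show ?case
      using NCP_side[OF 3 p(1,3)] p by auto
  next
    case (4 \<pi>)
    note p = partner[OF 4]
    let ?p = "partner \<pi>"
    have ex: "\<exists>B\<in>\<pi>. x \<in> B \<and> B \<noteq> {?p, b}" if "x \<in> {a..<Suc b}" "x \<noteq> ?p" "x \<noteq> b" for x
      using NCP_block[OF 4 that(1)] that by blast
    have "{B \<in> \<pi>. B \<subseteq> {Suc ?p..<b}} \<in> NCP {Suc ?p..<b}"
    proof (rule NCP_restrict[OF 4])
      fix x assume x: "x \<in> {Suc ?p..<b}"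
      then obtain B where "B \<in> \<pi>" "x \<in> B" "B \<noteq> {?p, b}" using ex[of x] p by auto
      then show "\<exists>B\<in>\<pi>. x \<in> B \<and> B \<subseteq> {Suc ?p..<b}"
        using NCP_side[OF 4 p(1,3), of B] x by fastforce
    qed
    moreover have "{B \<in> \<pi>. B \<subseteq> {a..<?p}} \<in> NCP {a..<?p}"
    proof (rule NCP_restrict[OF 4])
      fix x assume x: "x \<in> {a..<?p}"
      then obtain B where "B \<in> \<pi>" "x \<in> B" "B \<noteq> {?p, b}" using ex[of x] p by auto
      then show "\<exists>B\<in>\<pi>. x \<in> B \<and> B \<subseteq> {a..<?p}"
        using NCP_side[OF 4 p(1,3), of B] x by fastforce
    qed
    ultimately show ?case using p by auto
  next
    case (5 z)
    then show ?case by (auto simp: weight)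
  qed
  also have "\<dots> = (\<Sum>p\<in>{a..<b}. \<Sum>(\<pi>1, \<pi>2)\<in>NCP {Suc p..<b} \<times> NCP {a..<p}. g p b * ?w \<pi>1 * ?w \<pi>2)"
    by (rule sum.Sigma[symmetric]) (auto intro!: finite_NCP)
  also have "\<dots> = (\<Sum>p\<in>{a..<b}. g p b * pairing_sum g {Suc p..<b} * pairing_sum g {a..<p})"
    unfolding sum.cartesian_product[symmetric] pairing_sum_def
    by (simp add: sum_distrib_left sum_distrib_right mult.assoc)
      (rule sum.cong[OF refl], rule sum.swap)
  finally show ?thesis .
qed

text \<open>Both sides satisfy the same recursion. The word is reversed because the last operator
  acts first: the last point is pushed on the empty stack, and \<open>vac_pop\<close> sums over its
  partner.\<close>

lemma pairing_sum_eq_vac: "pairing_sum g {a..<b} = vac g (rev [a..<b]) []"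
proof (induction "b - a" arbitrary: a b rule: less_induct)
  case less
  show ?case
  proof (cases "a < b")
    case False
    then show ?thesis by (simp add: pairing_sum_def NCP_empty)
  next
    case True
    then obtain b' where b: "b = Suc b'" "a \<le> b'" by (cases b) auto
    let ?u = "rev [a..<b']"
    have "vac g (rev [a..<b]) [] = vac g ?u [b']"
      using b by simp
    also have "\<dots> = (\<Sum>q<b' - a. vac g (take q ?u) [] * g (?u ! q) b' * vac g (drop (Suc q) ?u) [])"
      by (simp add: vac_pop)
    also have "\<dots> = (\<Sum>p\<in>{a..<b'}. vac g (rev [Suc p..<b']) [] * g p b' * vac g (rev [a..<p]) [])"
    \<comment> \<open>Place q of the reversed list carries the point b' - Suc q.\<close>
    proof (rule sum.reindex_bij_witness[where i = "\<lambda>p. b' - Suc p" and j = "\<lambda>q. b' - Suc q"])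
      fix q assume "q \<in> {..<b' - a}"
      then have q: "q < b' - a" by simp
      have "take q ?u = rev [b' - q..<b']" "drop (Suc q) ?u = rev [a..<b' - Suc q]" "?u ! q = b' - Suc q"
        using q by (auto simp: take_rev drop_rev rev_nth drop_upt take_upt)
      then show "vac g (rev [Suc (b' - Suc q)..<b']) [] * g (b' - Suc q) b' * vac g (rev [a..<b' - Suc q]) [] =
         vac g (take q ?u) [] * g (?u ! q) b' * vac g (drop (Suc q) ?u) []"
        using q by (simp add: Suc_diff_Suc)
    qed auto
    also have "\<dots> = (\<Sum>p\<in>{a..<b'}. g p b' * pairing_sum g {Suc p..<b'} * pairing_sum g {a..<p})"
    proof (rule sum.cong)
      fix p assume "p \<in> {a..<b'}"
      then have "pairing_sum g {Suc p..<b'} = vac g (rev [Suc p..<b']) []"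
        "pairing_sum g {a..<p} = vac g (rev [a..<p]) []"
        using b by (auto intro!: less)
      then show "vac g (rev [Suc p..<b']) [] * g p b' * vac g (rev [a..<p]) [] =
          g p b' * pairing_sum g {Suc p..<b'} * pairing_sum g {a..<p}"
        by simp
    qed simp
    also have "\<dots> = pairing_sum g {a..<b}"
      using b by (simp add: pairing_sum_Suc)
    finally show ?thesis by simp
  qed
qed

lemma sum_NC2_eq_vac:
  "(\<Sum>\<pi>\<in>NC2 (length w). \<Prod>B\<in>\<pi>. c (w ! (Min B - 1)) (w ! (Max B - 1))) = vac c (rev w) []"
proof -
  have "w = map (\<lambda>p. w ! (p - 1)) [1..<Suc (length w)]"
    by (rule nth_equalityI) (simp_all del: upt_Suc)
  then have "vac c (rev w) [] = vac c (map (\<lambda>p. w ! (p - 1)) (rev [1..<Suc (length w)])) (map (\<lambda>p. w ! (p - 1)) [])"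
    by (metis rev_map list.simps(8))
  also have "\<dots> = pairing_sum (\<lambda>p q. c (w ! (p - 1)) (w ! (q - 1))) {1..<Suc (length w)}"
    unfolding vac_map pairing_sum_eq_vac by (rule refl)
  finally show ?thesis
    by (simp only: NC2_eq pairing_sum_def)
qed

section \<open>The limit theorem on a grid\<close>

lemma norm_op_prod_le:
  assumes "\<And>i. i \<in> set u \<Longrightarrow> norm (Y i) \<le> B i"
  shows "norm (op_prod (map Y u)) \<le> (\<Prod>i\<leftarrow>u. B i)"
  using assms
proof (induction u)
  case (Cons i u)
  have "norm (op_prod (map Y (i # u))) \<le> norm (Y i) * norm (op_prod (map Y u))"
    by (simp add: norm_blinfun_compose)
  also have "\<dots> \<le> B i * (\<Prod>i\<leftarrow>u. B i)"
    using Cons by (intro mult_mono) (auto intro: order_trans[OF norm_ge_zero])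
  finally show ?case by simp
qed (simp add: norm_blinfun_id_le)

lemma tendsto_prod_list:
  fixes g :: "nat \<Rightarrow> nat \<Rightarrow> real"
  assumes "\<And>i. i \<in> set w \<Longrightarrow> (\<lambda>k. g k i) \<longlonglongrightarrow> l i"
  shows "(\<lambda>k. \<Prod>i\<leftarrow>w. g k i) \<longlonglongrightarrow> (\<Prod>i\<leftarrow>w. l i)"
  using assms by (induction w) (auto intro!: tendsto_mult)

context tracial_W_prob_space
begin

text \<open>The operators \<open>T k w\<close> play the part of tensors, and \<open>step\<close>
  says that \<open>Y k i\<close> acts on them like a field operator on the full Fock space, up to an
  error in 2-norm. Moving one operator at a time onto the tensor reproduces the recursion of
  \<open>vac\<close>; the remaining operators stand in front of the error, which is why
  \<open>bound\<close> is required.\<close>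

lemma moments_tendsto_vac:
  fixes Y :: "nat \<Rightarrow> nat \<Rightarrow> 'h op" and T :: "nat \<Rightarrow> nat list \<Rightarrow> 'h op"
  assumes Y: "\<And>k i. i \<in> I \<Longrightarrow> Y k i \<in> A" and T: "\<And>k w. set w \<subseteq> I \<Longrightarrow> T k w \<in> A"
    and T0: "\<And>k. T k [] = id_blinfun" and T1: "\<And>k i. i \<in> I \<Longrightarrow> T k [i] = Y k i"
    and bound: "\<And>k i. i \<in> I \<Longrightarrow> norm (Y k i) \<le> B i"
    and cent: "\<And>k w. \<lbrakk>set w \<subseteq> I; w \<noteq> []\<rbrakk> \<Longrightarrow> \<phi> (T k w) = 0"
    and step: "\<And>i j w. \<lbrakk>i \<in> I; j \<in> I; set w \<subseteq> I\<rbrakk> \<Longrightarrow>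
      (\<lambda>k. n2 ((Y k i o\<^sub>L T k (j # w)) - T k (i # j # w) - scale_op (c i j) (T k w))) \<longlonglongrightarrow> 0"
    and "set u \<subseteq> I" "set w \<subseteq> I"
  shows "(\<lambda>k. \<phi> (op_prod (map (Y k) (rev u)) o\<^sub>L T k w)) \<longlonglongrightarrow> vac c u w"
  using assms(8,9)
proof (induction u arbitrary: w)
  case Nil
  then show ?case by (cases "w = []") (simp_all add: T0 state_unital cent)
next
  case (Cons i u)
  note IH = Cons.IH
  show ?case
  proof (cases w)
    case Nil
    then show ?thesis using Cons.prems IH[of "[i]"] by (simp add: op_prod_append T0 T1)
  next
    case w_eq: (Cons j w')
    note prems = Cons.prems[unfolded w_eq]
    define U where "U k = op_prod (map (Y k) (rev u))" for k
    define E where "E k = (Y k i o\<^sub>L T k (j # w')) - T k (i # j # w') - scale_op (c i j) (T k w')" for k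
    have U: "U k \<in> A" for k
      unfolding U_def using prems Y by (intro A_prod) auto
    have E: "E k \<in> A" for k
      unfolding E_def using prems by (intro A_intros Y T) auto
    have n2E: "(\<lambda>k. n2 (E k)) \<longlonglongrightarrow> 0"
      unfolding E_def using prems by (intro step) auto
    obtain K where K: "K > 0" "\<And>T. T \<in> A \<Longrightarrow> n2 T \<le> K * norm T"
      using n2_le_norm by blast
    \<comment> \<open>A bound, uniform in k, for the 2-norm of the operators in front of the
      error.\<close>
    define C where "C = K * (\<Prod>i\<leftarrow>rev u. B i)"
    have "(\<lambda>k. \<phi> (U k o\<^sub>L E k)) \<longlonglongrightarrow> 0"
    proof (rule Lim_null_comparison)
      show "(\<lambda>k. n2 (E k) * C) \<longlonglongrightarrow> 0"
        using n2E by (rule tendsto_mult_left_zero)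
      have "cmod (\<phi> (U k o\<^sub>L E k)) \<le> n2 (E k) * C" for k
      proof -
        have "cmod (\<phi> (adj (adj (U k)) o\<^sub>L E k)) \<le> n2 (E k) * n2 (adj (U k))"
          by (intro state_Cauchy_Schwarz E A_adj U)
        also have "n2 (adj (U k)) \<le> C"
        proof -
          have "n2 (adj (U k)) \<le> K * norm (U k)"
            using K U by (simp add: n2_adj)
          also have "norm (U k) \<le> (\<Prod>i\<leftarrow>rev u. B i)"
            unfolding U_def using prems by (intro norm_op_prod_le bound) auto
          finally show ?thesis using K by (simp add: C_def)
        qed
        finally show ?thesis
          using U E by (simp add: adj_adj A_BH n2_nonneg mult_left_mono)
      qed
      then show "\<forall>\<^sub>F k in sequentially. cmod (\<phi> (U k o\<^sub>L E k)) \<le> n2 (E k) * C" by simp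
    qed
    moreover have "(\<lambda>k. \<phi> (U k o\<^sub>L T k (i # j # w'))) \<longlonglongrightarrow> vac c u (i # j # w')"
      unfolding U_def using prems by (intro IH) auto
    moreover have "(\<lambda>k. \<phi> (U k o\<^sub>L T k w')) \<longlonglongrightarrow> vac c u w'"
      unfolding U_def using prems by (intro IH) auto
    ultimately have "(\<lambda>k. \<phi> (U k o\<^sub>L E k) + \<phi> (U k o\<^sub>L T k (i # j # w')) + c i j * \<phi> (U k o\<^sub>L T k w')) \<longlonglongrightarrow>
        0 + vac c u (i # j # w') + c i j * vac c u w'"
      by (intro tendsto_intros)
    moreover have "\<phi> (op_prod (map (Y k) (rev (i # u))) o\<^sub>L T k (j # w')) =
        \<phi> (U k o\<^sub>L E k) + \<phi> (U k o\<^sub>L T k (i # j # w')) + c i j * \<phi> (U k o\<^sub>L T k w')" for k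
    proof -
      have A: "T k (i # j # w') \<in> A" "T k w' \<in> A" using prems by (auto intro!: T)
      have "op_prod (map (Y k) (rev (i # u))) o\<^sub>L T k (j # w') = U k o\<^sub>L (Y k i o\<^sub>L T k (j # w'))"
        by (simp add: op_prod_append U_def compose_assoc)
      also have "Y k i o\<^sub>L T k (j # w') = E k + T k (i # j # w') + scale_op (c i j) (T k w')"
        by (simp add: E_def)
      finally show ?thesis
        using U[of k] E[of k] A by (simp add: compose_add_right compose_scale_op_right A_BH state_add A_intros state_scale)
    qed
    ultimately show ?thesis by (simp add: w_eq)
  qed
qed

text \<open>The system, its size and the kernels may all change with k: only norms of kernels and of
  their contractions enter, and these are governed by second and fourth moments.\<close>

theorem discrete_fourth_moment_limit:
  fixes X :: "nat \<Rightarrow> nat \<Rightarrow> 'h op" and N :: "nat \<Rightarrow> nat" and n :: "nat \<Rightarrow> nat"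
    and f :: "nat \<Rightarrow> nat \<Rightarrow> nat list \<Rightarrow> complex" and c :: "nat \<Rightarrow> nat \<Rightarrow> real"
  defines "Y \<equiv> \<lambda>k i. free_semicircular_system.J (X k) (N k) (n i) (f k i)"
  assumes sys: "\<And>k. free_semicircular_system A \<phi> (X k) (N k)"
    and hom: "\<And>k i. i \<in> I \<Longrightarrow> homog (N k) (n i) (f k i)"
    and star: "\<And>k i. i \<in> I \<Longrightarrow> star (f k i) = f k i"
    and n: "\<And>i. i \<in> I \<Longrightarrow> 1 \<le> n i"
    and cov: "\<And>i j. \<lbrakk>i \<in> I; j \<in> I\<rbrakk> \<Longrightarrow> (\<lambda>k. \<phi> (Y k i o\<^sub>L Y k j)) \<longlonglongrightarrow> of_real (c i j)"
    and four: "\<And>i. i \<in> I \<Longrightarrow> (\<lambda>k. \<phi> (op_pow (Y k i) 4)) \<longlonglongrightarrow> of_real (2 * (c i i)\<^sup>2)"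
    and u: "set u \<subseteq> I"
  shows "(\<lambda>k. \<phi> (op_prod (map (Y k) u))) \<longlonglongrightarrow> vac (\<lambda>i j. of_real (c i j)) (rev u) []"
proof -
  define T where "T k w = free_semicircular_system.J (X k) (N k) (sum_list (map n w)) (tens (N k) n (f k) w)" for k w
  define a where "a k i = sq (N k) (n i) (f k i)" for k i
  define q where "q k i j r = sq (N k) (n i + n j) (contr (N k) (n i) r (f k i) (f k j))" for k i j r
  have q_nonneg: "0 \<le> q k i j r" for k i j r
    by (simp add: q_def sq_nonneg)
  have Y: "Y k i \<in> A" for k i
    unfolding Y_def by (rule free_semicircular_system.J_A[OF sys])
  have T: "T k w \<in> A" for k w
    unfolding T_def by (rule free_semicircular_system.J_A[OF sys])
  have adjY: "adj (Y k i) = Y k i" if "i \<in> I" for k i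
    unfolding Y_def by (simp add: free_semicircular_system.adj_J[OF sys] star that)
  have n2Y: "n2 (Y k i) = sqrt (a k i)" for k i
    unfolding Y_def a_def by (rule free_semicircular_system.n2_J'[OF sys])
  have a_nonneg: "0 \<le> a k i" for k i by (simp add: a_def sq_nonneg)
  have a_lim: "(\<lambda>k. a k i) \<longlonglongrightarrow> c i i" if i: "i \<in> I" for i
  proof -
    have "\<phi> (Y k i o\<^sub>L Y k i) = of_real (a k i)" for k
      using state_adj_self[OF Y, of k i] adjY[OF i] a_nonneg by (simp add: n2Y)
    then have "(\<lambda>k. complex_of_real (a k i)) \<longlonglongrightarrow> of_real (c i i)"
      using cov[OF i i] by simp
    then show ?thesis by (simp only: tendsto_of_real_iff)
  qed
  \<comment> \<open>The fourth moment minus twice the squared variance is a sum of non-negative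
    terms. It tends to 0, hence so does each term.\<close>
  have q_self: "(\<lambda>k. q k i i r) \<longlonglongrightarrow> 0" if i: "i \<in> I" and r: "1 \<le> r" "r < n i" for i r
  proof -
    define S where "S k = (\<Sum>r\<in>{1..<n i}. q k i i r)" for k
    have "\<phi> (op_pow (Y k i) 4) = of_real (2 * (a k i)\<^sup>2 + S k)" for k
      unfolding Y_def a_def S_def q_def
      by (rule free_semicircular_system.fourth_moment[OF sys hom[OF i] star[OF i] n[OF i]])
    then have "(\<lambda>k. complex_of_real (2 * (a k i)\<^sup>2 + S k)) \<longlonglongrightarrow> of_real (2 * (c i i)\<^sup>2)"
      using four[OF i] by simp
    then have "(\<lambda>k. 2 * (a k i)\<^sup>2 + S k) \<longlonglongrightarrow> 2 * (c i i)\<^sup>2"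
      by (simp only: tendsto_of_real_iff)
    then have "(\<lambda>k. (2 * (a k i)\<^sup>2 + S k) - 2 * (a k i)\<^sup>2) \<longlonglongrightarrow> 2 * (c i i)\<^sup>2 - 2 * (c i i)\<^sup>2"
      by (intro tendsto_diff tendsto_mult tendsto_power tendsto_const a_lim[OF i])
    then have S: "S \<longlonglongrightarrow> 0" by simp
    show ?thesis
    proof (rule Lim_null_comparison[OF _ S])
      have "norm (q k i i r) \<le> S k" for k
        unfolding S_def using r q_nonneg[of k i i] member_le_sum[of r "{1..<n i}" "q k i i"] by auto
      then show "\<forall>\<^sub>F k in sequentially. norm (q k i i r) \<le> S k" by simp
    qed
  qed
  have q_le: "q k i i r \<le> a k i * a k i" if "i \<in> I" "r \<le> n i" for k i r
    unfolding q_def a_def by (rule sq_contr_le[OF hom[OF that(1)] homog_imp_supp[OF hom[OF that(1)] order_refl] that(2)])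
  \<comment> \<open>The order r exhausts at most one of the two kernels. The other one contributes a
    proper self-contraction, which tends to 0, and the remaining factor is bounded by a convergent
    variance.\<close>
  have q_lim: "(\<lambda>k. q k i j r) \<longlonglongrightarrow> 0"
    if i: "i \<in> I" and j: "j \<in> I" and r: "1 \<le> r" "r \<le> n i" "r \<le> n j" "\<not> (r = n i \<and> r = n j)" for i j r
  proof -
    have le: "q k i j r \<le> sqrt (q k i i (n i - r)) * sqrt (q k j j (n j - r))" for k
      unfolding q_def by (rule sq_contr_le_self_contr[OF hom[OF i] star[OF i] hom[OF j] star[OF j] r(2,3)])
    show ?thesis
    proof (cases "r < n i")
      case True
      have "(\<lambda>k. sqrt (q k i i (n i - r)) * sqrt (a k j * a k j)) \<longlonglongrightarrow> sqrt 0 * sqrt (c j j * c j j)"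
        using True r by (intro tendsto_mult tendsto_real_sqrt q_self a_lim i j) auto
      moreover have "norm (q k i j r) \<le> sqrt (q k i i (n i - r)) * sqrt (a k j * a k j)" for k
        using order_trans[OF le[of k] mult_left_mono[OF real_sqrt_le_mono[OF q_le[OF j, of "n j - r" k]]]] q_nonneg
        by simp
      ultimately show ?thesis
        by (intro Lim_null_comparison[of "\<lambda>k. q k i j r"]) auto
    next
      case False
      then have r': "r < n j" using r by auto
      have "(\<lambda>k. sqrt (a k i * a k i) * sqrt (q k j j (n j - r))) \<longlonglongrightarrow> sqrt (c i i * c i i) * sqrt 0"
        using r' r by (intro tendsto_mult tendsto_real_sqrt q_self a_lim i j) auto
      moreover have "norm (q k i j r) \<le> sqrt (a k i * a k i) * sqrt (q k j j (n j - r))" for k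
        using order_trans[OF le[of k] mult_right_mono[OF real_sqrt_le_mono[OF q_le[OF i, of "n i - r" k]]]] q_nonneg
        by simp
      ultimately show ?thesis
        by (intro Lim_null_comparison[of "\<lambda>k. q k i j r"]) auto
    qed
  qed
  have pa: "(\<lambda>k. \<Prod>l\<leftarrow>w. a k l) \<longlonglongrightarrow> (\<Prod>l\<leftarrow>w. c l l)" if "set w \<subseteq> I" for w
    by (intro tendsto_prod_list a_lim) (use that in auto)
  have n2T: "n2 (T k w) = sqrt (\<Prod>l\<leftarrow>w. a k l)" if "set w \<subseteq> I" for k w
  proof -
    have "sq (N k) (sum_list (map n w)) (tens (N k) n (f k) w) = (\<Prod>l\<leftarrow>w. a k l)"
      unfolding a_def by (rule sq_tens) (use that hom in auto)
    then show ?thesis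
      unfolding T_def by (simp add: free_semicircular_system.n2_J'[OF sys])
  qed
  have step: "(\<lambda>k. n2 ((Y k i o\<^sub>L T k (j # w)) - T k (i # j # w) - scale_op (of_real (c i j)) (T k w))) \<longlonglongrightarrow> 0"
    if i: "i \<in> I" and j: "j \<in> I" and w: "set w \<subseteq> I" for i j w
  proof -
    let ?R = "{r \<in> {1..n i}. \<not> (r = n i \<and> r = n j)}"
    let ?e = "\<lambda>k. \<Sum>r\<in>?R. sqrt (q k i j (min r (n j)) * (\<Prod>l\<leftarrow>w. a k l))"
    let ?\<kappa> = "\<lambda>k. \<phi> (Y k i o\<^sub>L Y k j)"
    have "?e \<longlonglongrightarrow> (\<Sum>r\<in>?R. sqrt (0 * (\<Prod>l\<leftarrow>w. c l l)))"
    proof (intro tendsto_sum tendsto_real_sqrt tendsto_mult pa w q_lim i j)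
      fix r assume "r \<in> ?R"
      then show "1 \<le> min r (n j)" "min r (n j) \<le> n i" "min r (n j) \<le> n j"
        "\<not> (min r (n j) = n i \<and> min r (n j) = n j)"
        using n[OF j] by auto
    qed
    moreover have "(\<lambda>k. cmod (?\<kappa> k - of_real (c i j)) * sqrt (\<Prod>l\<leftarrow>w. a k l)) \<longlonglongrightarrow> 0 * sqrt (\<Prod>l\<leftarrow>w. c l l)"
      by (intro tendsto_mult tendsto_real_sqrt pa w tendsto_norm_zero LIM_zero cov i j)
    ultimately have lim: "(\<lambda>k. ?e k + cmod (?\<kappa> k - of_real (c i j)) * sqrt (\<Prod>l\<leftarrow>w. a k l)) \<longlonglongrightarrow> 0"
      using tendsto_add by fastforce
    have le: "n2 ((Y k i o\<^sub>L T k (j # w)) - T k (i # j # w) - scale_op (of_real (c i j)) (T k w)) \<le>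
        ?e k + cmod (?\<kappa> k - of_real (c i j)) * sqrt (\<Prod>l\<leftarrow>w. a k l)" for k
    proof -
      let ?D = "(Y k i o\<^sub>L T k (j # w)) - T k (i # j # w)"
      have D: "?D \<in> A" by (intro A_intros Y T)
      have "n2 (?D - scale_op (?\<kappa> k) (T k w)) \<le> ?e k"
        unfolding Y_def T_def q_def a_def
        by (rule free_semicircular_system.n2_J_compose_tens[OF sys]) (use i j w hom n in auto)
      moreover have eq: "?D - scale_op (of_real (c i j)) (T k w) =
          (?D - scale_op (?\<kappa> k) (T k w)) + scale_op (?\<kappa> k - of_real (c i j)) (T k w)"
        unfolding diff_conv_add_uminus[of "?\<kappa> k" "of_real _"] scale_op_add_left
        by (simp add: uminus_eq_scale_op)
      moreover have "n2 ((?D - scale_op (?\<kappa> k) (T k w)) + scale_op (?\<kappa> k - of_real (c i j)) (T k w)) \<le>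
          n2 (?D - scale_op (?\<kappa> k) (T k w)) + n2 (scale_op (?\<kappa> k - of_real (c i j)) (T k w))"
        by (intro n2_triangle A_diff D A_scale T)
      moreover have "n2 (scale_op (?\<kappa> k - of_real (c i j)) (T k w)) =
          cmod (?\<kappa> k - of_real (c i j)) * sqrt (\<Prod>l\<leftarrow>w. a k l)"
        by (simp add: n2_scale T n2T[OF w])
      ultimately show ?thesis
        unfolding eq by linarith
    qed
    show ?thesis
      by (rule Lim_null_comparison[OF _ lim]) (use le in \<open>simp add: n2_nonneg A_intros Y T\<close>)
  qed
  \<comment> \<open>The Haagerup inequality turns convergence of the variances into a uniform bound
    for the operator norms.\<close>
  have "\<exists>B. \<forall>k. norm (Y k i) \<le> B" if i: "i \<in> I" for i
  proof -
    have "(\<lambda>k. (real (n i) + 1) * sqrt (a k i)) \<longlonglongrightarrow> (real (n i) + 1) * sqrt (c i i)"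
      by (intro tendsto_mult tendsto_const tendsto_real_sqrt a_lim i)
    then have "Bseq (\<lambda>k. (real (n i) + 1) * sqrt (a k i))"
      by (intro convergent_imp_Bseq convergentI)
    then obtain B where B: "\<And>k. norm ((real (n i) + 1) * sqrt (a k i)) \<le> B"
      by (auto simp: Bseq_def)
    have "norm (Y k i) \<le> B" for k
    proof -
      have "norm (Y k i) \<le> (real (n i) + 1) * n2 (Y k i)"
        unfolding Y_def by (rule free_semicircular_system.norm_J_le[OF sys hom[OF i]])
      then show ?thesis using B[of k] by (simp add: n2Y)
    qed
    then show ?thesis by blast
  qed
  then obtain B where B: "\<And>k i. i \<in> I \<Longrightarrow> norm (Y k i) \<le> B i" by metis
  have "(\<lambda>k. \<phi> (op_prod (map (Y k) (rev (rev u))) o\<^sub>L T k [])) \<longlonglongrightarrow> vac (\<lambda>i j. of_real (c i j)) (rev u) []"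
  proof (rule moments_tendsto_vac[where I = I and B = B])
    show "T k [] = id_blinfun" for k
      using free_semicircular_system.J_delta[OF sys, of k 0]
      by (simp add: T_def free_semicircular_system.delta_def[OF sys, abs_def])
    show "T k [i] = Y k i" if "i \<in> I" for k i
    proof -
      have "tens (N k) n (f k) [i] = f k i"
      proof
        fix v
        have "f k i v = 0" if "length v \<noteq> n i"
          using hom[OF \<open>i \<in> I\<close>, of k] that by (simp add: homog_def words_def)
        then show "tens (N k) n (f k) [i] v = f k i v"
          by (cases "length v = n i") (auto simp: contr_def)
      qed
      then show ?thesis by (simp add: T_def Y_def)
    qed
    show "\<phi> (T k w) = 0" if "set w \<subseteq> I" "w \<noteq> []" for k w
      unfolding T_def
    proof (rule free_semicircular_system.state_J_homog[OF sys homog_tens])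
      show "1 \<le> sum_list (map n w)"
        using that n by (cases w) (auto simp: trans_le_add1)
    qed (use that hom in auto)
  qed (use Y T B step u in auto)
  moreover have "T k [] = id_blinfun" for k
    using free_semicircular_system.J_delta[OF sys, of k 0]
    by (simp add: T_def free_semicircular_system.delta_def[OF sys, abs_def])
  ultimately show ?thesis by simp
qed

end

section \<open>Chebyshev polynomials and the semicircle law\<close>

text \<open>The Chebyshev polynomials of the second kind at x / 2, orthogonal for the semicircle law
  of variance 1.\<close>

fun cheb :: "nat \<Rightarrow> real \<Rightarrow> real" where
  "cheb 0 x = 1"
| "cheb (Suc 0) x = x"
| "cheb (Suc (Suc k)) x = x * cheb (Suc k) x - cheb k x"

lemma cheb_cos: "cheb k (2 * cos t) * sin t = sin (real (Suc k) * t)"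
proof (induction k rule: induct_nat_012)
  case 1
  then show ?case using sin_double[of t] by (simp add: mult.commute)
next
  case (ge2 k)
  have "cheb (Suc (Suc k)) (2 * cos t) * sin t =
      2 * cos t * (cheb (Suc k) (2 * cos t) * sin t) - cheb k (2 * cos t) * sin t"
    by (simp add: algebra_simps)
  also have "\<dots> = 2 * cos t * sin (real (Suc (Suc k)) * t) - sin (real (Suc k) * t)"
    using ge2 by simp
  also have "sin (real (Suc k) * t) = sin (real (Suc (Suc k)) * t - t)"
    by (simp add: algebra_simps)
  also have "2 * cos t * sin (real (Suc (Suc k)) * t) - sin (real (Suc (Suc k)) * t - t) =
      sin (real (Suc (Suc k)) * t + t)"
    by (simp add: sin_add sin_diff)
  also have "real (Suc (Suc k)) * t + t = real (Suc (Suc (Suc k))) * t"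
    by (simp add: algebra_simps)
  finally show ?case .
qed simp

lemma continuous_on_cheb: "continuous_on UNIV (cheb k)"
proof (induction k rule: induct_nat_012)
  case 0
  have "cheb 0 = (\<lambda>x. 1)" by (rule ext) simp
  then show ?case by simp
next
  case 1
  have "cheb (Suc 0) = (\<lambda>x. x)" by (rule ext) simp
  then show ?case by simp
next
  case (ge2 k)
  have "cheb (Suc (Suc k)) = (\<lambda>x. x * cheb (Suc k) x - cheb k x)" by (rule ext) simp
  then show ?case using ge2 by (auto intro!: continuous_intros)
qed

text \<open>At x = 2 s cos t the root times the polynomial is 2 s sin ((k + 1) t), so an
  antiderivative can be written down. It involves arccos, which has no derivative at the ends; hence
  the interior form of the fundamental theorem.\<close>

lemma semicircle_cheb_has_integral:
  assumes s: "0 < s" and k: "1 \<le> k"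
  shows "((\<lambda>x. sqrt (4 * s\<^sup>2 - x\<^sup>2) / (2 * pi * s\<^sup>2) * cheb k (x / s)) has_integral 0) {- 2 * s..2 * s}"
proof -
  define \<theta> where "\<theta> x = arccos (x / (2 * s))" for x
  \<comment> \<open>Found from 2 sin ((k + 1) t) sin t = cos (k t) - cos ((k + 2) t). Both sines
    vanish at t = 0 and t = pi, so the integral is 0; k is at least 1, so the first denominator is
    not 0.\<close>
  define F where "F x = - (1 / pi) * (sin (real k * \<theta> x) / real k - sin (real (k + 2) * \<theta> x) / real (k + 2))" for x
  let ?h = "\<lambda>x. sqrt (4 * s\<^sup>2 - x\<^sup>2) / (2 * pi * s\<^sup>2) * cheb k (x / s)"
  have "(?h has_integral (F (2 * s) - F (- 2 * s))) {- 2 * s..2 * s}"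
  proof (rule fundamental_theorem_of_calculus_interior)
    show "- 2 * s \<le> 2 * s" using s by simp
    show "continuous_on {- 2 * s..2 * s} F"
      unfolding F_def \<theta>_def using s k
      by (intro continuous_intros ballI) (auto simp: field_simps)
  next
    fix x assume x: "x \<in> {- 2 * s<..<2 * s}"
    define y where "y = x / (2 * s)"
    define t where "t = \<theta> x"
    have y: "- 1 < y" "y < 1" using x s by (auto simp: y_def field_simps)
    have xy: "x = 2 * s * y" using s by (simp add: y_def)
    have cos: "cos t = y" and sin: "sin t = sqrt (1 - y\<^sup>2)"
      using y by (auto simp: t_def \<theta>_def y_def[symmetric] sin_arccos_abs cos_arccos_abs)
    have pos: "0 < 1 - y\<^sup>2" using y by (simp add: abs_square_less_1 abs_less_iff)
    then have sin_pos: "0 < sin t" by (simp add: sin)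
    have d\<theta>: "(\<theta> has_real_derivative (inverse (- sin t) * (1 / (2 * s)))) (at x)"
    proof -
      have "((\<lambda>x. x / (2 * s)) has_real_derivative (1 / (2 * s))) (at x)"
        using s by (auto intro!: derivative_eq_intros)
      moreover have "(arccos has_real_derivative inverse (- sin t)) (at (x / (2 * s)))"
        using DERIV_arccos[OF y] by (simp add: sin y_def)
      ultimately show ?thesis
        unfolding \<theta>_def by (rule DERIV_chain2[rotated])
    qed
    have "(F has_real_derivative (- (1 / pi) * (cos (real k * t) - cos (real (k + 2) * t)) * (inverse (- sin t) * (1 / (2 * s))))) (at x)"
    proof -
      have piece: "((\<lambda>x. sin (a * \<theta> x) / a) has_real_derivative cos (a * t) * (inverse (- sin t) * (1 / (2 * s)))) (at x)"
        if "a > 0" for a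
      proof -
        have "((\<lambda>x. sin (a * \<theta> x)) has_real_derivative cos (a * t) * (a * (inverse (- sin t) * (1 / (2 * s))))) (at x)"
          unfolding t_def by (rule DERIV_fun_sin, rule DERIV_cmult, rule d\<theta>[unfolded t_def])
        from DERIV_cdivide[OF this, of a] show ?thesis using that by simp
      qed
      have "((\<lambda>x. - (1 / pi) * (sin (real k * \<theta> x) / real k - sin (real (k + 2) * \<theta> x) / real (k + 2))) has_real_derivative
          - (1 / pi) * (cos (real k * t) * (inverse (- sin t) * (1 / (2 * s))) - cos (real (k + 2) * t) * (inverse (- sin t) * (1 / (2 * s))))) (at x)"
        using k by (intro DERIV_cmult DERIV_diff piece) auto
      then show ?thesis
        unfolding F_def by (simp only: left_diff_distrib mult.assoc)
    qed
    also have "cos (real k * t) - cos (real (k + 2) * t) = 2 * sin (real (Suc k) * t) * sin t"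
    proof -
      have "real k * t = real (Suc k) * t - t" "real (k + 2) * t = real (Suc k) * t + t"
        by (simp_all add: algebra_simps)
      then show ?thesis by (simp only: cos_add cos_diff)
    qed
    also have "- (1 / pi) * (2 * sin (real (Suc k) * t) * sin t) * (inverse (- sin t) * (1 / (2 * s))) =
        sin (real (Suc k) * t) / (pi * s)"
      using sin_pos s by (simp add: field_simps)
    also have "\<dots> = ?h x"
    proof -
      have "4 * s\<^sup>2 - x\<^sup>2 = (2 * s)\<^sup>2 * (1 - y\<^sup>2)"
        by (simp add: xy power_mult_distrib algebra_simps)
      then have "sqrt (4 * s\<^sup>2 - x\<^sup>2) = 2 * s * sin t"
        using s by (simp add: real_sqrt_mult sin)
      moreover have "x / s = 2 * cos t" using s by (simp add: cos xy)
      ultimately have "?h x = 2 * s * (cheb k (2 * cos t) * sin t) / (2 * pi * s\<^sup>2)" by simp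
      then show ?thesis
        using s by (simp add: cheb_cos power2_eq_square)
    qed
    finally show "(F has_vector_derivative ?h x) (at x)"
      by (simp add: has_real_derivative_iff_has_vector_derivative)
  qed
  moreover have "F (2 * s) = 0" "F (- 2 * s) = 0"
    using s sin_npi[of k] sin_npi[of "k + 2"] by (simp_all add: F_def \<theta>_def mult.commute del: sin_npi)
  ultimately show ?thesis by simp
qed

lemma integral_semicircular_cheb:
  assumes v: "0 < v" and k: "1 \<le> k"
  shows "(\<integral>x. cheb k (x / sqrt v) \<partial>semicircular v) = 0"
proof -
  define s where "s = sqrt v"
  have s: "0 < s" "v = s\<^sup>2" using v by (auto simp: s_def)
  have s': "sqrt v = s" by (simp add: s_def)
  let ?h = "\<lambda>x. sqrt (4 * s\<^sup>2 - x\<^sup>2) / (2 * pi * s\<^sup>2) * cheb k (x / s)"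
  have meas: "(\<lambda>x. cheb k (x / s)) \<in> borel_measurable borel"
    by (intro borel_measurable_continuous_onI continuous_on_compose2[OF continuous_on_cheb])
      (use s in \<open>auto intro!: continuous_intros\<close>)
  have ind: "{x. \<bar>x\<bar> \<le> 2 * s} = {- 2 * s..2 * s}" by auto
  have "(\<integral>x. cheb k (x / s) \<partial>semicircular v) =
      (\<integral>x. (indicator {x. \<bar>x\<bar> \<le> 2 * s} x * (sqrt (4 * v - x\<^sup>2) / (2 * pi * v))) *\<^sub>R cheb k (x / s) \<partial>lborel)"
    unfolding semicircular_def s'
  proof (rule integral_density)
    show "(\<lambda>x. indicat_real {x. \<bar>x\<bar> \<le> 2 * s} x * (sqrt (4 * v - x\<^sup>2) / (2 * pi * v))) \<in> borel_measurable lborel"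
      unfolding ind by measurable
    show "AE x in lborel. 0 \<le> indicat_real {x. \<bar>x\<bar> \<le> 2 * s} x * (sqrt (4 * v - x\<^sup>2) / (2 * pi * v))"
    proof (rule AE_I2)
      fix x
      have "x\<^sup>2 \<le> (2 * s)\<^sup>2" if "\<bar>x\<bar> \<le> 2 * s"
        using that s power_mono[of "\<bar>x\<bar>" "2 * s" 2] by simp
      then show "0 \<le> indicat_real {x. \<bar>x\<bar> \<le> 2 * s} x * (sqrt (4 * v - x\<^sup>2) / (2 * pi * v))"
        using s by (auto simp: indicator_def power_mult_distrib)
    qed
  qed (use meas in simp)
  also have "\<dots> = (LINT x:{- 2 * s..2 * s}|lborel. ?h x)"
    unfolding ind set_lebesgue_integral_def by (simp add: s(2) mult.assoc)
  also have "\<dots> = integral {- 2 * s..2 * s} ?h"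
  proof (rule set_borel_integral_eq_integral)
    show "set_integrable lborel {- 2 * s..2 * s} ?h"
    proof (rule borel_integrable_atLeastAtMost')
      show "continuous_on {- 2 * s..2 * s} ?h"
        using s by (intro continuous_intros continuous_on_compose2[OF continuous_on_cheb]) auto
    qed
  qed
  also have "\<dots> = 0"
    using semicircle_cheb_has_integral[OF s(1) k] by (rule integral_unique)
  finally show ?thesis unfolding s' .
qed

section \<open>Increments of free Brownian motion\<close>

lemma wick_append:
  assumes "u \<noteq> []" "v \<noteq> []" "last u \<noteq> hd v"
  shows "wick X (u @ v) = wick X u o\<^sub>L wick X v"
proof -
  have "u = butlast u @ [last u]" "v = hd v # tl v" using assms by auto
  moreover have "wick X ((butlast u @ [last u]) @ (hd v # tl v)) =
      wick X (butlast u @ [last u]) o\<^sub>L wick X (hd v # tl v)"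
    using assms(3) by (simp add: wick_snoc_compose_Cons)
  ultimately show ?thesis by metis
qed

text \<open>Consecutive blocks carry different labels, as the words in the definition of freeness
  do.\<close>

lemma ex_blocks:
  "v \<noteq> [] \<Longrightarrow> \<exists>bs. concat (map snd bs) = v \<and> distinct_adj (map fst bs) \<and> bs \<noteq> [] \<and>
     (\<forall>(b, u)\<in>set bs. u \<noteq> [] \<and> (\<forall>x\<in>set u. P x = b))"
proof (induction v)
  case (Cons x v)
  show ?case
  proof (cases "v = []")
    case True
    then show ?thesis by (intro exI[of _ "[(P x, [x])]"]) simp
  next
    case False
    then obtain bs where bs: "concat (map snd bs) = v" "distinct_adj (map fst bs)" "bs \<noteq> []"
      "\<forall>(b, u)\<in>set bs. u \<noteq> [] \<and> (\<forall>x\<in>set u. P x = b)"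
      using Cons.IH by blast
    then obtain b u rest where bs_eq: "bs = (b, u) # rest" by (cases bs) auto
    show ?thesis
    proof (cases "P x = b")
      case True
      then show ?thesis
        using bs by (intro exI[of _ "(b, x # u) # rest"]) (auto simp: bs_eq)
    next
      case False
      then show ?thesis
        using bs by (intro exI[of _ "(P x, [x]) # bs"]) (auto simp: bs_eq)
    qed
  qed
qed simp

text \<open>Letters on the two sides of a seam between blocks differ, since \<open>P\<close>
  separates them. No contraction occurs there and the Wick word factorises.\<close>

lemma wick_concat_blocks:
  assumes "distinct_adj (map fst bs)" "\<forall>(b, u)\<in>set bs. u \<noteq> [] \<and> (\<forall>x\<in>set u. P x = b)"
  shows "wick X (concat (map snd bs)) = op_prod (map (\<lambda>(b, u). wick X u) bs)"
  using assms
proof (induction bs)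
  case (Cons z bs)
  obtain b u where z: "z = (b, u)" by (cases z)
  show ?case
  proof (cases bs)
    case Nil
    then show ?thesis by (simp add: z)
  next
    case (Cons z' rest)
    obtain b' u' where z': "z' = (b', u')" by (cases z')
    have u: "u \<noteq> []" "u' \<noteq> []" "P (last u) = b" "P (hd u') = b'" "b \<noteq> b'"
      using Cons.prems by (auto simp: z z' local.Cons)
    then have "wick X (u @ concat (map snd bs)) = wick X u o\<^sub>L wick X (concat (map snd bs))"
      by (intro wick_append) (auto simp: local.Cons z')
    then show ?thesis
      using Cons.IH Cons.prems by (auto simp: z dest: distinct_adj_ConsD)
  qed
qed simp

lemma op_pow_scale_op:
  assumes "D \<in> BH" shows "op_pow (scale_op a D) m = scale_op (a ^ m) (op_pow D m)"
proof (induction m)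
  case (Suc m)
  then show ?case
    using assms by (simp add: op_pow_Suc compose_scale_op_left compose_scale_op_right mult.commute)
qed simp

lemma generated_algebraI: "(\<And>B. \<lbrakk>unital_subalgebra B; G \<subseteq> B\<rbrakk> \<Longrightarrow> T \<in> B) \<Longrightarrow> T \<in> generated_algebra G"
  by (simp add: generated_algebra_def hull_def)

context tracial_W_prob_space
begin

lemma semicircular_wick_centred:
  assumes v: "0 < v" and D: "D \<in> A" and law: "has_law \<phi> D (semicircular v)" and k: "1 \<le> k"
    and X: "X i = scale_op (complex_of_real (1 / sqrt v)) D"
  shows "\<phi> (wick X (replicate k i)) = 0"
proof -
  let ?\<mu> = "semicircular v"
  let ?r = "1 / sqrt v"
  have Xi: "X i \<in> A" using D by (simp add: X A_scale)
  have W: "wick X (replicate k i) \<in> A" for k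
    by (rule wick_in_subalgebra[OF unital]) (use Xi in auto)
  have int: "integrable ?\<mu> (\<lambda>x. x ^ m)" and mom: "\<phi> (op_pow D m) = complex_of_real (\<integral>x. x ^ m \<partial>?\<mu>)" for m
    using law by (auto simp: has_law_def)
  \<comment> \<open>The power in front absorbs the factor \<open>X i\<close> of the Chebyshev
    recursion, which the induction would otherwise not be able to evaluate.\<close>
  have claim: "integrable ?\<mu> (\<lambda>x. (x / sqrt v) ^ m * cheb k (x / sqrt v)) \<and>
     \<phi> (op_pow (X i) m o\<^sub>L wick X (replicate k i)) =
       complex_of_real (\<integral>x. (x / sqrt v) ^ m * cheb k (x / sqrt v) \<partial>?\<mu>)" for m k
  proof (induction k arbitrary: m rule: induct_nat_012)
    have pow: "integrable ?\<mu> (\<lambda>x. (x / sqrt v) ^ m)"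
      "\<phi> (op_pow (X i) m) = complex_of_real (\<integral>x. (x / sqrt v) ^ m \<partial>?\<mu>)" for m
    proof -
      have "(\<lambda>x. (x / sqrt v) ^ m) = (\<lambda>x. ?r ^ m * x ^ m)"
        by (simp add: power_divide field_simps)
      then show "integrable ?\<mu> (\<lambda>x. (x / sqrt v) ^ m)"
        "\<phi> (op_pow (X i) m) = complex_of_real (\<integral>x. (x / sqrt v) ^ m \<partial>?\<mu>)"
        using int[of m] D by (simp_all add: X op_pow_scale_op A_BH state_scale A_pow mom)
    qed
    {
      case 0
      then show ?case using pow by simp
    next
      case 1
      have "op_pow (X i) m o\<^sub>L X i = op_pow (X i) (Suc m)" by (simp add: op_pow_Suc')
      then show ?case using pow[of "Suc m"] by (simp add: mult.commute)
    next
      case (ge2 k)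
      show ?case
      proof -
        have e: "(x / sqrt v) ^ m * cheb (Suc (Suc k)) (x / sqrt v) =
            (x / sqrt v) ^ Suc m * cheb (Suc k) (x / sqrt v) - (x / sqrt v) ^ m * cheb k (x / sqrt v)" for x
          by (simp add: algebra_simps)
        have w: "op_pow (X i) m o\<^sub>L wick X (replicate (Suc (Suc k)) i) =
            (op_pow (X i) (Suc m) o\<^sub>L wick X (replicate (Suc k) i)) - (op_pow (X i) m o\<^sub>L wick X (replicate k i))"
          by (simp add: compose_diff_right op_pow_Suc' compose_assoc)
        have i: "integrable ?\<mu> (\<lambda>x. (x / sqrt v) ^ Suc m * cheb (Suc k) (x / sqrt v))"
          "integrable ?\<mu> (\<lambda>x. (x / sqrt v) ^ m * cheb k (x / sqrt v))"
          using ge2(1)[of m] ge2(2)[of "Suc m"] by blast+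
        have d: "\<phi> (op_pow (X i) m o\<^sub>L wick X (replicate (Suc (Suc k)) i)) =
            \<phi> (op_pow (X i) (Suc m) o\<^sub>L wick X (replicate (Suc k) i)) - \<phi> (op_pow (X i) m o\<^sub>L wick X (replicate k i))"
          unfolding w by (intro state_diff A_compose A_pow W Xi)
        show ?thesis
          unfolding e d using ge2(1)[of m] ge2(2)[of "Suc m"]
          by (simp only: Bochner_Integration.integral_diff[OF i] Bochner_Integration.integrable_diff[OF i] of_real_diff)
      qed
    }
  qed
  show ?thesis
    using claim[of 0 k] integral_semicircular_cheb[OF v k] by simp
qed

end

context free_brownian_motion
begin

text \<open>Freeness is only given for one increment against its past. A word is cut into blocks according to
  whether a letter is the largest one, \<open>j\<close>; the blocks without \<open>j\<close> lie in the past of the \<open>j\<close>-th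
  increment and are centred by induction.\<close>

theorem free_increments:
  fixes \<tau> :: "nat \<Rightarrow> real" and N :: nat
  assumes \<tau>0: "0 \<le> \<tau> 0" and mono: "\<And>i. i < N \<Longrightarrow> \<tau> i < \<tau> (Suc i)"
  defines "X \<equiv> \<lambda>i. scale_op (complex_of_real (1 / sqrt (\<tau> (Suc i) - \<tau> i))) (S (\<tau> (Suc i)) - S (\<tau> i))"
  shows "free_semicircular_system A \<phi> X N"
proof -
  have \<tau>_mono: "\<tau> i \<le> \<tau> j" if "i \<le> j" "j \<le> N" for i j
    using that
  proof (induction j)
    case (Suc j)
    then show ?case using mono[of j] by (cases "i = Suc j") auto
  qed simp
  have \<tau>_nonneg: "0 \<le> \<tau> i" if "i \<le> N" for i
    using \<tau>_mono[of 0 i] \<tau>0 that by simp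
  have S_filt: "S (\<tau> i) \<in> \<A> (\<tau> j)" if "i \<le> j" "j \<le> N" for i j
    using adapted[of "\<tau> i"] filtration_mono[of "\<tau> i" "\<tau> j"] \<tau>_mono[OF that] \<tau>_nonneg[of i] that by auto
  have ua: "unital_subalgebra (\<A> (\<tau> j))" if "j \<le> N" for j
    using filtration_von_neumann[OF \<tau>_nonneg[OF that]] by (simp add: von_neumann_algebra_def)
  have X_filt: "X i \<in> \<A> (\<tau> j)" if "i < j" "j \<le> N" for i j
  proof -
    have "S (\<tau> (Suc i)) - S (\<tau> i) \<in> \<A> (\<tau> j)"
      using that by (intro unital_subalgebra_diff[OF ua] S_filt) auto
    then show ?thesis using ua[OF that(2)] by (simp add: X_def unital_subalgebra_def)
  qed
  have D_A: "S (\<tau> (Suc i)) - S (\<tau> i) \<in> A" if "i < N" for i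
    using that filtration_subset[OF \<tau>_nonneg[of "Suc i"]] S_filt[of i "Suc i"] S_filt[of "Suc i" "Suc i"]
    by (intro A_diff) auto
  have single: "\<phi> (wick X (replicate k i)) = 0" if "i < N" "1 \<le> k" for i k
  proof (rule semicircular_wick_centred)
    show "0 < \<tau> (Suc i) - \<tau> i" using mono[OF that(1)] by simp
    show "has_law \<phi> (S (\<tau> (Suc i)) - S (\<tau> i)) (semicircular (\<tau> (Suc i) - \<tau> i))"
      using mono[OF that(1)] \<tau>_nonneg[of i] that by (intro increment_law) auto
    show "X i = scale_op (complex_of_real (1 / sqrt (\<tau> (Suc i) - \<tau> i))) (S (\<tau> (Suc i)) - S (\<tau> i))"
      by (simp add: X_def)
  qed (use that D_A in auto)
  have centred: "\<phi> (wick X v) = 0" if "set v \<subseteq> {..<j}" "v \<noteq> []" "j \<le> N" for v j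
    using that
  proof (induction j arbitrary: v)
    case (Suc j)
    obtain bs where bs: "concat (map snd bs) = v" "distinct_adj (map fst bs)" "bs \<noteq> []"
      "\<forall>(b, u)\<in>set bs. u \<noteq> [] \<and> (\<forall>x\<in>set u. (x = j) = b)"
      using ex_blocks[OF Suc.prems(2), of "\<lambda>x. x = j"] by blast
    let ?D = "S (\<tau> (Suc j)) - S (\<tau> j)"
    let ?B = "\<lambda>b. if b then generated_algebra {?D} else \<A> (\<tau> j)"
    define w where "w = map (\<lambda>(b, u). (b, wick X u)) bs"
    have "free_from \<phi> ?D (\<A> (\<tau> j))"
      using Suc.prems \<tau>_nonneg[of j] mono[of j] by (intro increment_free) auto
    then have free: "free_subalgebras \<phi> UNIV ?B" by (simp add: free_from_def)
    have "Y \<in> ?B b \<and> \<phi> Y = 0" if wY: "(b, Y) \<in> set w" for b Y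
    proof -
      obtain u where u: "(b, u) \<in> set bs" "Y = wick X u"
        using wY unfolding w_def by auto
      then have ub: "u \<noteq> []" "\<And>x. x \<in> set u \<Longrightarrow> (x = j) = b" using bs(4) by auto
      have "set u \<subseteq> set v" using u(1) bs(1) by force
      show ?thesis
      proof (cases b)
        case True
        then have "u = replicate (length u) j"
          using ub by (metis (full_types) replicate_eqI)
        moreover have "1 \<le> length u" using ub(1) by (cases u) auto
        ultimately have "\<phi> Y = 0"
          using single[of j "length u"] Suc.prems(3) u(2) by simp
        moreover have "Y \<in> generated_algebra {?D}"
        proof (rule generated_algebraI)
          fix B assume B: "unital_subalgebra B" "{?D} \<subseteq> B"
          then have "X j \<in> B" by (simp add: X_def unital_subalgebra_def)
          then show "Y \<in> B"
            unfolding u(2) using ub(2) True by (intro wick_in_subalgebra[OF B(1)]) auto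
        qed
        ultimately show ?thesis using True by simp
      next
        case False
        then have "set u \<subseteq> {..<j}"
          using ub(2) \<open>set u \<subseteq> set v\<close> Suc.prems(1) by (fastforce simp: less_Suc_eq)
        then have "\<phi> Y = 0" "Y \<in> \<A> (\<tau> j)"
          using Suc.IH[of u] ub(1) Suc.prems(3) u(2)
          by (auto intro!: wick_in_subalgebra[OF ua] X_filt)
        then show ?thesis using False by simp
      qed
    qed
    moreover have "w \<noteq> []" "distinct_adj (map fst w)"
      using bs by (auto simp: w_def case_prod_beta comp_def)
    ultimately have "\<phi> (op_prod (map snd w)) = 0"
      using free unfolding free_subalgebras_def by blast
    also have "op_prod (map snd w) = wick X v"
      using wick_concat_blocks[OF bs(2,4), of X] bs(1)
      unfolding w_def case_prod_beta by (simp add: comp_def)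
    finally show ?case .
  qed simp
  show ?thesis
  proof (unfold_locales)
    show "X i \<in> A" if "i < N" for i
      using D_A[OF that] by (simp add: X_def A_scale)
    show "adj (X i) = X i" if "i < N" for i
    proof -
      have "S (\<tau> (Suc i)) \<in> A" "S (\<tau> i) \<in> A"
        using that filtration_subset[OF \<tau>_nonneg[of "Suc i"]] S_filt[of i "Suc i"] S_filt[of "Suc i" "Suc i"] by auto
      then have "adj (S (\<tau> (Suc i)) - S (\<tau> i)) = S (\<tau> (Suc i)) - S (\<tau> i)"
        using that \<tau>_nonneg[of i] \<tau>_nonneg[of "Suc i"] by (simp add: adj_diff A_BH self_adjoint)
      then show ?thesis
        using A_BH[OF D_A[OF that]] by (simp add: X_def adj_scale_op)
    qed
    show "\<phi> (wick X v) = 0" if "set v \<subseteq> {..<N}" "v \<noteq> []" for v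
      using centred[OF that order_refl] .
  qed
qed

end

section \<open>Step functions off the diagonals are dense\<close>

abbreviation "halfline \<equiv> restrict_space lborel {0::real..}"

section \<open>Null sets of the product measure\<close>

lemma sigma_finite_halfline: "sigma_finite_measure halfline"
  by (rule sigma_finite_measure_restrict_space) (auto intro: lborel.sigma_finite_measure_axioms)

interpretation Rp: product_sigma_finite "\<lambda>_::nat. halfline"
  by (simp add: product_sigma_finite_def sigma_finite_halfline)

lemma space_Rplus: "space (Rplus n) = (\<Pi>\<^sub>E i\<in>{1..n}. {0..})"
  by (simp add: Rplus_def space_PiM space_restrict_space)

lemma measurable_coord: "i \<in> {1..n} \<Longrightarrow> (\<lambda>t. t i) \<in> borel_measurable (Rplus n)"
proof -
  assume "i \<in> {1..n}"
  then have "(\<lambda>t. t i) \<in> measurable (Rplus n) halfline"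
    unfolding Rplus_def by (rule measurable_component_singleton)
  then show ?thesis
    by (simp add: measurable_restrict_space2_iff)
qed

lemma AE_halfline_countable: "countable Z \<Longrightarrow> AE y in halfline. y \<notin> Z"
  using AE_not_in[of Z lborel] countable_imp_null_set_lborel[of Z]
  by (auto simp: AE_restrict_space_iff)

text \<open>Integrating over the coordinate \<open>i\<close> first: countable sections are null, so
  the whole set is.\<close>

lemma Rplus_null_by_section:
  assumes A: "A \<in> sets (Rplus n)" and i: "i \<in> {1..n}"
    and sec: "\<And>x. countable {y. x(i := y) \<in> A}"
  shows "emeasure (Rplus n) A = 0"
proof -
  have ins: "insert i ({1..n} - {i}) = {1..n}" using i by auto
  have meas: "indicator A \<in> borel_measurable (Pi\<^sub>M (insert i ({1..n} - {i})) (\<lambda>_. halfline))"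
    unfolding ins using A by (simp add: Rplus_def)
  have "emeasure (Rplus n) A = (\<integral>\<^sup>+x. indicator A x \<partial>Rplus n)"
    using A by simp
  also have "\<dots> = (\<integral>\<^sup>+x. indicator A x \<partial>Pi\<^sub>M (insert i ({1..n} - {i})) (\<lambda>_. halfline))"
    unfolding ins by (simp add: Rplus_def)
  also have "\<dots> = (\<integral>\<^sup>+x. (\<integral>\<^sup>+y. indicator A (x(i := y)) \<partial>halfline) \<partial>Pi\<^sub>M ({1..n} - {i}) (\<lambda>_. halfline))"
    by (rule Rp.product_nn_integral_insert[OF _ _ meas]) auto
  also have "\<dots> = (\<integral>\<^sup>+x. 0 \<partial>Pi\<^sub>M ({1..n} - {i}) (\<lambda>_. halfline))"
  proof (rule nn_integral_cong)
    fix x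
    have "AE y in halfline. indicator A (x(i := y)) = (0::ennreal)"
      using AE_halfline_countable[OF sec[of x]] by eventually_elim (auto simp: indicator_def)
    then show "(\<integral>\<^sup>+y. indicator A (x(i := y)) \<partial>halfline) = 0"
      by (subst nn_integral_cong_AE[where v = "\<lambda>_. 0"]) auto
  qed
  finally show ?thesis by simp
qed

lemma AE_coord_notin:
  assumes Z: "countable Z" shows "AE t in Rplus n. \<forall>i\<in>{1..n}. t i \<notin> Z"
proof (rule AE_ball_countable[THEN iffD2], simp, rule ballI)
  fix i assume i: "i \<in> {1..n}"
  let ?A = "{t \<in> space (Rplus n). t i \<in> Z}"
  have "Z \<in> sets borel"
    using Z by (rule sets.countable[rotated]) auto
  then have "(\<lambda>t. t i) -` Z \<inter> space (Rplus n) \<in> sets (Rplus n)"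
    by (rule measurable_sets[OF measurable_coord[OF i]])
  also have "(\<lambda>t. t i) -` Z \<inter> space (Rplus n) = ?A" by auto
  finally have A: "?A \<in> sets (Rplus n)" .
  have "emeasure (Rplus n) ?A = 0"
    by (rule Rplus_null_by_section[OF A i]) (auto intro: countable_subset[OF _ Z])
  then show "AE t in Rplus n. t i \<notin> Z"
    using A by (intro AE_I[of _ _ ?A]) auto
qed

text \<open>The diagonals are null sets. This is what lets step functions supported off them be
  dense.\<close>

lemma AE_coord_distinct: "AE t in Rplus n. \<forall>i\<in>{1..n}. \<forall>j\<in>{1..n}. i \<noteq> j \<longrightarrow> t i \<noteq> t j"
proof (rule AE_ball_countable[THEN iffD2], simp, rule ballI, rule AE_ball_countable[THEN iffD2], simp, rule ballI)
  fix i j assume i: "i \<in> {1..n}" and j: "j \<in> {1..n}"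
  let ?A = "{t \<in> space (Rplus n). t i = t j}"
  show "AE t in Rplus n. i \<noteq> j \<longrightarrow> t i \<noteq> t j"
  proof (cases "i = j")
    case False
    have A: "?A \<in> sets (Rplus n)"
      using measurable_coord[OF i] measurable_coord[OF j] by (rule borel_measurable_eq)
    have "emeasure (Rplus n) ?A = 0"
    proof (rule Rplus_null_by_section[OF A i])
      fix x
      have "{y. x(i := y) \<in> ?A} \<subseteq> {x j}" using False by auto
      then show "countable {y. x(i := y) \<in> ?A}" by (rule countable_subset) simp
    qed
    then show ?thesis
      using A by (intro AE_I[of _ _ ?A]) auto
  qed simp
qed

text \<open>The half-line is intersected in so that the box lies in the space of
  \<open>Rplus n\<close> even when \<open>a i\<close> is negative.\<close>

definition obox :: "nat \<Rightarrow> (nat \<Rightarrow> real) \<Rightarrow> (nat \<Rightarrow> real) \<Rightarrow> (nat \<Rightarrow> real) set" where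
  "obox n a b = (\<Pi>\<^sub>E i\<in>{1..n}. {0..} \<inter> {a i<..<b i})"

lemma obox_sets [measurable]: "obox n a b \<in> sets (Rplus n)"
  unfolding obox_def Rplus_def
  by (rule sets_PiM_I_finite) (auto simp: sets_restrict_space)

lemma emeasure_obox: "emeasure (Rplus n) (obox n a b) = (\<Prod>i\<in>{1..n}. emeasure lborel ({0..} \<inter> {a i<..<b i}))"
proof -
  have "emeasure (Rplus n) (obox n a b) = (\<Prod>i\<in>{1..n}. emeasure halfline ({0..} \<inter> {a i<..<b i}))"
    unfolding obox_def Rplus_def
    by (rule Rp.emeasure_PiM) (auto simp: sets_restrict_space)
  then show ?thesis by (simp add: emeasure_restrict_space)
qed

lemma emeasure_obox_finite: "emeasure (Rplus n) (obox n a b) < \<infinity>"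
proof -
  have "emeasure lborel ({0..} \<inter> {a i<..<b i}) < \<infinity>" for i
    by (rule emeasure_bounded_finite) (auto intro: bounded_subset[of "{a i<..<b i}"])
  then have "(\<Prod>i\<in>I. emeasure lborel ({0..} \<inter> {a i<..<b i})) < \<infinity>" for I
    by (induction I rule: infinite_finite_induct) (auto simp: ennreal_mult_less_top)
  then show ?thesis unfolding emeasure_obox .
qed

lemma prod_indicator_obox:
  assumes "t \<in> space (Rplus n)"
  shows "(\<Prod>i=1..n. indicator {a i<..<b i} (t i)) = (indicator (obox n a b) t :: complex)"
proof (cases "t \<in> obox n a b")
  case True
  then have "\<forall>i\<in>{1..n}. t i \<in> {a i<..<b i}" by (auto simp: obox_def)
  then show ?thesis using True by simp
next
  case False
  then have "\<exists>i\<in>{1..n}. t i \<notin> {a i<..<b i}"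
    using assms by (auto simp: obox_def space_Rplus PiE_def Pi_def)
  then show ?thesis
    using False by (auto simp: prod_zero_iff indicator_def)
qed

lemma box_fun_eq:
  "t \<in> space (Rplus n) \<Longrightarrow> box_fun n ts t = (\<Sum>(c, a, b)\<leftarrow>ts. c * indicator (obox n a b) t)"
  unfolding box_fun_def by (simp only: prod_indicator_obox)

section \<open>The squared L2 distance and step functions\<close>

definition d2 :: "nat \<Rightarrow> ((nat \<Rightarrow> real) \<Rightarrow> complex) \<Rightarrow> real" where
  "d2 n f = (\<integral>t. (cmod (f t))\<^sup>2 \<partial>Rplus n)"

lemma d2_nonneg: "0 \<le> d2 n f"
  by (simp add: d2_def)

lemma cmod_add_square_le: "(cmod (x + y))\<^sup>2 \<le> 2 * (cmod x)\<^sup>2 + 2 * (cmod y)\<^sup>2"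
proof -
  have "(cmod (x + y))\<^sup>2 \<le> (cmod x + cmod y)\<^sup>2"
    by (intro power_mono norm_triangle_ineq) simp
  also have "\<dots> \<le> 2 * (cmod x)\<^sup>2 + 2 * (cmod y)\<^sup>2"
    using sum_squares_bound[of "cmod x" "cmod y"] by (simp add: power2_sum)
  finally show ?thesis .
qed

lemma L2_add: "f \<in> L2 n \<Longrightarrow> g \<in> L2 n \<Longrightarrow> (\<lambda>t. f t + g t) \<in> L2 n"
proof -
  assume f: "f \<in> L2 n" and g: "g \<in> L2 n"
  then have "integrable (Rplus n) (\<lambda>t. 2 * (cmod (f t))\<^sup>2 + 2 * (cmod (g t))\<^sup>2)"
    by (auto simp: L2_def)
  then have "integrable (Rplus n) (\<lambda>t. (cmod (f t + g t))\<^sup>2)"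
    by (rule Bochner_Integration.integrable_bound)
      (use f g in \<open>auto simp: L2_def intro!: order_trans[OF cmod_add_square_le]\<close>)
  then show ?thesis using f g by (simp add: L2_def borel_measurable_add)
qed

lemma L2_scale: "f \<in> L2 n \<Longrightarrow> (\<lambda>t. a * f t) \<in> L2 n"
  by (auto simp: L2_def norm_mult power_mult_distrib)

lemma L2_diff: "f \<in> L2 n \<Longrightarrow> g \<in> L2 n \<Longrightarrow> (\<lambda>t. f t - g t) \<in> L2 n"
  using L2_add[of f n "\<lambda>t. (-1) * g t"] L2_scale[of g n "-1"] by simp

lemma L2_cong: "(\<And>t. t \<in> space (Rplus n) \<Longrightarrow> f t = g t) \<Longrightarrow> f \<in> L2 n \<longleftrightarrow> g \<in> L2 n"
  by (simp add: L2_def cong: measurable_cong Bochner_Integration.integrable_cong)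

lemma d2_cong: "(\<And>t. t \<in> space (Rplus n) \<Longrightarrow> f t = g t) \<Longrightarrow> d2 n f = d2 n g"
  by (auto simp: d2_def intro: Bochner_Integration.integral_cong)

lemma L2_indicator: "A \<in> sets (Rplus n) \<Longrightarrow> emeasure (Rplus n) A < \<infinity> \<Longrightarrow> indicator A \<in> L2 n"
proof -
  assume A: "A \<in> sets (Rplus n)" "emeasure (Rplus n) A < \<infinity>"
  have "(\<lambda>t. (cmod (indicator A t))\<^sup>2) = indicat_real A" by (auto simp: indicator_def)
  then show ?thesis using A by (simp add: L2_def)
qed

lemma d2_add_le: "f \<in> L2 n \<Longrightarrow> g \<in> L2 n \<Longrightarrow> d2 n (\<lambda>t. f t + g t) \<le> 2 * d2 n f + 2 * d2 n g"
proof -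
  assume f: "f \<in> L2 n" and g: "g \<in> L2 n"
  have "d2 n (\<lambda>t. f t + g t) \<le> (\<integral>t. 2 * (cmod (f t))\<^sup>2 + 2 * (cmod (g t))\<^sup>2 \<partial>Rplus n)"
    unfolding d2_def
    by (rule integral_mono) (use f g L2_add[OF f g] in \<open>auto simp: L2_def intro!: cmod_add_square_le\<close>)
  also have "\<dots> = 2 * d2 n f + 2 * d2 n g"
    using f g by (auto simp: L2_def d2_def)
  finally show ?thesis .
qed

lemma d2_diff_le: "\<lbrakk>f \<in> L2 n; g \<in> L2 n; h \<in> L2 n\<rbrakk> \<Longrightarrow>
  d2 n (\<lambda>t. f t - h t) \<le> 2 * d2 n (\<lambda>t. f t - g t) + 2 * d2 n (\<lambda>t. g t - h t)"
  using d2_add_le[OF L2_diff[of f n g] L2_diff[of g n h]] by simp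

lemma d2_minus_commute: "d2 n (\<lambda>t. f t - g t) = d2 n (\<lambda>t. g t - f t)"
  by (simp add: d2_def norm_minus_commute)

lemma box_fun_L2: "box_fun n ts \<in> L2 n"
proof (induction ts)
  case Nil
  then show ?case by (simp add: box_fun_def L2_def)
next
  case (Cons z ts)
  obtain c a b where z: "z = (c, a, b)" by (cases z)
  have "(\<lambda>t. c * indicator (obox n a b) t + box_fun n ts t) \<in> L2 n"
    by (intro L2_add L2_scale L2_indicator obox_sets emeasure_obox_finite Cons)
  then show ?case
    by (subst L2_cong[where g = "\<lambda>t. c * indicator (obox n a b) t + box_fun n ts t"])
      (auto simp: z box_fun_eq)
qed

lemma box_fun_append: "box_fun n (ts @ us) t = box_fun n ts t + box_fun n us t"
  by (simp add: box_fun_def)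

definition scale_boxes :: "complex \<Rightarrow> boxes \<Rightarrow> boxes" where
  "scale_boxes z ts = map (\<lambda>(c, a, b). (z * c, a, b)) ts"

lemma box_fun_scale: "box_fun n (scale_boxes z ts) t = z * box_fun n ts t"
  by (induction ts) (auto simp: box_fun_def scale_boxes_def algebra_simps)

lemma off_diagonal_append: "off_diagonal n ts \<Longrightarrow> off_diagonal n us \<Longrightarrow> off_diagonal n (ts @ us)"
  by (auto simp: off_diagonal_def)

lemma off_diagonal_scale: "off_diagonal n ts \<Longrightarrow> off_diagonal n (scale_boxes z ts)"
  by (auto simp: off_diagonal_def scale_boxes_def)

text \<open>Membership in the L2 closure of the step functions off the diagonals. The predicate is
  stable under linear combinations and dominated limits, and density follows by enlarging the class
  of functions that satisfy it.\<close>

definition appr :: "nat \<Rightarrow> ((nat \<Rightarrow> real) \<Rightarrow> complex) \<Rightarrow> bool" where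
  "appr n f \<longleftrightarrow> f \<in> L2 n \<and> (\<forall>e>0. \<exists>ts. off_diagonal n ts \<and> d2 n (\<lambda>t. f t - box_fun n ts t) < e)"

lemma appr_cong: "(\<And>t. t \<in> space (Rplus n) \<Longrightarrow> f t = g t) \<Longrightarrow> appr n f \<longleftrightarrow> appr n g"
proof -
  assume eq: "\<And>t. t \<in> space (Rplus n) \<Longrightarrow> f t = g t"
  have "d2 n (\<lambda>t. f t - box_fun n ts t) = d2 n (\<lambda>t. g t - box_fun n ts t)" for ts
    by (rule d2_cong) (simp add: eq)
  then show ?thesis by (simp add: appr_def L2_cong[OF eq])
qed

lemma appr_limit:
  assumes f: "f \<in> L2 n" and g: "\<And>k. appr n (g k)"
    and lim: "(\<lambda>k. d2 n (\<lambda>t. f t - g k t)) \<longlonglongrightarrow> 0"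
  shows "appr n f"
  unfolding appr_def
proof (intro conjI allI impI f)
  fix e :: real assume e: "0 < e"
  have "\<forall>\<^sub>F k in sequentially. d2 n (\<lambda>t. f t - g k t) < e / 4"
    using lim e by (intro order_tendstoD(2)[of _ 0]) auto
  then obtain k where k: "d2 n (\<lambda>t. f t - g k t) < e / 4"
    by (auto simp: eventually_sequentially)
  obtain ts where ts: "off_diagonal n ts" "d2 n (\<lambda>t. g k t - box_fun n ts t) < e / 4"
    using g[of k] e unfolding appr_def by (meson divide_pos_pos zero_less_numeral)
  have "d2 n (\<lambda>t. f t - box_fun n ts t) < e"
    using d2_diff_le[OF f _ box_fun_L2, of "g k" ts] g[of k] k ts(2) by (simp add: appr_def)
  with ts(1) show "\<exists>ts. off_diagonal n ts \<and> d2 n (\<lambda>t. f t - box_fun n ts t) < e" by blast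
qed

lemma appr_add: "appr n f \<Longrightarrow> appr n g \<Longrightarrow> appr n (\<lambda>t. f t + g t)"
  unfolding appr_def
proof (intro conjI allI impI)
  fix e :: real
  assume f: "f \<in> L2 n \<and> (\<forall>e>0. \<exists>ts. off_diagonal n ts \<and> d2 n (\<lambda>t. f t - box_fun n ts t) < e)"
    and g: "g \<in> L2 n \<and> (\<forall>e>0. \<exists>ts. off_diagonal n ts \<and> d2 n (\<lambda>t. g t - box_fun n ts t) < e)"
    and e: "0 < e"
  then obtain ts us where ts: "off_diagonal n ts" "d2 n (\<lambda>t. f t - box_fun n ts t) < e / 4"
    and us: "off_diagonal n us" "d2 n (\<lambda>t. g t - box_fun n us t) < e / 4"
    by (meson divide_pos_pos zero_less_numeral)
  have "d2 n (\<lambda>t. f t + g t - box_fun n (ts @ us) t) =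
      d2 n (\<lambda>t. (f t - box_fun n ts t) + (g t - box_fun n us t))"
    by (simp add: box_fun_append algebra_simps)
  also have "\<dots> \<le> 2 * d2 n (\<lambda>t. f t - box_fun n ts t) + 2 * d2 n (\<lambda>t. g t - box_fun n us t)"
    using f g by (intro d2_add_le L2_diff box_fun_L2) auto
  also have "\<dots> < e" using ts us by simp
  finally show "\<exists>ts. off_diagonal n ts \<and> d2 n (\<lambda>t. f t + g t - box_fun n ts t) < e"
    using off_diagonal_append[OF ts(1) us(1)] by blast
qed (auto intro: L2_add)

lemma appr_scale: assumes "appr n f" shows "appr n (\<lambda>t. a * f t)"
  unfolding appr_def
proof (intro conjI allI impI)
  show "(\<lambda>t. a * f t) \<in> L2 n" using assms by (auto simp: appr_def intro: L2_scale)
  fix e :: real assume e: "0 < e"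
  define e' where "e' = e / ((cmod a)\<^sup>2 + 1)"
  have e': "0 < e'" using e by (simp add: e'_def add_nonneg_pos)
  then obtain ts where ts: "off_diagonal n ts" "d2 n (\<lambda>t. f t - box_fun n ts t) < e'"
    using assms by (auto simp: appr_def)
  have "d2 n (\<lambda>t. a * f t - box_fun n (scale_boxes a ts) t) = (cmod a)\<^sup>2 * d2 n (\<lambda>t. f t - box_fun n ts t)"
    by (simp add: d2_def box_fun_scale right_diff_distrib[symmetric] norm_mult power_mult_distrib)
  also have "\<dots> \<le> (cmod a)\<^sup>2 * e'"
    using ts by (intro mult_left_mono) auto
  also have "\<dots> < ((cmod a)\<^sup>2 + 1) * e'" using e' by simp
  also have "\<dots> = e" by (simp add: e'_def add_nonneg_eq_0_iff)
  finally show "\<exists>ts. off_diagonal n ts \<and> d2 n (\<lambda>t. a * f t - box_fun n ts t) < e"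
    using off_diagonal_scale[OF ts(1)] by blast
qed

lemma appr_zero: "appr n (\<lambda>t. 0)"
  by (auto simp: appr_def L2_def d2_def box_fun_def off_diagonal_def intro!: exI[of _ "[]"])

lemma appr_sum: "(\<And>i. i \<in> I \<Longrightarrow> appr n (f i)) \<Longrightarrow> appr n (\<lambda>t. \<Sum>i\<in>I. f i t)"
  by (induction I rule: infinite_finite_induct) (auto simp: appr_zero appr_add)

lemma d2_dominated_limit:
  assumes f: "f \<in> borel_measurable (Rplus n)" and g: "\<And>k. g k \<in> borel_measurable (Rplus n)"
    and lim: "AE t in Rplus n. (\<lambda>k. g k t) \<longlonglongrightarrow> f t"
    and bound: "\<And>k t. t \<in> space (Rplus n) \<Longrightarrow> cmod (g k t) \<le> w t"
    and w: "integrable (Rplus n) (\<lambda>t. (w t)\<^sup>2)"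
  shows "(\<lambda>k. d2 n (\<lambda>t. f t - g k t)) \<longlonglongrightarrow> 0"
proof -
  have "(\<lambda>k. \<integral>t. (cmod (f t - g k t))\<^sup>2 \<partial>Rplus n) \<longlonglongrightarrow> (\<integral>t. 0 \<partial>Rplus n)"
  proof (rule integral_dominated_convergence)
    show "integrable (Rplus n) (\<lambda>t. 4 * (w t)\<^sup>2)" using w by simp
    show "AE t in Rplus n. (\<lambda>k. (cmod (f t - g k t))\<^sup>2) \<longlonglongrightarrow> 0"
      using lim
    proof eventually_elim
      case (elim t)
      have "(\<lambda>k. (cmod (f t - g k t))\<^sup>2) \<longlonglongrightarrow> (cmod (f t - f t))\<^sup>2"
        by (intro tendsto_intros elim)
      then show ?case by simp
    qed
    fix k
    show "AE t in Rplus n. norm ((cmod (f t - g k t))\<^sup>2) \<le> 4 * (w t)\<^sup>2"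
      using lim AE_space
    proof eventually_elim
      case (elim t)
      have "cmod (f t) \<le> w t"
        using bound[OF elim(2)] by (intro LIMSEQ_le_const2[OF tendsto_norm[OF elim(1)]]) auto
      then have "cmod (f t - g k t) \<le> 2 * w t"
        using bound[OF elim(2), of k] norm_triangle_ineq4[of "f t" "g k t"] by linarith
      then have "(cmod (f t - g k t))\<^sup>2 \<le> (2 * w t)\<^sup>2"
        by (intro power_mono) auto
      then show ?case by (simp add: power_mult_distrib)
    qed
  qed (use f g in auto)
  then show ?thesis by (simp add: d2_def)
qed

lemma appr_dominated_limit:
  assumes f: "f \<in> borel_measurable (Rplus n)" and g: "\<And>k. appr n (g k)"
    and lim: "AE t in Rplus n. (\<lambda>k. g k t) \<longlonglongrightarrow> f t"
    and bound: "\<And>k t. t \<in> space (Rplus n) \<Longrightarrow> cmod (g k t) \<le> w t"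
    and w: "integrable (Rplus n) (\<lambda>t. (w t)\<^sup>2)"
  shows "appr n f"
proof (rule appr_limit[OF _ g])
  have gm: "g k \<in> borel_measurable (Rplus n)" for k using g[of k] by (simp add: appr_def L2_def)
  show "(\<lambda>k. d2 n (\<lambda>t. f t - g k t)) \<longlonglongrightarrow> 0"
    by (rule d2_dominated_limit[OF f gm lim bound w])
  have "integrable (Rplus n) (\<lambda>t. (cmod (f t))\<^sup>2)"
  proof (rule integrable_dominated_convergence)
    show "integrable (Rplus n) (\<lambda>t. (w t)\<^sup>2)" by (rule w)
    show "AE t in Rplus n. (\<lambda>k. (cmod (g k t))\<^sup>2) \<longlonglongrightarrow> (cmod (f t))\<^sup>2"
      using lim by eventually_elim (intro tendsto_intros)
    show "AE t in Rplus n. norm ((cmod (g k t))\<^sup>2) \<le> (w t)\<^sup>2" for k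
      using AE_space by eventually_elim (auto intro!: power_mono bound)
  qed (use f gm in auto)
  then show "f \<in> L2 n" using f by (simp add: L2_def)
qed

lemma obox_Int: "obox n a b \<inter> obox n a' b' = obox n (\<lambda>i. max (a i) (a' i)) (\<lambda>i. min (b i) (b' i))"
  by (auto simp: obox_def PiE_def Pi_def)

lemma appr_off_diagonal_obox:
  assumes "\<And>i. i \<in> {1..n} \<Longrightarrow> 0 \<le> a i" "disjoint_family_on (\<lambda>i. {a i<..<b i}) {1..n}"
  shows "appr n (indicator (obox n a b))"
proof (cases "\<forall>i\<in>{1..n}. a i < b i")
  case True
  have "box_fun n [(1, a, b)] t = indicator (obox n a b) t" if "t \<in> space (Rplus n)" for t
    using that by (simp add: box_fun_eq)
  then have "d2 n (\<lambda>t. indicator (obox n a b) t - box_fun n [(1, a, b)] t) = d2 n (\<lambda>t. 0)"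
    by (intro d2_cong) auto
  moreover have "off_diagonal n [(1, a, b)]"
    using assms True by (auto simp: off_diagonal_def)
  moreover have "indicator (obox n a b) \<in> L2 n"
    by (intro L2_indicator obox_sets emeasure_obox_finite)
  ultimately show ?thesis
    unfolding appr_def by (auto simp: d2_def intro!: exI[of _ "[(1, a, b)]"])
next
  case False
  then obtain i where "i \<in> {1..n}" "b i \<le> a i" by force
  then have "obox n a b = {}" by (force simp: obox_def PiE_def Pi_def)
  then have "(indicator (obox n a b) :: _ \<Rightarrow> complex) = (\<lambda>t. 0)" by auto
  then show ?thesis by (simp only: appr_zero)
qed

text \<open>The box is cut by the grid of mesh \<open>1 / h\<close>; the cells with pairwise distinct indices are
  off the diagonals and exhaust almost every point of the box as \<open>h\<close> grows.\<close>

lemma appr_obox: "appr n (indicator (obox n a b))"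
proof -
  define lo where "lo h v i = max (a i) (real (v ! (i - 1)) / real h)" for h :: nat and v i
  define up where "up h v i = min (b i) ((real (v ! (i - 1)) + 1) / real h)" for h :: nat and v i
  \<comment> \<open>With h * h indices on each axis the cells of mesh 1 / h reach up to h;
    \<open>distinct\<close> removes the cells with a repeated index.\<close>
  define V where "V h = {v \<in> words (h * h) n. distinct v}" for h :: nat
  define g where "g k t = (\<Sum>v\<in>V (Suc k). indicator (obox n (lo (Suc k) v) (up (Suc k) v)) t :: complex)" for k t
  define ix where "ix h t = map (\<lambda>i. nat \<lfloor>real h * t i\<rfloor>) [1..<Suc n]" for h :: nat and t :: "nat \<Rightarrow> real"
  have finV: "finite (V h)" for h by (simp add: V_def)
  have ix_nth: "ix h t ! (i - 1) = nat \<lfloor>real h * t i\<rfloor>" if "i \<in> {1..n}" for h t i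
    using that by (auto simp: ix_def simp del: upt_Suc)
  have cell_ix: "v = ix h t" if h: "0 < h" and v: "v \<in> V h" and t: "t \<in> obox n (lo h v) (up h v)" for h v t
  proof (rule nth_equalityI)
    show "length v = length (ix h t)" using v by (simp add: V_def words_def ix_def)
    fix l assume "l < length v"
    then have l: "Suc l \<in> {1..n}" using v by (auto simp: V_def words_def)
    then have "t (Suc l) \<in> {0..} \<inter> {lo h v (Suc l)<..<up h v (Suc l)}"
      using t unfolding obox_def by (rule PiE_mem[rotated])
    then have "real (v ! l) < real h * t (Suc l)" "real h * t (Suc l) < real (v ! l) + 1"
      using h by (auto simp: lo_def up_def field_simps)
    then have "\<lfloor>real h * t (Suc l)\<rfloor> = int (v ! l)" by linarith
    then show "v ! l = ix h t ! l" using ix_nth[OF l] by simp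
  qed
  show ?thesis
  proof (rule appr_dominated_limit[where g = g and w = "indicat_real (obox n a b)"])
    show "appr n (g k)" for k
      unfolding g_def
    proof (intro appr_sum appr_off_diagonal_obox)
      fix v i assume "v \<in> V (Suc k)"
      show "0 \<le> lo (Suc k) v i" by (simp add: lo_def le_max_iff_disj)
    next
      fix v assume v: "v \<in> V (Suc k)"
      show "disjoint_family_on (\<lambda>i. {lo (Suc k) v i<..<up (Suc k) v i}) {1..n}"
        unfolding disjoint_family_on_def
      proof (intro ballI impI)
        fix i j assume ij: "i \<in> {1..n}" "j \<in> {1..n}" "i \<noteq> j"
        then have "v ! (i - 1) \<noteq> v ! (j - 1)"
          using v by (auto simp: V_def words_def nth_eq_iff_index_eq)
        then consider "v ! (i - 1) + 1 \<le> v ! (j - 1)" | "v ! (j - 1) + 1 \<le> v ! (i - 1)" by linarith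
        then have "(real (v ! (i - 1)) + 1) / real (Suc k) \<le> real (v ! (j - 1)) / real (Suc k) \<or>
            (real (v ! (j - 1)) + 1) / real (Suc k) \<le> real (v ! (i - 1)) / real (Suc k)"
          by cases (auto intro!: divide_right_mono simp del: of_nat_Suc)
        then show "{lo (Suc k) v i<..<up (Suc k) v i} \<inter> {lo (Suc k) v j<..<up (Suc k) v j} = {}"
        proof (rule disjE)
          assume le: "(real (v ! (i - 1)) + 1) / real (Suc k) \<le> real (v ! (j - 1)) / real (Suc k)"
          show ?thesis
          proof (rule equals0I)
            fix x assume "x \<in> {lo (Suc k) v i<..<up (Suc k) v i} \<inter> {lo (Suc k) v j<..<up (Suc k) v j}"
            then have "x < (real (v ! (i - 1)) + 1) / real (Suc k)" "real (v ! (j - 1)) / real (Suc k) < x"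
              unfolding lo_def up_def by (simp_all del: of_nat_Suc)
            then show False using le by linarith
          qed
        next
          assume le: "(real (v ! (j - 1)) + 1) / real (Suc k) \<le> real (v ! (i - 1)) / real (Suc k)"
          show ?thesis
          proof (rule equals0I)
            fix x assume "x \<in> {lo (Suc k) v i<..<up (Suc k) v i} \<inter> {lo (Suc k) v j<..<up (Suc k) v j}"
            then have "x < (real (v ! (j - 1)) + 1) / real (Suc k)" "real (v ! (i - 1)) / real (Suc k) < x"
              unfolding lo_def up_def by (simp_all del: of_nat_Suc)
            then show False using le by linarith
          qed
        qed
      qed
    qed
    \<comment> \<open>A generic point has irrational coordinates, so it lies on no cell boundary,
      and pairwise different ones, so a fine mesh gives them different indices.\<close>
    show "AE t in Rplus n. (\<lambda>k. g k t) \<longlonglongrightarrow> indicator (obox n a b) t"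
      using AE_coord_notin[OF countable_rat] AE_coord_distinct AE_space
    proof eventually_elim
      case (elim t)
      show ?case
      proof (cases "t \<in> obox n a b")
        case False
        have "g k t = 0" for k
          unfolding g_def
        proof (intro sum.neutral ballI)
          fix v
          have "t \<notin> obox n (lo (Suc k) v) (up (Suc k) v)"
            using False by (auto simp: obox_def PiE_def Pi_def lo_def up_def)
          then show "indicator (obox n (lo (Suc k) v) (up (Suc k) v)) t = (0::complex)" by simp
        qed
        then show ?thesis using False by simp
      next
        case True
        \<comment> \<open>\<open>B\<close> bounds the coordinates of \<open>t\<close> and
          \<open>\<delta>\<close> separates them; for h above \<open>B\<close> and 1 / \<delta> some
          cell of \<open>V h\<close> contains \<open>t\<close>. The inserted 0 and 1 keep the
          maximum and the minimum meaningful for n = 0.\<close>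
        define B where "B = Max (insert 0 (t ` {1..n}))"
        define \<delta> where "\<delta> = Min (insert 1 ((\<lambda>(i, j). if i = j then 1 else \<bar>t i - t j\<bar>) ` ({1..n} \<times> {1..n})))"
        have B: "t i \<le> B" if "i \<in> {1..n}" for i
          unfolding B_def using that by (intro Max_ge) auto
        have \<delta>: "0 < \<delta>"
          unfolding \<delta>_def using elim(2) by (subst Min_gr_iff) auto
        have \<delta>_le: "\<delta> \<le> \<bar>t i - t j\<bar>" if "i \<in> {1..n}" "j \<in> {1..n}" "i \<noteq> j" for i j
          unfolding \<delta>_def using that by (intro Min_le) (auto intro!: rev_image_eqI[of "(i, j)"])
        have "\<forall>\<^sub>F k in sequentially. B < real (Suc k)"
          using filterlim_compose[OF filterlim_real_sequentially filterlim_Suc]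
          by (simp add: filterlim_at_top_dense)
        moreover have "\<forall>\<^sub>F k in sequentially. 1 / \<delta> < real (Suc k)"
          using filterlim_compose[OF filterlim_real_sequentially filterlim_Suc]
          by (simp add: filterlim_at_top_dense)
        ultimately have "\<forall>\<^sub>F k in sequentially. g k t = 1"
        proof eventually_elim
          case (elim k)
          let ?h = "Suc k"
          have tnn: "0 \<le> t i" if "i \<in> {1..n}" for i
            using \<open>t \<in> space (Rplus n)\<close> that by (auto simp: space_Rplus)
          have fl: "real (nat \<lfloor>real ?h * t i\<rfloor>) < real ?h * t i" "real ?h * t i < real (nat \<lfloor>real ?h * t i\<rfloor>) + 1"
            if i: "i \<in> {1..n}" for i
          proof -
            have "real ?h * t i \<notin> \<int>"
            proof
              assume "real ?h * t i \<in> \<int>"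
              then have "real ?h * t i / real ?h \<in> \<rat>"
                by (intro Rats_divide) (auto simp: Ints_subset_Rats[THEN subsetD])
              then show False using \<open>\<forall>i\<in>{1..n}. t i \<notin> \<rat>\<close> i by simp
            qed
            then have "of_int \<lfloor>real ?h * t i\<rfloor> \<noteq> real ?h * t i" by (metis Ints_of_int)
            moreover have "0 \<le> \<lfloor>real ?h * t i\<rfloor>" using tnn[OF i] by simp
            ultimately show "real (nat \<lfloor>real ?h * t i\<rfloor>) < real ?h * t i" "real ?h * t i < real (nat \<lfloor>real ?h * t i\<rfloor>) + 1"
              by linarith+
          qed
          have "ix ?h t \<in> V ?h"
          proof -
            have "nat \<lfloor>real ?h * t i\<rfloor> < ?h * ?h" if i: "i \<in> {1..n}" for i
            proof -
              have "real (nat \<lfloor>real ?h * t i\<rfloor>) < real ?h * real ?h"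
                using fl(1)[OF i] B[OF i] elim(1) mult_left_mono[of "t i" "real ?h" "real ?h"] by linarith
              then show ?thesis by (metis of_nat_less_iff of_nat_mult)
            qed
            then have "ix ?h t \<in> words (?h * ?h) n"
              by (auto simp: words_def ix_def simp del: upt_Suc)
            moreover have "distinct (ix ?h t)"
              unfolding ix_def distinct_map
            proof (intro conjI distinct_upt inj_onI)
              fix i j assume ij: "i \<in> set [1..<Suc n]" "j \<in> set [1..<Suc n]"
                and eq: "nat \<lfloor>real ?h * t i\<rfloor> = nat \<lfloor>real ?h * t j\<rfloor>"
              then have ij': "i \<in> {1..n}" "j \<in> {1..n}" by auto
              show "i = j"
              proof (rule ccontr)
                assume "i \<noteq> j"
                have "\<bar>real ?h * t i - real ?h * t j\<bar> < 1"
                  using fl[OF ij'(1)] fl[OF ij'(2)] eq by linarith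
                then have "real ?h * \<bar>t i - t j\<bar> < 1"
                  by (simp add: right_diff_distrib[symmetric] abs_mult del: of_nat_Suc)
                moreover have "real ?h * \<delta> \<le> real ?h * \<bar>t i - t j\<bar>"
                  using \<delta>_le[OF ij' \<open>i \<noteq> j\<close>] by (intro mult_left_mono) auto
                moreover have "1 < real ?h * \<delta>"
                  using elim(2) \<delta> by (simp add: field_simps del: of_nat_Suc)
                ultimately show False by linarith
              qed
            qed
            ultimately show ?thesis by (simp add: V_def)
          qed
          moreover have "t \<in> obox n (lo ?h (ix ?h t)) (up ?h (ix ?h t))"
          proof -
            have "t i \<in> {0..} \<inter> {lo ?h (ix ?h t) i<..<up ?h (ix ?h t) i}" if i: "i \<in> {1..n}" for i
            proof -
              have "real (nat \<lfloor>real ?h * t i\<rfloor>) / real ?h < t i" "t i < (real (nat \<lfloor>real ?h * t i\<rfloor>) + 1) / real ?h"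
                using fl[OF i] by (simp_all add: field_simps del: of_nat_Suc)
              moreover have "a i < t i" "t i < b i"
                using True i by (auto simp: obox_def)
              ultimately show ?thesis
                using tnn[OF i] unfolding lo_def up_def ix_nth[OF i] by (simp del: of_nat_Suc)
            qed
            then show ?thesis
              using \<open>t \<in> space (Rplus n)\<close> by (auto simp: obox_def space_Rplus PiE_def)
          qed
          ultimately have "g k t = (\<Sum>v\<in>{ix ?h t}. indicator (obox n (lo ?h v) (up ?h v)) t)"
            unfolding g_def
            by (intro sum.mono_neutral_right finV) (auto simp: indicator_def dest: cell_ix[rotated -1])
          then show "g k t = 1"
            using \<open>t \<in> obox n (lo ?h (ix ?h t)) (up ?h (ix ?h t))\<close> by simp
        qed
        then show ?thesis
          using True by (simp add: tendsto_eventually)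
      qed
    qed
    show "cmod (g k t) \<le> indicat_real (obox n a b) t" for k t
    proof (cases "\<exists>v\<in>V (Suc k). t \<in> obox n (lo (Suc k) v) (up (Suc k) v)")
      case True
      then obtain v where v: "v \<in> V (Suc k)" "t \<in> obox n (lo (Suc k) v) (up (Suc k) v)" by blast
      have "g k t = (\<Sum>v\<in>{v}. indicator (obox n (lo (Suc k) v) (up (Suc k) v)) t)"
        unfolding g_def using v cell_ix[of "Suc k"]
        by (intro sum.mono_neutral_right finV) (auto simp: indicator_def)
      moreover have "t \<in> obox n a b"
        using v by (auto simp: obox_def PiE_def Pi_def lo_def up_def)
      ultimately show ?thesis using v by simp
    next
      case False
      then have "g k t = 0" unfolding g_def by (intro sum.neutral) auto
      then show ?thesis by simp
    qed
    have "(\<lambda>t. (indicat_real (obox n a b) t)\<^sup>2) = indicat_real (obox n a b)"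
      by (auto simp: indicator_def)
    then show "integrable (Rplus n) (\<lambda>t. (indicat_real (obox n a b) t)\<^sup>2)"
      using emeasure_obox_finite by simp
  qed simp
qed

section \<open>Boxes generate the measurable sets, and density follows\<close>

lemma sets_halfline: "sets halfline = sigma_sets {0..} (range (\<lambda>(a, b). {0..} \<inter> {a<..<b}))"
proof -
  have borel: "sets (borel :: real measure) = sigma_sets UNIV (range (\<lambda>(a, b). box a b))"
    by (subst borel_eq_box) (rule sets_measure_of, simp)
  have "sets halfline = (\<inter>) {0..} ` sigma_sets UNIV (range (\<lambda>(a, b). box a b :: real set))"
    by (simp only: sets_restrict_space sets_lborel borel)
  also have "\<dots> = sigma_sets {0..} ((\<inter>) {0..} ` range (\<lambda>(a, b). box a b))"
  proof (rule sigma_sets_Int)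
    show "{0::real..} \<in> sigma_sets UNIV (range (\<lambda>(a, b). box a b))"
      unfolding borel[symmetric] by simp
  qed simp
  also have "(\<inter>) {0..} ` range (\<lambda>(a, b). box a b) = range (\<lambda>(a, b). {0::real..} \<inter> {a<..<b})"
    by (auto simp: image_def box_real)
  finally show ?thesis .
qed

text \<open>Boxes are stable under intersection, so a generator consisting of boxes allows induction
  over complements and disjoint unions.\<close>

lemma sets_Rplus: "sets (Rplus n) = sigma_sets (space (Rplus n)) {obox n a b | a b. True}"
proof -
  let ?E = "range (\<lambda>(a, b). {0::real..} \<inter> {a<..<b})"
  let ?P = "{{f \<in> \<Pi>\<^sub>E i\<in>{1..n}. {0::real..}. \<forall>i\<in>j. f i \<in> A i} | A j. j \<in> {{1..n}} \<and> A \<in> Pi j (\<lambda>_::nat. ?E)}"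
  have "sets (Rplus n) = sets (\<Pi>\<^sub>M i\<in>{1..n}. sigma {0..} ?E)"
    unfolding Rplus_def
    by (intro sets_PiM_cong refl) (subst sets_measure_of, auto simp: sets_halfline)
  also have "\<dots> = sets (sigma (\<Pi>\<^sub>E i\<in>{1..n}. {0..}) ?P)"
  proof (rule sets_PiM_sigma)
    \<comment> \<open>The left end -1 makes the open intervals contain the point 0.\<close>
    show "\<exists>S\<subseteq>?E. countable S \<and> {0..} = \<Union>S"
    proof (intro exI[of _ "range (\<lambda>m::nat. {0..} \<inter> {-1<..<real m})"] conjI)
      show "range (\<lambda>m::nat. {0..} \<inter> {-1<..<real m}) \<subseteq> ?E" by auto
      show "{0..} = (\<Union>m::nat. {0..} \<inter> {-1<..<real m})"
        using reals_Archimedean2 by (auto intro: less_le_trans[of "-1" 0])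
    qed auto
  qed auto
  also have "\<dots> = sigma_sets (space (Rplus n)) ?P"
    unfolding space_Rplus by (rule sets_measure_of) auto
  also have "?P = {obox n a b | a b. True}"
  proof (intro equalityI subsetI)
    fix Z assume "Z \<in> ?P"
    then obtain A where A: "Z = {f \<in> \<Pi>\<^sub>E i\<in>{1..n}. {0..}. \<forall>i\<in>{1..n}. f i \<in> A i}" "A \<in> Pi {1..n} (\<lambda>_. ?E)"
      by auto
    then have "\<forall>i\<in>{1..n}. \<exists>p. A i = {0..} \<inter> {fst p<..<snd p}" by (fastforce simp: Pi_def)
    then obtain p where p: "\<And>i. i \<in> {1..n} \<Longrightarrow> A i = {0..} \<inter> {fst (p i)<..<snd (p i)}" by metis
    have "Z = obox n (\<lambda>i. fst (p i)) (\<lambda>i. snd (p i))"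
      unfolding A obox_def using p by (auto simp: PiE_def Pi_def)
    then show "Z \<in> {obox n a b | a b. True}" by blast
  next
    fix Z assume "Z \<in> {obox n a b | a b. True}"
    then obtain a b where Z: "Z = obox n a b" by blast
    have "Z = {f \<in> \<Pi>\<^sub>E i\<in>{1..n}. {0..}. \<forall>i\<in>{1..n}. f i \<in> {0..} \<inter> {a i<..<b i}}"
      unfolding Z obox_def by (auto simp: PiE_def Pi_def)
    then show "Z \<in> ?P"
      by (intro CollectI exI[of _ "\<lambda>i. {0..} \<inter> {a i<..<b i}"] exI[of _ "{1..n}"]) auto
  qed
  finally show ?thesis .
qed

text \<open>A box of finite volume; the left end -1 admits points with zero coordinates, so that the
  cubes exhaust the space.\<close>

definition cube :: "nat \<Rightarrow> nat \<Rightarrow> (nat \<Rightarrow> real) set" where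
  "cube n T = obox n (\<lambda>_. - 1) (\<lambda>_. real T)"

lemma cube_sets [measurable]: "cube n T \<in> sets (Rplus n)"
  by (simp add: cube_def)

lemma eventually_in_cube:
  assumes "t \<in> space (Rplus n)" shows "\<forall>\<^sub>F T in sequentially. t \<in> cube n T"
proof -
  define B where "B = Max (insert 0 (t ` {1..n}))"
  have B: "t i \<le> B" if "i \<in> {1..n}" for i
    unfolding B_def using that by (intro Max_ge) auto
  have "\<forall>\<^sub>F T in sequentially. B < real T"
    using filterlim_real_sequentially by (simp add: filterlim_at_top_dense)
  then show ?thesis
  proof eventually_elim
    case (elim T)
    have "t i \<in> {0..} \<inter> {- 1<..<real T}" if "i \<in> {1..n}" for i
      using B[OF that] elim assms that by (auto simp: space_Rplus PiE_def Pi_def intro: less_le_trans[of "-1" 0])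
    then show ?case
      using assms by (auto simp: cube_def obox_def space_Rplus PiE_def)
  qed
qed

lemma integrable_indicator_cube: "integrable (Rplus n) (\<lambda>t. (indicat_real (cube n T) t)\<^sup>2)"
proof -
  have "(\<lambda>t. (indicat_real (cube n T) t)\<^sup>2) = indicat_real (cube n T)"
    by (auto simp: indicator_def)
  then show ?thesis using emeasure_obox_finite by (simp add: cube_def)
qed

text \<open>A Dynkin class argument starting from the boxes. Cutting with a cube keeps all sets,
  complements included, of finite measure and supplies the dominating function for countable
  unions.\<close>

lemma appr_indicator_cube:
  assumes "Z \<in> sets (Rplus n)"
  shows "appr n (indicator (Z \<inter> cube n T))"
proof -
  let ?G = "{obox n a b | a b. True}"
  have "Int_stable ?G"
    unfolding Int_stable_def using obox_Int by blast
  moreover have "?G \<subseteq> Pow (space (Rplus n))"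
    using sets.sets_into_space[OF obox_sets] by blast
  moreover have "Z \<in> sigma_sets (space (Rplus n)) ?G"
    using assms by (simp add: sets_Rplus)
  ultimately show ?thesis
  proof (induction rule: sigma_sets_induct_disjoint)
    case (basic Z)
    then show ?case by (auto simp: cube_def obox_Int appr_obox)
  next
    case empty
    have "(indicator ({} \<inter> cube n T) :: _ \<Rightarrow> complex) = (\<lambda>t. 0)" by auto
    then show ?case by (simp only: appr_zero)
  next
    case (compl Z)
    have "appr n (\<lambda>t. indicator (cube n T) t + (-1) * indicator (Z \<inter> cube n T) t)"
      unfolding cube_def by (intro appr_add appr_scale appr_obox compl(2)[unfolded cube_def])
    then show ?case
      by (subst appr_cong[where g = "\<lambda>t. indicator (cube n T) t + (-1) * indicator (Z \<inter> cube n T) t"])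
        (auto simp: indicator_def)
  next
    case (union Z)
    have meas: "Z i \<in> sets (Rplus n)" for i
      using union(2) by (auto simp: sets_Rplus)
    let ?g = "\<lambda>k t. \<Sum>i<k. indicator (Z i \<inter> cube n T) t :: complex"
    have g_eq: "?g k t = indicator ((\<Union>i<k. Z i) \<inter> cube n T) t" for k t
    proof (cases "\<exists>i<k. t \<in> Z i \<inter> cube n T")
      case True
      then obtain i where i: "i < k" "t \<in> Z i \<inter> cube n T" by blast
      have "t \<notin> Z j" if "j \<noteq> i" for j
        using union(1) i that by (auto simp: disjoint_family_on_def)
      then have "?g k t = (\<Sum>i\<in>{i}. indicator (Z i \<inter> cube n T) t)"
        using i by (intro sum.mono_neutral_right) auto
      also have "\<dots> = 1" using i by simp
      also have "1 = indicator ((\<Union>i<k. Z i) \<inter> cube n T) t"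
        using i by (auto simp: indicator_def)
      finally show ?thesis .
    next
      case False
      then have "?g k t = 0" by (intro sum.neutral) auto
      also have "0 = indicator ((\<Union>i<k. Z i) \<inter> cube n T) t"
        using False by (auto simp: indicator_def)
      finally show ?thesis .
    qed
    show ?case
    proof (rule appr_dominated_limit[where g = ?g and w = "indicat_real (cube n T)"])
      show "appr n (?g k)" for k by (intro appr_sum union)
      show "AE t in Rplus n. (\<lambda>k. ?g k t) \<longlonglongrightarrow> indicator (\<Union> (range Z) \<inter> cube n T) t"
      proof (rule AE_I2)
        fix t
        show "(\<lambda>k. ?g k t) \<longlonglongrightarrow> indicator (\<Union> (range Z) \<inter> cube n T) t"
        proof (cases "\<exists>i. t \<in> Z i")
          case True
          then obtain i where "t \<in> Z i" by blast
          then have "?g k t = indicator (\<Union> (range Z) \<inter> cube n T) t" if "Suc i \<le> k" for k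
            unfolding g_eq using that by (auto simp: indicator_def)
          then show ?thesis
            by (intro tendsto_eventually eventually_sequentiallyI[of "Suc i"])
        qed (auto simp: g_eq)
      qed
      show "cmod (?g k t) \<le> indicat_real (cube n T) t" for k t
        unfolding g_eq by (auto simp: indicator_def)
    qed (use meas integrable_indicator_cube in auto)
  qed
qed

text \<open>Simple functions converge to \<open>f\<close> under the bound 2 |f|. They are multiplied
  by the indicator of a growing cube, which gives their level sets finite measure and leaves the
  pointwise limit as it is.\<close>

lemma appr_L2:
  assumes f: "f \<in> L2 n" shows "appr n f"
proof -
  have fm: "f \<in> borel_measurable (Rplus n)" and fi: "integrable (Rplus n) (\<lambda>t. (cmod (f t))\<^sup>2)"
    using f by (auto simp: L2_def)
  obtain F where F: "\<And>i. simple_function (Rplus n) (F i)"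
    "\<And>t. t \<in> space (Rplus n) \<Longrightarrow> (\<lambda>i. F i t) \<longlonglongrightarrow> f t"
    "\<And>i t. t \<in> space (Rplus n) \<Longrightarrow> dist (F i t) 0 \<le> 2 * dist (f t) 0"
    using borel_measurable_implies_sequence_metric[OF fm, of 0] by blast
  define g where "g k t = (\<Sum>y\<in>F k ` space (Rplus n). y * indicator ((F k -` {y} \<inter> space (Rplus n)) \<inter> cube n k) t)" for k t
  have g_eq: "g k t = F k t * indicator (cube n k) t" if t: "t \<in> space (Rplus n)" for k t
  proof -
    have "g k t = (\<Sum>y\<in>{F k t}. y * indicator ((F k -` {y} \<inter> space (Rplus n)) \<inter> cube n k) t)"
      unfolding g_def using t F(1)[of k]
      by (intro sum.mono_neutral_right) (auto simp: simple_function_def)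
    then show ?thesis using t by (auto simp: indicator_def)
  qed
  show ?thesis
  proof (rule appr_dominated_limit[where g = g and w = "\<lambda>t. 2 * cmod (f t)"])
    show "appr n (g k)" for k
      unfolding g_def
      by (intro appr_sum appr_scale appr_indicator_cube) (use F(1)[of k] in \<open>auto simp: simple_function_def\<close>)
    show "AE t in Rplus n. (\<lambda>k. g k t) \<longlonglongrightarrow> f t"
    proof (rule AE_I2)
      fix t assume t: "t \<in> space (Rplus n)"
      have "\<forall>\<^sub>F k in sequentially. F k t = g k t"
        using eventually_in_cube[OF t] by eventually_elim (simp add: g_eq[OF t])
      then show "(\<lambda>k. g k t) \<longlonglongrightarrow> f t"
        by (rule Lim_transform_eventually[OF F(2)[OF t]])
    qed
    show "cmod (g k t) \<le> 2 * cmod (f t)" if "t \<in> space (Rplus n)" for k t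
      using F(3)[OF that, of k] by (auto simp: g_eq[OF that] indicator_def)
    show "integrable (Rplus n) (\<lambda>t. (2 * cmod (f t))\<^sup>2)"
      using fi by (simp add: power_mult_distrib)
  qed (rule fm)
qed

lemma ex_box_sequence:
  assumes "f \<in> L2 n"
  shows "\<exists>ts. (\<forall>k. off_diagonal n (ts k)) \<and> (\<lambda>k. d2 n (\<lambda>t. f t - box_fun n (ts k) t)) \<longlonglongrightarrow> 0"
proof -
  have "\<exists>ts. off_diagonal n ts \<and> d2 n (\<lambda>t. f t - box_fun n ts t) < 1 / real (Suc k)" for k
    using appr_L2[OF assms] by (simp add: appr_def)
  then obtain ts where ts: "\<And>k. off_diagonal n (ts k)"
    "\<And>k. d2 n (\<lambda>t. f t - box_fun n (ts k) t) < 1 / real (Suc k)" by metis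
  have "(\<lambda>k. d2 n (\<lambda>t. f t - box_fun n (ts k) t)) \<longlonglongrightarrow> 0"
  proof (rule Lim_null_comparison)
    show "(\<lambda>k. 1 / real (Suc k)) \<longlonglongrightarrow> 0"
      using LIMSEQ_inverse_real_of_nat by (simp add: inverse_eq_divide)
    show "\<forall>\<^sub>F k in sequentially. norm (d2 n (\<lambda>t. f t - box_fun n (ts k) t)) \<le> 1 / real (Suc k)"
      using ts(2) d2_nonneg by (auto intro!: always_eventually less_imp_le simp del: of_nat_Suc)
  qed
  then show ?thesis using ts(1) by blast
qed

section \<open>Reversal of the time variables\<close>

definition rev_pt :: "nat \<Rightarrow> (nat \<Rightarrow> real) \<Rightarrow> nat \<Rightarrow> real" where
  "rev_pt n t = (\<lambda>i\<in>{1..n}. t (n + 1 - i))"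

lemma bij_betw_rev: "bij_betw (\<lambda>i. n + 1 - i) {1..n} {1..n::nat}"
  by (rule bij_betw_byWitness[where f' = "\<lambda>i. n + 1 - i"]) auto

lemma measurable_rev_pt: "rev_pt n \<in> measurable (Rplus n) (Rplus n)"
  unfolding Rplus_def rev_pt_def
  by (rule measurable_restrict) (auto intro!: measurable_component_singleton)

text \<open>The product measure is determined on rectangles, where reversal merely permutes the
  factors.\<close>

lemma distr_rev_pt: "distr (Rplus n) (Rplus n) (rev_pt n) = Rplus n"
proof -
  have "distr (Rplus n) (Rplus n) (rev_pt n) = Pi\<^sub>M {1..n} (\<lambda>_. halfline)"
  proof (rule Rp.PiM_eqI)
    show "sets (distr (Rplus n) (Rplus n) (rev_pt n)) = sets (Pi\<^sub>M {1..n} (\<lambda>_. halfline))"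
      by (simp add: Rplus_def)
    fix Z :: "nat \<Rightarrow> real set" assume Z: "\<And>i. i \<in> {1..n} \<Longrightarrow> Z i \<in> sets halfline"
    have Zs: "Pi\<^sub>E {1..n} Z \<in> sets (Rplus n)"
      unfolding Rplus_def by (rule sets_PiM_I_finite) (use Z in auto)
    have sub: "Z i \<subseteq> {0..}" if "i \<in> {1..n}" for i
      using sets.sets_into_space[OF Z[OF that]] by (simp add: space_restrict_space)
    have pre: "rev_pt n -` Pi\<^sub>E {1..n} Z \<inter> space (Rplus n) = Pi\<^sub>E {1..n} (\<lambda>i. Z (n + 1 - i))"
    proof (intro equalityI subsetI)
      fix t assume t: "t \<in> rev_pt n -` Pi\<^sub>E {1..n} Z \<inter> space (Rplus n)"
      have "t i \<in> Z (n + 1 - i)" if "i \<in> {1..n}" for i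
      proof -
        have "n + 1 - i \<in> {1..n}" "n + 1 - (n + 1 - i) = i" using that by auto
        moreover have "rev_pt n t (n + 1 - i) \<in> Z (n + 1 - i)"
          using t \<open>n + 1 - i \<in> {1..n}\<close> by (auto simp: PiE_def Pi_def)
        ultimately show ?thesis by (simp add: rev_pt_def)
      qed
      then show "t \<in> Pi\<^sub>E {1..n} (\<lambda>i. Z (n + 1 - i))"
        using t by (auto simp: space_Rplus PiE_def)
    next
      fix t assume t: "t \<in> Pi\<^sub>E {1..n} (\<lambda>i. Z (n + 1 - i))"
      have "t (n + 1 - i) \<in> Z i" if "i \<in> {1..n}" for i
      proof -
        have "n + 1 - i \<in> {1..n}" "n + 1 - (n + 1 - i) = i" using that by auto
        then show ?thesis using t by (metis PiE_mem)
      qed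
      moreover have "t i \<in> {0..}" if "i \<in> {1..n}" for i
      proof -
        have "n + 1 - i \<in> {1..n}" using that by auto
        then show ?thesis using sub t that by (metis PiE_mem subsetD)
      qed
      ultimately show "t \<in> rev_pt n -` Pi\<^sub>E {1..n} Z \<inter> space (Rplus n)"
        using t by (auto simp: rev_pt_def space_Rplus PiE_def Pi_def)
    qed
    have "emeasure (distr (Rplus n) (Rplus n) (rev_pt n)) (Pi\<^sub>E {1..n} Z) =
        emeasure (Rplus n) (Pi\<^sub>E {1..n} (\<lambda>i. Z (n + 1 - i)))"
      by (subst emeasure_distr[OF measurable_rev_pt Zs]) (simp only: pre)
    also have "\<dots> = (\<Prod>i\<in>{1..n}. emeasure halfline (Z (n + 1 - i)))"
      unfolding Rplus_def
    proof (rule Rp.emeasure_PiM)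
      fix i assume "i \<in> {1..n}"
      then show "Z (n + 1 - i) \<in> sets halfline" by (intro Z) auto
    qed simp
    also have "\<dots> = (\<Prod>i\<in>{1..n}. emeasure halfline (Z i))"
      by (rule prod.reindex_bij_betw[OF bij_betw_rev])
    finally show "emeasure (distr (Rplus n) (Rplus n) (rev_pt n)) (Pi\<^sub>E {1..n} Z) =
        (\<Prod>i\<in>{1..n}. emeasure halfline (Z i))" .
  qed simp
  then show ?thesis by (simp add: Rplus_def)
qed

text \<open>The mirror image of a list of boxes: it represents the mirrored step function, by
  \<open>box_fun_rev\<close>, and its integral is the adjoint, by
  \<open>adj_box_integral\<close>.\<close>

definition rev_boxes :: "nat \<Rightarrow> boxes \<Rightarrow> boxes" where
  "rev_boxes n ts = map (\<lambda>(c, a, b). (cnj c, \<lambda>i. a (n + 1 - i), \<lambda>i. b (n + 1 - i))) ts"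

lemma off_diagonal_rev: "off_diagonal n ts \<Longrightarrow> off_diagonal n (rev_boxes n ts)"
proof -
  assume ts: "off_diagonal n ts"
  have in_range: "n + 1 - i \<in> {1..n}" if "i \<in> {1..n}" for i
    using that by auto
  have ne: "n + 1 - i \<noteq> n + 1 - j" if "i \<in> {1..n}" "j \<in> {1..n}" "i \<noteq> j" for i j
    using that by auto
  show ?thesis
    unfolding off_diagonal_def
  proof (clarify, intro conjI ballI)
    fix c a b assume "(c, a, b) \<in> set (rev_boxes n ts)"
    then obtain c' a' b' where t: "(c', a', b') \<in> set ts"
      "a = (\<lambda>i. a' (n + 1 - i))" "b = (\<lambda>i. b' (n + 1 - i))"
      by (auto simp: rev_boxes_def)
    have a': "0 \<le> a' i" "a' i < b' i" if "i \<in> {1..n}" for i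
      using ts t(1) that unfolding off_diagonal_def by blast+
    have dis: "disjoint_family_on (\<lambda>i. {a' i<..<b' i}) {1..n}"
      using ts t(1) unfolding off_diagonal_def by blast
    show "0 \<le> a i" "a i < b i" if "i \<in> {1..n}" for i
      using a'[OF in_range[OF that]] by (auto simp: t)
    show "disjoint_family_on (\<lambda>i. {a i<..<b i}) {1..n}"
      unfolding t(2,3) disjoint_family_on_def
      using dis in_range ne unfolding disjoint_family_on_def by blast
  qed
qed

lemma box_fun_rev: "box_fun n (rev_boxes n ts) t = cnj (box_fun n ts (rev_pt n t))"
proof (induction ts)
  case Nil
  then show ?case by (simp add: box_fun_def rev_boxes_def)
next
  case (Cons z ts)
  obtain c a b where z: "z = (c, a, b)" by (cases z)
  have "(\<Prod>i=1..n. indicator {a (n + 1 - i)<..<b (n + 1 - i)} (t i) :: complex) =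
      (\<Prod>i=1..n. indicator {a (n + 1 - (n + 1 - i))<..<b (n + 1 - (n + 1 - i))} (t (n + 1 - i)))"
    by (rule prod.reindex_bij_betw[OF bij_betw_rev, symmetric])
  also have "\<dots> = (\<Prod>i=1..n. cnj (indicator {a i<..<b i} (rev_pt n t i)))"
    by (rule prod.cong) (auto simp: rev_pt_def indicator_def)
  finally show ?case
    using Cons by (simp add: box_fun_def rev_boxes_def z)
qed

text \<open>Reversal preserves the measure, and \<open>f\<close> agrees with its own mirror image.
  Hence mirrored step functions approximate \<open>f\<close> equally well, which makes its integral
  self-adjoint.\<close>

lemma d2_rev_boxes:
  assumes f: "f \<in> L2 n" and m: "mirror_symmetric n f"
  shows "d2 n (\<lambda>t. f t - box_fun n (rev_boxes n ts) t) = d2 n (\<lambda>t. f t - box_fun n ts t)"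
proof -
  let ?h = "\<lambda>t. (cmod (f t - box_fun n ts t))\<^sup>2"
  have h: "?h \<in> borel_measurable (Rplus n)"
    using L2_diff[OF f box_fun_L2, of ts] by (auto simp: L2_def dest: borel_measurable_integrable)
  have "d2 n (\<lambda>t. f t - box_fun n (rev_boxes n ts) t) = (\<integral>t. ?h (rev_pt n t) \<partial>Rplus n)"
    unfolding d2_def
  proof (rule integral_cong_AE)
    show "(\<lambda>t. (cmod (f t - box_fun n (rev_boxes n ts) t))\<^sup>2) \<in> borel_measurable (Rplus n)"
      using L2_diff[OF f box_fun_L2, of "rev_boxes n ts"] by (auto simp: L2_def dest: borel_measurable_integrable)
    show "(\<lambda>t. ?h (rev_pt n t)) \<in> borel_measurable (Rplus n)"
      by (rule measurable_compose[OF measurable_rev_pt h])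
    show "AE t in Rplus n. (cmod (f t - box_fun n (rev_boxes n ts) t))\<^sup>2 = ?h (rev_pt n t)"
      using m unfolding mirror_symmetric_def
    proof eventually_elim
      case (elim t)
      then have "f t = cnj (f (rev_pt n t))" by (simp add: rev_pt_def)
      then have "f t - box_fun n (rev_boxes n ts) t = cnj (f (rev_pt n t) - box_fun n ts (rev_pt n t))"
        by (simp add: box_fun_rev)
      then show ?case by (simp only: complex_mod_cnj)
    qed
  qed
  also have "\<dots> = (\<integral>t. ?h t \<partial>distr (Rplus n) (Rplus n) (rev_pt n))"
    by (rule integral_distr[OF measurable_rev_pt h, symmetric])
  finally show ?thesis by (simp add: distr_rev_pt d2_def)
qed

section \<open>Wigner integrals of step functions\<close>

definition grid :: "(nat \<Rightarrow> real) \<Rightarrow> nat \<Rightarrow> bool" where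
  "grid \<tau> N \<longleftrightarrow> 0 \<le> \<tau> 0 \<and> (\<forall>i<N. \<tau> i < \<tau> (Suc i))"

definition endpoints :: "nat \<Rightarrow> boxes \<Rightarrow> real set" where
  "endpoints n ts = (\<Union>(c, a, b)\<in>set ts. a ` {1..n} \<union> b ` {1..n})"

lemma finite_endpoints: "finite (endpoints n ts)"
  by (auto simp: endpoints_def)

lemma endpoints_nonneg: "off_diagonal n ts \<Longrightarrow> endpoints n ts \<subseteq> {0..}"
  by (fastforce simp: off_diagonal_def endpoints_def)

lemma off_diagonalD:
  assumes "off_diagonal n ts" "(c, a, b) \<in> set ts" "i \<in> {1..n}"
  shows "0 \<le> a i" "a i < b i"
  using assms unfolding off_diagonal_def by blast+

lemma ex_grid:
  assumes "finite P" "P \<subseteq> {0..}"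
  shows "\<exists>\<tau> N. grid \<tau> N \<and> P \<subseteq> \<tau> ` {..N}"
proof -
  \<comment> \<open>The point 0 makes the list non-empty even if \<open>P\<close> is empty.\<close>
  define xs where "xs = sorted_list_of_set (insert 0 P)"
  have set: "set xs = insert 0 P" and sorted: "sorted_wrt (<) xs"
    using assms strict_sorted_list_of_set[of "insert 0 P"] set_sorted_list_of_set[of "insert 0 P"]
    by (simp_all add: xs_def del: sorted_list_of_set_insert_remove)
  have len: "0 < length xs" using set by (cases xs) auto
  have "grid (\<lambda>i. xs ! i) (length xs - 1)"
    unfolding grid_def
  proof (intro conjI allI impI)
    show "0 \<le> xs ! 0" using nth_mem[OF len] set assms(2) by auto
    show "xs ! i < xs ! Suc i" if "i < length xs - 1" for i
      using that by (intro sorted_wrt_nth_less[OF sorted]) auto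
  qed
  moreover have "P \<subseteq> (\<lambda>i. xs ! i) ` {..length xs - 1}"
  proof
    fix x assume "x \<in> P"
    then obtain i where "i < length xs" "xs ! i = x" using set by (metis in_set_conv_nth insertI2)
    then show "x \<in> (\<lambda>i. xs ! i) ` {..length xs - 1}" by force
  qed
  ultimately show ?thesis by blast
qed

lemma grid_less: "\<lbrakk>grid \<tau> N; i < j; j \<le> N\<rbrakk> \<Longrightarrow> \<tau> i < \<tau> j"
proof (induction j)
  case (Suc j)
  then have "\<tau> j < \<tau> (Suc j)" by (simp add: grid_def)
  then show ?case using Suc by (cases "i = j") auto
qed simp

lemma grid_less_iff: "\<lbrakk>grid \<tau> N; i \<le> N; j \<le> N\<rbrakk> \<Longrightarrow> \<tau> i < \<tau> j \<longleftrightarrow> i < j"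
  using grid_less[of \<tau> N i j] grid_less[of \<tau> N j i] by (cases i j rule: linorder_cases) auto

lemma grid_le_iff: "\<lbrakk>grid \<tau> N; i \<le> N; j \<le> N\<rbrakk> \<Longrightarrow> \<tau> i \<le> \<tau> j \<longleftrightarrow> i \<le> j"
  using grid_less_iff[of \<tau> N j i] by (simp add: not_less[symmetric])

lemma grid_nonneg: "grid \<tau> N \<Longrightarrow> i \<le> N \<Longrightarrow> 0 \<le> \<tau> i"
  using grid_le_iff[of \<tau> N 0 i] by (auto simp: grid_def intro: order_trans)

lemma grid_locate:
  assumes "grid \<tau> N" "\<tau> 0 < x" "x < \<tau> N" "x \<notin> \<tau> ` {..N}"
  shows "\<exists>m<N. \<tau> m < x \<and> x < \<tau> (Suc m)"
proof -
  define m where "m = (LEAST m. x < \<tau> (Suc m))"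
  have N: "N \<noteq> 0" using assms by (intro notI) auto
  then have ex: "x < \<tau> (Suc (N - 1))" using assms by simp
  have m: "x < \<tau> (Suc m)" unfolding m_def by (rule LeastI[of _ "N - 1"]) (rule ex)
  have "m \<le> N - 1" unfolding m_def by (rule Least_le) (rule ex)
  then have mN: "m < N" using N by simp
  have "\<tau> m < x"
  proof (cases m)
    case 0
    then show ?thesis using assms by simp
  next
    case (Suc m')
    then have "\<not> x < \<tau> m" unfolding m_def using not_less_Least[of m' "\<lambda>m. x < \<tau> (Suc m)"] by auto
    moreover have "x \<noteq> \<tau> m" using assms(4) mN by auto
    ultimately show ?thesis by simp
  qed
  then show ?thesis using m mN by blast
qed

section \<open>Cells of a grid and the coefficients of step functions\<close>

definition inside :: "(nat \<Rightarrow> real) \<Rightarrow> real \<Rightarrow> real \<Rightarrow> nat \<Rightarrow> bool" where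
  "inside \<tau> x y m \<longleftrightarrow> x \<le> \<tau> m \<and> \<tau> (Suc m) \<le> y"

text \<open>The value of the step function on the cell indexed by \<open>v\<close>, if its endpoints
  lie on the grid. Variables are numbered from 1 and letters of a word from 0, whence i - 1.\<close>

definition cell_coeff :: "nat \<Rightarrow> (nat \<Rightarrow> real) \<Rightarrow> boxes \<Rightarrow> nat list \<Rightarrow> complex" where
  "cell_coeff n \<tau> ts v = (\<Sum>(c, a, b)\<leftarrow>ts. c * of_bool (\<forall>i\<in>{1..n}. inside \<tau> (a i) (b i) (v ! (i - 1))))"

definition cell_volume :: "nat \<Rightarrow> (nat \<Rightarrow> real) \<Rightarrow> nat list \<Rightarrow> real" where
  "cell_volume n \<tau> v = (\<Prod>i=1..n. \<tau> (Suc (v ! (i - 1))) - \<tau> (v ! (i - 1)))"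

text \<open>The square root of the volume compensates for the normalisation of the increments.\<close>

definition grid_coeff :: "nat \<Rightarrow> (nat \<Rightarrow> real) \<Rightarrow> nat \<Rightarrow> boxes \<Rightarrow> nat list \<Rightarrow> complex" where
  "grid_coeff n \<tau> N ts v =
     (if v \<in> words N n then cell_coeff n \<tau> ts v * of_real (sqrt (cell_volume n \<tau> v)) else 0)"

definition cell :: "nat \<Rightarrow> (nat \<Rightarrow> real) \<Rightarrow> nat list \<Rightarrow> (nat \<Rightarrow> real) set" where
  "cell n \<tau> v = obox n (\<lambda>i. \<tau> (v ! (i - 1))) (\<lambda>i. \<tau> (Suc (v ! (i - 1))))"

lemma homog_grid_coeff: "homog N n (grid_coeff n \<tau> N ts)"
  by (simp add: homog_def grid_coeff_def)

lemma words_nth_less: "v \<in> words N n \<Longrightarrow> i \<in> {1..n} \<Longrightarrow> v ! (i - 1) < N"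
proof -
  assume v: "v \<in> words N n" and i: "i \<in> {1..n}"
  then have "i - 1 < length v" by (auto simp: words_def)
  then have "v ! (i - 1) \<in> set v" by (rule nth_mem)
  then show "v ! (i - 1) < N" using v by (auto simp: words_def)
qed

lemma obox_coord:
  assumes "t \<in> obox n a b" "i \<in> {1..n}" shows "a i < t i" "t i < b i" "0 \<le> t i"
  using PiE_mem[OF assms[unfolded obox_def]] by simp_all

lemma endpointsI:
  "(c, a, b) \<in> set ts \<Longrightarrow> i \<in> {1..n} \<Longrightarrow> a i \<in> endpoints n ts \<and> b i \<in> endpoints n ts"
  unfolding endpoints_def by (intro conjI UN_I[of "(c, a, b)"]) simp_all

lemma cell_unique:
  assumes g: "grid \<tau> N" and v: "v \<in> words N n" "w \<in> words N n" and t: "t \<in> cell n \<tau> v" "t \<in> cell n \<tau> w"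
  shows "v = w"
proof (rule nth_equalityI)
  show "length v = length w" using v by (simp add: words_def)
  fix l assume "l < length v"
  then have l: "Suc l \<in> {1..n}" using v by (auto simp: words_def)
  have lt: "v ! l < N" "w ! l < N" using words_nth_less[OF v(1) l] words_nth_less[OF v(2) l] by simp_all
  have "\<tau> (v ! l) < \<tau> (Suc (w ! l))" "\<tau> (w ! l) < \<tau> (Suc (v ! l))"
    using obox_coord[OF t(1)[unfolded cell_def] l] obox_coord[OF t(2)[unfolded cell_def] l] by simp_all
  then show "v ! l = w ! l"
    using grid_less_iff[OF g, of "v ! l" "Suc (w ! l)"] grid_less_iff[OF g, of "w ! l" "Suc (v ! l)"] lt
    by auto
qed

lemma sum_cells:
  fixes F :: "nat list \<Rightarrow> 'a::semiring_1"
  assumes g: "grid \<tau> N" and v: "v \<in> words N n" "t \<in> cell n \<tau> v"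
  shows "(\<Sum>w\<in>words N n. F w * indicator (cell n \<tau> w) t) = F v"
proof -
  have "F w * indicator (cell n \<tau> w) t = (if w = v then F v else 0)" if "w \<in> words N n" for w
    using cell_unique[OF g that v(1) _ v(2)] v(2) by (cases "t \<in> cell n \<tau> w") auto
  then have "(\<Sum>w\<in>words N n. F w * indicator (cell n \<tau> w) t) = (\<Sum>w\<in>words N n. if w = v then F v else 0)"
    by (rule sum.cong[OF refl])
  then show ?thesis using v(1) by simp
qed

lemma emeasure_cell:
  assumes g: "grid \<tau> N" and v: "v \<in> words N n"
  shows "emeasure (Rplus n) (cell n \<tau> v) = ennreal (cell_volume n \<tau> v)"
proof -
  have "emeasure lborel ({0..} \<inter> {\<tau> (v ! (i - 1))<..<\<tau> (Suc (v ! (i - 1)))}) =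
      ennreal (\<tau> (Suc (v ! (i - 1))) - \<tau> (v ! (i - 1)))" if i: "i \<in> {1..n}" for i
  proof -
    have m: "v ! (i - 1) < N" by (rule words_nth_less[OF v i])
    have "{0..} \<inter> {\<tau> (v ! (i - 1))<..<\<tau> (Suc (v ! (i - 1)))} = {\<tau> (v ! (i - 1))<..<\<tau> (Suc (v ! (i - 1)))}"
      using grid_nonneg[OF g, of "v ! (i - 1)"] m by auto
    moreover have "\<tau> (v ! (i - 1)) \<le> \<tau> (Suc (v ! (i - 1)))"
      using grid_le_iff[OF g] m by simp
    ultimately show ?thesis by simp
  qed
  moreover have "0 \<le> \<tau> (Suc (v ! (i - 1))) - \<tau> (v ! (i - 1))" if "i \<in> {1..n}" for i
    using grid_le_iff[OF g, of "v ! (i - 1)" "Suc (v ! (i - 1))"] words_nth_less[OF v that] by simp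
  ultimately show ?thesis
    unfolding cell_def emeasure_obox cell_volume_def
    by (subst prod_ennreal[symmetric]) (blast, rule prod.cong[OF refl], blast)
qed

lemma cell_volume_nonneg: "grid \<tau> N \<Longrightarrow> v \<in> words N n \<Longrightarrow> 0 \<le> cell_volume n \<tau> v"
  unfolding cell_volume_def
proof (rule prod_nonneg)
  fix i assume g: "grid \<tau> N" and v: "v \<in> words N n" and i: "i \<in> {1..n}"
  show "0 \<le> \<tau> (Suc (v ! (i - 1))) - \<tau> (v ! (i - 1))"
    using grid_le_iff[OF g, of "v ! (i - 1)" "Suc (v ! (i - 1))"] words_nth_less[OF v i] by simp
qed

text \<open>A box with endpoints on the grid is a union of cells up to grid hyperplanes, which the
  second assumption on \<open>t\<close> avoids.\<close>

lemma box_fun_cells: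
  assumes g: "grid \<tau> N" and ts: "endpoints n ts \<subseteq> \<tau> ` {..N}"
    and t: "t \<in> space (Rplus n)" "\<forall>i\<in>{1..n}. t i \<notin> \<tau> ` {..N}"
  shows "box_fun n ts t = (\<Sum>v\<in>words N n. cell_coeff n \<tau> ts v * indicator (cell n \<tau> v) t)"
proof -
  have single: "indicator (obox n a b) t =
      (\<Sum>v\<in>words N n. of_bool (\<forall>i\<in>{1..n}. inside \<tau> (a i) (b i) (v ! (i - 1))) * indicator (cell n \<tau> v) t :: complex)"
    if ab: "(c, a, b) \<in> set ts" for c a b
  proof -
    have a: "\<exists>p\<le>N. a i = \<tau> p" and b: "\<exists>q\<le>N. b i = \<tau> q" if "i \<in> {1..n}" for i
      using endpointsI[OF ab that] ts by blast+
    show ?thesis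
    proof (cases "\<exists>v\<in>words N n. t \<in> cell n \<tau> v")
      case True
      then obtain v where v: "v \<in> words N n" "t \<in> cell n \<tau> v" by blast
      have "(\<Sum>v\<in>words N n. of_bool (\<forall>i\<in>{1..n}. inside \<tau> (a i) (b i) (v ! (i - 1))) * indicator (cell n \<tau> v) t :: complex) =
          of_bool (\<forall>i\<in>{1..n}. inside \<tau> (a i) (b i) (v ! (i - 1)))"
        by (rule sum_cells[OF g v])
      also have "(\<forall>i\<in>{1..n}. inside \<tau> (a i) (b i) (v ! (i - 1))) \<longleftrightarrow> (\<forall>i\<in>{1..n}. t i \<in> {a i<..<b i})"
      proof (rule ball_cong[OF refl])
        fix i assume i: "i \<in> {1..n}"
        let ?m = "v ! (i - 1)"
        have m: "?m < N" by (rule words_nth_less[OF v(1) i])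
        have tm: "\<tau> ?m < t i" "t i < \<tau> (Suc ?m)"
          using obox_coord[OF v(2)[unfolded cell_def] i] by simp_all
        obtain p q where pq: "p \<le> N" "a i = \<tau> p" "q \<le> N" "b i = \<tau> q" using a[OF i] b[OF i] by blast
        have "\<tau> p < t i \<longleftrightarrow> p \<le> ?m"
        proof
          assume "\<tau> p < t i"
          then have "\<tau> p < \<tau> (Suc ?m)" using tm by simp
          then show "p \<le> ?m" using grid_less_iff[OF g, of p "Suc ?m"] m pq by simp
        next
          assume "p \<le> ?m"
          then have "\<tau> p \<le> \<tau> ?m" using grid_le_iff[OF g, of p ?m] m pq by simp
          then show "\<tau> p < t i" using tm by simp
        qed
        moreover have "t i < \<tau> q \<longleftrightarrow> Suc ?m \<le> q"
        proof
          assume "t i < \<tau> q"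
          then have "\<tau> ?m < \<tau> q" using tm by simp
          then show "Suc ?m \<le> q" using grid_less_iff[OF g, of ?m q] m pq by simp
        next
          assume "Suc ?m \<le> q"
          then have "\<tau> (Suc ?m) \<le> \<tau> q" using grid_le_iff[OF g, of "Suc ?m" q] m pq by simp
          then show "t i < \<tau> q" using tm by simp
        qed
        ultimately show "inside \<tau> (a i) (b i) ?m \<longleftrightarrow> t i \<in> {a i<..<b i}"
          using grid_le_iff[OF g, of p ?m] grid_le_iff[OF g, of "Suc ?m" q] m pq
          by (auto simp: inside_def)
      qed
      also have "(\<forall>i\<in>{1..n}. t i \<in> {a i<..<b i}) \<longleftrightarrow> t \<in> obox n a b"
        using t(1) by (auto simp: obox_def space_Rplus PiE_def Pi_def)
      finally show ?thesis by (simp add: indicator_def)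
    next
      case False
      have "t \<notin> obox n a b"
      proof
        assume tb: "t \<in> obox n a b"
        have "\<exists>m<N. \<tau> m < t i \<and> t i < \<tau> (Suc m)" if i: "i \<in> {1..n}" for i
        proof (rule grid_locate[OF g])
          obtain p q where pq: "p \<le> N" "a i = \<tau> p" "q \<le> N" "b i = \<tau> q" using a[OF i] b[OF i] by blast
          have "a i < t i" "t i < b i" using obox_coord[OF tb i] by simp_all
          then show "\<tau> 0 < t i" "t i < \<tau> N"
            using grid_le_iff[OF g, of 0 p] grid_le_iff[OF g, of q N] pq by auto
          show "t i \<notin> \<tau> ` {..N}" using t(2) i by blast
        qed
        then obtain m where m: "\<And>i. i \<in> {1..n} \<Longrightarrow> m i < N \<and> \<tau> (m i) < t i \<and> t i < \<tau> (Suc (m i))" by metis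
        define v where "v = map m [1..<Suc n]"
        have nth: "v ! (i - 1) = m i" if "i \<in> {1..n}" for i
          using that by (auto simp: v_def simp del: upt_Suc)
        have "v \<in> words N n"
          using m by (auto simp: v_def words_def simp del: upt_Suc)
        moreover have "t \<in> cell n \<tau> v"
          unfolding cell_def obox_def
        proof (rule PiE_I)
          fix i assume i: "i \<in> {1..n}"
          show "t i \<in> {0..} \<inter> {\<tau> (v ! (i - 1))<..<\<tau> (Suc (v ! (i - 1)))}"
            unfolding nth[OF i] using m[OF i] t(1) i by (auto simp: space_Rplus)
        next
          fix i assume "i \<notin> {1..n}"
          then show "t i = undefined" using t(1) unfolding space_Rplus by (rule PiE_arb[rotated])
        qed
        ultimately show False using False by blast
      qed
      then have "indicator (obox n a b) t = (0::complex)" by simp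
      moreover have "(\<Sum>v\<in>words N n. of_bool (\<forall>i\<in>{1..n}. inside \<tau> (a i) (b i) (v ! (i - 1))) * indicator (cell n \<tau> v) t) = (0::complex)"
        using False by (intro sum.neutral) auto
      ultimately show ?thesis by (simp only:)
    qed
  qed
  have "(\<Sum>(c, a, b)\<leftarrow>us. c * indicator (obox n a b) t) =
      (\<Sum>v\<in>words N n. cell_coeff n \<tau> us v * indicator (cell n \<tau> v) t)" if "set us \<subseteq> set ts" for us
    using that
  proof (induction us)
    case (Cons z us)
    obtain c a b where z: "z = (c, a, b)" by (cases z)
    have "(c, a, b) \<in> set ts" using Cons.prems z by simp
    note single = single[OF this]
    have IH: "(\<Sum>(c, a, b)\<leftarrow>us. c * indicator (obox n a b) t) =
        (\<Sum>v\<in>words N n. cell_coeff n \<tau> us v * indicator (cell n \<tau> v) t)"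
      using Cons by simp
    have cc: "cell_coeff n \<tau> ((c, a, b) # us) v =
        c * of_bool (\<forall>i\<in>{1..n}. inside \<tau> (a i) (b i) (v ! (i - 1))) + cell_coeff n \<tau> us v" for v
      by (simp add: cell_coeff_def)
    have "(\<Sum>(c, a, b)\<leftarrow>z # us. c * indicator (obox n a b) t) =
        c * indicator (obox n a b) t + (\<Sum>(c, a, b)\<leftarrow>us. c * indicator (obox n a b) t)"
      by (simp add: z)
    also have "\<dots> = (\<Sum>v\<in>words N n. cell_coeff n \<tau> (z # us) v * indicator (cell n \<tau> v) t)"
      unfolding z cc IH single by (simp only: distrib_right sum.distrib sum_distrib_left mult.assoc)
    finally show ?case .
  qed (simp add: cell_coeff_def)
  then show ?thesis
    using box_fun_eq[OF t(1)] by simp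
qed

text \<open>A generic point lies in at most one cell, so the square of the step function is the sum
  of the squared values, each weighted by the volume of its cell. The normalisation of
  \<open>grid_coeff\<close> contains just this weight.\<close>

lemma sq_grid_coeff:
  assumes g: "grid \<tau> N" and ts: "endpoints n ts \<subseteq> \<tau> ` {..N}"
  shows "sq N n (grid_coeff n \<tau> N ts) = d2 n (box_fun n ts)"
proof -
  let ?G = "\<lambda>t. \<Sum>v\<in>words N n. (cmod (cell_coeff n \<tau> ts v))\<^sup>2 * indicat_real (cell n \<tau> v) t"
  have cell_sets: "cell n \<tau> v \<in> sets (Rplus n)" for v by (simp add: cell_def)
  have int: "integrable (Rplus n) (indicat_real (cell n \<tau> v))" for v
    using emeasure_obox_finite cell_sets by (auto simp: cell_def)
  have "d2 n (box_fun n ts) = (\<integral>t. ?G t \<partial>Rplus n)"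
    unfolding d2_def
  proof (rule integral_cong_AE)
    show "(\<lambda>t. (cmod (box_fun n ts t))\<^sup>2) \<in> borel_measurable (Rplus n)"
      using box_fun_L2[of n ts] by (auto simp: L2_def dest: borel_measurable_integrable)
    show "?G \<in> borel_measurable (Rplus n)"
      by (intro borel_measurable_sum borel_measurable_times borel_measurable_const
          borel_measurable_indicator cell_sets)
    have "countable (\<tau> ` {..N})" by simp
    from AE_coord_notin[OF this, of n] AE_space
    show "AE t in Rplus n. (cmod (box_fun n ts t))\<^sup>2 = ?G t"
    proof eventually_elim
      case (elim t)
      show ?case
      proof (cases "\<exists>v\<in>words N n. t \<in> cell n \<tau> v")
        case True
        then obtain v where v: "v \<in> words N n" "t \<in> cell n \<tau> v" by blast
        have "(\<Sum>v\<in>words N n. cell_coeff n \<tau> ts v * indicator (cell n \<tau> v) t) = cell_coeff n \<tau> ts v"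
          by (rule sum_cells[OF g v])
        moreover have "?G t = (cmod (cell_coeff n \<tau> ts v))\<^sup>2"
          by (rule sum_cells[OF g v])
        ultimately show ?thesis
          using box_fun_cells[OF g ts elim(2,1)] by simp
      next
        case False
        then have "(\<Sum>v\<in>words N n. cell_coeff n \<tau> ts v * indicator (cell n \<tau> v) t) = 0" "?G t = 0"
          by (auto intro!: sum.neutral)
        then show ?thesis using box_fun_cells[OF g ts elim(2,1)] by simp
      qed
    qed
  qed
  also have "\<dots> = (\<Sum>v\<in>words N n. (cmod (cell_coeff n \<tau> ts v))\<^sup>2 * cell_volume n \<tau> v)"
  proof (subst Bochner_Integration.integral_sum)
    show "(\<Sum>v\<in>words N n. \<integral>t. (cmod (cell_coeff n \<tau> ts v))\<^sup>2 * indicat_real (cell n \<tau> v) t \<partial>Rplus n) =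
        (\<Sum>v\<in>words N n. (cmod (cell_coeff n \<tau> ts v))\<^sup>2 * cell_volume n \<tau> v)"
    proof (rule sum.cong)
      fix v assume v: "v \<in> words N n"
      have "measure (Rplus n) (cell n \<tau> v) = cell_volume n \<tau> v"
        using emeasure_cell[OF g v] cell_volume_nonneg[OF g v] by (simp add: measure_def)
      then show "(\<integral>t. (cmod (cell_coeff n \<tau> ts v))\<^sup>2 * indicat_real (cell n \<tau> v) t \<partial>Rplus n) =
          (cmod (cell_coeff n \<tau> ts v))\<^sup>2 * cell_volume n \<tau> v"
        using cell_sets sets.sets_into_space[OF cell_sets] by (simp add: Int_absorb2)
    qed simp
  qed (use int in simp)
  also have "\<dots> = (\<Sum>v\<in>words N n. (cmod (grid_coeff n \<tau> N ts v))\<^sup>2)"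
    by (rule sum.cong) (auto simp: grid_coeff_def norm_mult power_mult_distrib cell_volume_nonneg[OF g])
  also have "\<dots> = sq N n (grid_coeff n \<tau> N ts)"
    by (rule sq_homog[OF homog_grid_coeff order_refl, symmetric])
  finally show ?thesis by simp
qed

lemma sqrt_prod: "sqrt (\<Prod>i\<in>I. x i) = (\<Prod>i\<in>I. sqrt (x i))"
  by (induction I rule: infinite_finite_induct) (auto simp: real_sqrt_mult)

section \<open>Products of increments expanded over the cells\<close>

lemma op_prod_sum:
  fixes X :: "nat \<Rightarrow> 'h::complex_hilbert_space op"
  assumes X: "\<And>m. m < N \<Longrightarrow> X m \<in> BH"
  shows "op_prod (map (\<lambda>i. \<Sum>m<N. scale_op (G i m) (X m)) is) =
    (\<Sum>v\<in>words N (length is). scale_op (\<Prod>l<length is. G (is ! l) (v ! l)) (op_prod (map X v)))"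
proof (induction "is")
  case (Cons i "is")
  let ?k = "length is"
  let ?W = "\<lambda>v. scale_op (\<Prod>l<?k. G (is ! l) (v ! l)) (op_prod (map X v))"
  have "op_prod (map (\<lambda>i. \<Sum>m<N. scale_op (G i m) (X m)) (i # is)) =
      (\<Sum>v\<in>words N ?k. \<Sum>m<N. scale_op (G i m) (X m) o\<^sub>L ?W v)"
    by (simp add: Cons.IH compose_sum_left compose_sum_right)
  also have "\<dots> = (\<Sum>m<N. \<Sum>v\<in>words N ?k. scale_op (G i m) (X m) o\<^sub>L ?W v)"
    by (rule sum.swap)
  also have "\<dots> = (\<Sum>m<N. \<Sum>v\<in>words N ?k.
      scale_op (\<Prod>l<Suc ?k. G ((i # is) ! l) ((m # v) ! l)) (op_prod (map X (m # v))))"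
    unfolding prod.lessThan_Suc_shift
    by (intro sum.cong refl) (simp add: compose_scale_op_left compose_scale_op_right X)
  also have "\<dots> = (\<Sum>v\<in>words N (Suc ?k). scale_op (\<Prod>l<Suc ?k. G ((i # is) ! l) (v ! l)) (op_prod (map X v)))"
    unfolding sum.cartesian_product
    by (rule sum.reindex_bij_witness[where i = "\<lambda>v. (hd v, tl v)" and j = "\<lambda>(m, v). m # v"])
      (auto simp: words_def length_Suc_conv)
  finally show ?case by simp
qed simp

text \<open>Without equal neighbours the recursion of \<open>wick\<close> produces no correction
  terms.\<close>

lemma wick_distinct_adj: "distinct_adj v \<Longrightarrow> wick X v = op_prod (map X v)"
  by (induction X v rule: wick.induct) auto

lemma box_integral_Cons:
  "box_integral S n ((c, a, b) # ts) =
     scale_op c (op_prod (map (\<lambda>i. S (b i) - S (a i)) [1..<n + 1])) + box_integral S n ts"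
  by (simp add: box_integral_def)

lemma box_integral_append: "box_integral S n (ts @ us) = box_integral S n ts + box_integral S n us"
  by (simp add: box_integral_def)

lemma box_integral_scale: "box_integral S n (scale_boxes z ts) = scale_op z (box_integral S n ts)"
  by (induction ts) (auto simp: box_integral_def scale_boxes_def scale_op_add_right)

context free_brownian_motion
begin

definition incr :: "(nat \<Rightarrow> real) \<Rightarrow> nat \<Rightarrow> 'h op" where
  "incr \<tau> i = scale_op (complex_of_real (1 / sqrt (\<tau> (Suc i) - \<tau> i))) (S (\<tau> (Suc i)) - S (\<tau> i))"

lemma free_incr: "grid \<tau> N \<Longrightarrow> free_semicircular_system A \<phi> (incr \<tau>) N"
  unfolding incr_def by (rule free_increments) (auto simp: grid_def)

lemma increment_grid:
  assumes g: "grid \<tau> N" and pq: "p < q" "q \<le> N"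
  shows "S (\<tau> q) - S (\<tau> p) =
    (\<Sum>m<N. scale_op (of_bool (inside \<tau> (\<tau> p) (\<tau> q) m) * of_real (sqrt (\<tau> (Suc m) - \<tau> m))) (incr \<tau> m))"
proof -
  have "scale_op (of_bool (inside \<tau> (\<tau> p) (\<tau> q) m) * of_real (sqrt (\<tau> (Suc m) - \<tau> m))) (incr \<tau> m) =
      (if m \<in> {p..<q} then S (\<tau> (Suc m)) - S (\<tau> m) else 0)" if m: "m < N" for m
  proof -
    have "inside \<tau> (\<tau> p) (\<tau> q) m \<longleftrightarrow> m \<in> {p..<q}"
      using grid_le_iff[OF g, of p m] grid_le_iff[OF g, of "Suc m" q] m pq
      by (auto simp: inside_def)
    moreover have "0 < \<tau> (Suc m) - \<tau> m" using g m by (simp add: grid_def)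
    then have "complex_of_real (sqrt (\<tau> (Suc m) - \<tau> m)) * complex_of_real (1 / sqrt (\<tau> (Suc m) - \<tau> m)) = 1"
      by (simp add: of_real_mult[symmetric] del: of_real_mult)
    ultimately show ?thesis by (simp add: incr_def)
  qed
  then have "(\<Sum>m<N. scale_op (of_bool (inside \<tau> (\<tau> p) (\<tau> q) m) * of_real (sqrt (\<tau> (Suc m) - \<tau> m))) (incr \<tau> m)) =
      (\<Sum>m<N. if m \<in> {p..<q} then S (\<tau> (Suc m)) - S (\<tau> m) else 0)"
    by (intro sum.cong) auto
  also have "\<dots> = (\<Sum>m\<in>{p..<q}. S (\<tau> (Suc m)) - S (\<tau> m))"
    using pq by (intro sum.mono_neutral_cong_right) auto
  also have "\<dots> = S (\<tau> q) - S (\<tau> p)"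
    using pq by (intro sum_Suc_diff') simp
  finally show ?thesis by simp
qed

text \<open>Each increment is a sum over cells. Disjoint intervals share no cell, so the words that
  occur have no equal neighbours, and for them the plain product is the Wick word. This is where the
  support off the diagonals enters.\<close>

lemma box_integral_grid:
  assumes g: "grid \<tau> N" and "endpoints n ts \<subseteq> \<tau> ` {..N}" and "off_diagonal n ts"
  shows "box_integral S n ts = free_semicircular_system.J (incr \<tau>) N n (grid_coeff n \<tau> N ts)"
  using assms(2,3)
proof (induction ts)
  case Nil
  interpret F: free_semicircular_system A \<phi> "incr \<tau>" N by (rule free_incr[OF g])
  have "grid_coeff n \<tau> N [] = (\<lambda>_. 0)"
    by (simp add: fun_eq_iff grid_coeff_def cell_coeff_def)
  then show ?case by (simp add: box_integral_def F.J_def)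
next
  case (Cons z ts)
  interpret F: free_semicircular_system A \<phi> "incr \<tau>" N by (rule free_incr[OF g])
  obtain c a b where z: "z = (c, a, b)" by (cases z)
  have ends: "\<exists>p q. a i = \<tau> p \<and> b i = \<tau> q \<and> p < q \<and> q \<le> N" if i: "i \<in> {1..n}" for i
  proof -
    have "a i \<in> \<tau> ` {..N}" "b i \<in> \<tau> ` {..N}"
      using Cons.prems(1) endpointsI[of c a b "z # ts" i n] i by (auto simp: z)
    then obtain p q where pq: "p \<le> N" "a i = \<tau> p" "q \<le> N" "b i = \<tau> q" by auto
    moreover have "a i < b i" using Cons.prems(2) i by (auto simp: off_diagonal_def z)
    ultimately show ?thesis using grid_less_iff[OF g, of p q] by auto
  qed
  have dis: "disjoint_family_on (\<lambda>i. {a i<..<b i}) {1..n}"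
    using Cons.prems(2) by (auto simp: off_diagonal_def z)
  let ?G = "\<lambda>i m. of_bool (inside \<tau> (a i) (b i) m) * complex_of_real (sqrt (\<tau> (Suc m) - \<tau> m))"
  have "op_prod (map (\<lambda>i. S (b i) - S (a i)) [1..<n + 1]) =
      op_prod (map (\<lambda>i. \<Sum>m<N. scale_op (?G i m) (incr \<tau> m)) [1..<n + 1])"
  proof (rule arg_cong[where f = op_prod], rule map_cong[OF refl])
    fix i assume "i \<in> set [1..<n + 1]"
    then have "i \<in> {1..n}" by auto
    from ends[OF this] obtain p q where pq: "a i = \<tau> p" "b i = \<tau> q" "p < q" "q \<le> N" by blast
    show "S (b i) - S (a i) = (\<Sum>m<N. scale_op (?G i m) (incr \<tau> m))"
      unfolding pq(1,2) by (rule increment_grid[OF g pq(3,4)])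
  qed
  also have "\<dots> = (\<Sum>v\<in>words N (length [1..<n + 1]).
      scale_op (\<Prod>l<length [1..<n + 1]. ?G ([1..<n + 1] ! l) (v ! l)) (op_prod (map (incr \<tau>) v)))"
    by (rule op_prod_sum) (simp add: A_BH F.X_in)
  also have "\<dots> = (\<Sum>v\<in>words N n. scale_op (\<Prod>i=1..n. ?G i (v ! (i - 1))) (op_prod (map (incr \<tau>) v)))"
  proof -
    have "(\<Prod>l<n. ?G ([1..<n + 1] ! l) (v ! l)) = (\<Prod>i=1..n. ?G i (v ! (i - 1)))" for v
      by (rule prod.reindex_bij_witness[where i = "\<lambda>i. i - 1" and j = Suc])
        (auto simp del: upt_Suc)
    moreover have "length [1..<n + 1] = n" by simp
    ultimately show ?thesis by (simp only:)
  qed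
  also have "\<dots> = (\<Sum>v\<in>words N n. scale_op (of_bool (\<forall>i\<in>{1..n}. inside \<tau> (a i) (b i) (v ! (i - 1))) *
      of_real (sqrt (cell_volume n \<tau> v))) (wick (incr \<tau>) v))"
  proof (rule sum.cong)
    fix v assume v: "v \<in> words N n"
    have prod: "(\<Prod>i=1..n. ?G i (v ! (i - 1))) = of_bool (\<forall>i\<in>{1..n}. inside \<tau> (a i) (b i) (v ! (i - 1))) *
        complex_of_real (sqrt (cell_volume n \<tau> v))"
    proof (cases "\<forall>i\<in>{1..n}. inside \<tau> (a i) (b i) (v ! (i - 1))")
      case True
      then show ?thesis by (simp add: cell_volume_def sqrt_prod)
    next
      case False
      then obtain i where i: "i \<in> {1..n}" "\<not> inside \<tau> (a i) (b i) (v ! (i - 1))" by blast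
      have "(\<Prod>i=1..n. ?G i (v ! (i - 1))) = 0"
        by (rule prod_zero, simp, rule bexI[OF _ i(1)]) (simp add: i(2) del: One_nat_def)
      moreover have "of_bool (\<forall>i\<in>{1..n}. inside \<tau> (a i) (b i) (v ! (i - 1))) = (0::complex)"
        using False unfolding of_bool_eq_0_iff .
      ultimately show ?thesis by (simp only: mult_zero_left)
    qed
    show "scale_op (\<Prod>i=1..n. ?G i (v ! (i - 1))) (op_prod (map (incr \<tau>) v)) =
      scale_op (of_bool (\<forall>i\<in>{1..n}. inside \<tau> (a i) (b i) (v ! (i - 1))) * of_real (sqrt (cell_volume n \<tau> v))) (wick (incr \<tau>) v)"
    proof (cases "\<forall>i\<in>{1..n}. inside \<tau> (a i) (b i) (v ! (i - 1))")
      case True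
      have "distinct_adj v"
        unfolding distinct_adj_conv_nth
      proof (intro allI impI notI)
        fix l assume l: "Suc l < length v" and eq: "v ! l = v ! Suc l"
        have i: "Suc l \<in> {1..n}" "Suc (Suc l) \<in> {1..n}" using l v by (auto simp: words_def)
        have "inside \<tau> (a (Suc l)) (b (Suc l)) (v ! l)" "inside \<tau> (a (Suc (Suc l))) (b (Suc (Suc l))) (v ! l)"
          using True i eq by (metis diff_Suc_1)+
        moreover have "\<tau> (v ! l) < \<tau> (Suc (v ! l))"
          using words_nth_less[OF v i(1)] g by (simp add: grid_def)
        \<comment> \<open>The midpoint of a cell shared by two neighbouring variables would lie in
          two disjoint intervals.\<close>
        ultimately have "(\<tau> (v ! l) + \<tau> (Suc (v ! l))) / 2 \<in> {a (Suc l)<..<b (Suc l)} \<inter> {a (Suc (Suc l))<..<b (Suc (Suc l))}"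
          by (auto simp: inside_def)
        moreover have "{a (Suc l)<..<b (Suc l)} \<inter> {a (Suc (Suc l))<..<b (Suc (Suc l))} = {}"
          using dis i unfolding disjoint_family_on_def by (metis n_not_Suc_n)
        ultimately show False by blast
      qed
      then show ?thesis using prod by (simp add: wick_distinct_adj)
    next
      case False
      then have zero: "of_bool (\<forall>i\<in>{1..n}. inside \<tau> (a i) (b i) (v ! (i - 1))) = (0::complex)"
        unfolding of_bool_eq_0_iff .
      show ?thesis unfolding prod zero by simp
    qed
  qed simp
  finally have head: "scale_op c (op_prod (map (\<lambda>i. S (b i) - S (a i)) [1..<n + 1])) =
      (\<Sum>v\<in>words N n. scale_op (c * of_bool (\<forall>i\<in>{1..n}. inside \<tau> (a i) (b i) (v ! (i - 1))) *
         of_real (sqrt (cell_volume n \<tau> v))) (wick (incr \<tau>) v))"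
    by (simp add: F.scale_op_sum mult.assoc)
  have tl: "box_integral S n ts = (\<Sum>v\<in>words N n. scale_op (cell_coeff n \<tau> ts v * of_real (sqrt (cell_volume n \<tau> v))) (wick (incr \<tau>) v))"
    using Cons by (simp add: endpoints_def off_diagonal_def F.J_homog[OF homog_grid_coeff order_refl])
      (simp add: grid_coeff_def)
  have "box_integral S n (z # ts) =
      (\<Sum>v\<in>words N n. scale_op (cell_coeff n \<tau> (z # ts) v * of_real (sqrt (cell_volume n \<tau> v))) (wick (incr \<tau>) v))"
    unfolding z box_integral_Cons head tl
    by (simp add: cell_coeff_def distrib_right scale_op_add_left sum.distrib)
  then show ?case
    by (simp add: F.J_homog[OF homog_grid_coeff order_refl]) (simp add: grid_coeff_def)
qed

lemma ex_grid_boxes: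
  assumes "off_diagonal n ts"
  shows "\<exists>\<tau> N. grid \<tau> N \<and> endpoints n ts \<subseteq> \<tau> ` {..N}"
  using ex_grid[OF finite_endpoints endpoints_nonneg[OF assms]] .

text \<open>The isometry and the Haagerup inequality on any grid through the endpoints; the grid has
  disappeared from the bounds, so they survive limits of step functions.\<close>

lemma box_integral_bounds:
  assumes "off_diagonal n ts"
  shows "box_integral S n ts \<in> A" "n2 (box_integral S n ts) = sqrt (d2 n (box_fun n ts))"
    "norm (box_integral S n ts) \<le> (real n + 1) * sqrt (d2 n (box_fun n ts))"
proof -
  obtain \<tau> N where g: "grid \<tau> N" "endpoints n ts \<subseteq> \<tau> ` {..N}"
    using ex_grid_boxes[OF assms] by blast
  interpret F: free_semicircular_system A \<phi> "incr \<tau>" N by (rule free_incr[OF g(1)])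
  have eq: "box_integral S n ts = F.J n (grid_coeff n \<tau> N ts)"
    by (rule box_integral_grid[OF g assms])
  show "box_integral S n ts \<in> A" by (simp add: eq F.J_A)
  show n2: "n2 (box_integral S n ts) = sqrt (d2 n (box_fun n ts))"
    by (simp add: eq F.n2_J' sq_grid_coeff[OF g])
  show "norm (box_integral S n ts) \<le> (real n + 1) * sqrt (d2 n (box_fun n ts))"
    using F.norm_J_le[OF homog_grid_coeff, of n \<tau> ts] n2 by (simp add: eq)
qed

text \<open>Appending the second list with coefficients multiplied by -1 represents the difference
  by a single list, hence on a common grid.\<close>

lemma box_integral_diff_bounds:
  assumes "off_diagonal n ts" "off_diagonal n us"
  shows "n2 (box_integral S n ts - box_integral S n us) = sqrt (d2 n (\<lambda>t. box_fun n ts t - box_fun n us t))"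
    "norm (box_integral S n ts - box_integral S n us) \<le> (real n + 1) * sqrt (d2 n (\<lambda>t. box_fun n ts t - box_fun n us t))"
proof -
  let ?vs = "ts @ scale_boxes (-1) us"
  have od: "off_diagonal n ?vs" using assms by (intro off_diagonal_append off_diagonal_scale)
  have 1: "box_integral S n ?vs = box_integral S n ts - box_integral S n us"
    by (simp add: box_integral_append box_integral_scale diff_eq_scale_op)
  have 2: "box_fun n ?vs = (\<lambda>t. box_fun n ts t - box_fun n us t)"
    by (simp add: box_fun_append box_fun_scale fun_eq_iff)
  show "n2 (box_integral S n ts - box_integral S n us) = sqrt (d2 n (\<lambda>t. box_fun n ts t - box_fun n us t))"
    "norm (box_integral S n ts - box_integral S n us) \<le> (real n + 1) * sqrt (d2 n (\<lambda>t. box_fun n ts t - box_fun n us t))"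
    using box_integral_bounds(2,3)[OF od] unfolding 1 2 by auto
qed

lemma S_A: "0 \<le> t \<Longrightarrow> S t \<in> A"
  using adapted filtration_subset by blast

lemma adj_op_prod: "set Xs \<subseteq> A \<Longrightarrow> adj (op_prod Xs) = op_prod (rev (map adj Xs))"
proof (induction Xs)
  case (Cons T Ts)
  then show ?case by (simp add: adj_compose A_BH A_prod op_prod_append)
qed simp

lemma adj_box_integral:
  assumes "off_diagonal n ts"
  shows "adj (box_integral S n ts) = box_integral S n (rev_boxes n ts)"
  using assms
proof (induction ts)
  case Nil
  then show ?case by (simp add: box_integral_def rev_boxes_def)
next
  case (Cons z ts)
  obtain c a b where z: "z = (c, a, b)" by (cases z)
  have od: "off_diagonal n ts" using Cons.prems by (simp add: off_diagonal_def)
  have ab: "0 \<le> a i" "0 \<le> b i" if "i \<in> {1..n}" for i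
    using off_diagonalD[OF Cons.prems, of c a b i] that by (auto simp: z)
  have D: "S (b i) - S (a i) \<in> A" "adj (S (b i) - S (a i)) = S (b i) - S (a i)" if "i \<in> {1..n}" for i
    using ab[OF that] by (auto simp: A_diff S_A adj_diff A_BH self_adjoint)
  let ?Xs = "map (\<lambda>i. S (b i) - S (a i)) [1..<n + 1]"
  have sub: "set ?Xs \<subseteq> A" using D by auto
  have "adj (op_prod ?Xs) = op_prod (rev (map adj ?Xs))"
    by (rule adj_op_prod[OF sub])
  also have "map adj ?Xs = ?Xs" using D(2) by (simp del: upt_Suc)
  also have "rev ?Xs = map (\<lambda>i. S (b (n + 1 - i)) - S (a (n + 1 - i))) [1..<n + 1]"
    by (rule nth_equalityI) (auto simp: rev_nth Suc_diff_Suc simp del: upt_Suc)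
  finally have "adj (scale_op c (op_prod ?Xs)) =
      scale_op (cnj c) (op_prod (map (\<lambda>i. S (b (n + 1 - i)) - S (a (n + 1 - i))) [1..<n + 1]))"
    using A_prod[OF sub] by (simp add: adj_scale_op A_BH)
  moreover have "adj (box_integral S n (z # ts)) = adj (scale_op c (op_prod ?Xs)) + adj (box_integral S n ts)"
    unfolding z box_integral_Cons
    using A_prod[OF sub] box_integral_bounds(1)[OF od] by (intro adj_add A_BH A_scale)
  moreover have "rev_boxes n (z # ts) = (cnj c, \<lambda>i. a (n + 1 - i), \<lambda>i. b (n + 1 - i)) # rev_boxes n ts"
    by (simp add: rev_boxes_def z)
  ultimately show ?case
    using Cons.IH[OF od] by (simp only: box_integral_Cons)
qed

section \<open>The Wigner integral as a norm limit\<close>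

text \<open>The norm bound for differences makes the integrals of approximating step functions a
  Cauchy sequence in operator norm, whose limit stays in \<open>A\<close>. It is also a 2-norm
  limit, and uniqueness of these identifies it with the definite description, for every admissible
  sequence.\<close>

lemma wigner_integral_limit:
  assumes f: "f \<in> L2 n" and od: "\<And>k. off_diagonal n (ts k)"
    and lim: "(\<lambda>k. d2 n (\<lambda>t. f t - box_fun n (ts k) t)) \<longlonglongrightarrow> 0"
  shows "wigner_integral A \<phi> S n f \<in> A" "(\<lambda>k. box_integral S n (ts k)) \<longlonglongrightarrow> wigner_integral A \<phi> S n f"
proof -
  define B where "B k = box_integral S n (ts k)" for k
  define e where "e k = d2 n (\<lambda>t. f t - box_fun n (ts k) t)" for k
  have B: "B k \<in> A" for k unfolding B_def by (rule box_integral_bounds(1)[OF od])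
  have diff_le: "d2 n (\<lambda>t. box_fun n (ts k) t - box_fun n us t) \<le> 2 * e k + 2 * d2 n (\<lambda>t. f t - box_fun n us t)" for k us
    using d2_diff_le[OF box_fun_L2 f box_fun_L2, of "ts k" us] d2_minus_commute[of n "box_fun n (ts k)" f]
    by (simp add: e_def)
  have e0: "e \<longlonglongrightarrow> 0" unfolding e_def by (rule lim)
  have "Cauchy B"
  proof (rule metric_CauchyI)
    fix \<epsilon> :: real assume \<epsilon>: "0 < \<epsilon>"
    \<comment> \<open>The 4 covers the two terms of the triangle inequality for \<open>d2\<close>,
      each with factor 2, and n + 1 is the constant of the norm bound.\<close>
    define \<eta> where "\<eta> = (\<epsilon> / (real n + 1))\<^sup>2 / 4"
    have "0 < \<eta>" using \<epsilon> by (simp add: \<eta>_def)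
    then have "\<forall>\<^sub>F k in sequentially. e k < \<eta>" using e0 by (rule order_tendstoD(2)[rotated])
    then obtain M where M: "\<And>k. M \<le> k \<Longrightarrow> e k < \<eta>" by (auto simp: eventually_sequentially)
    have "dist (B k) (B l) < \<epsilon>" if "M \<le> k" "M \<le> l" for k l
    proof -
      have "d2 n (\<lambda>t. box_fun n (ts k) t - box_fun n (ts l) t) < (\<epsilon> / (real n + 1))\<^sup>2"
        using diff_le[of k "ts l"] M[OF that(1)] M[OF that(2)] by (simp add: e_def \<eta>_def)
      then have "sqrt (d2 n (\<lambda>t. box_fun n (ts k) t - box_fun n (ts l) t)) < \<epsilon> / (real n + 1)"
        using \<epsilon> by (intro real_less_lsqrt) (auto simp: d2_nonneg)
      then have "(real n + 1) * sqrt (d2 n (\<lambda>t. box_fun n (ts k) t - box_fun n (ts l) t)) < \<epsilon>"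
        by (simp add: field_simps add_nonneg_pos)
      then show ?thesis
        using box_integral_diff_bounds(2)[OF od od, of k l] by (simp add: dist_norm B_def)
    qed
    then show "\<exists>M. \<forall>k\<ge>M. \<forall>l\<ge>M. dist (B k) (B l) < \<epsilon>" by blast
  qed
  then obtain X where X: "B \<longlonglongrightarrow> X" using Cauchy_convergent_iff convergent_def by blast
  have XA: "X \<in> A" by (rule A_limit[OF B X])
  obtain K where K: "\<And>T. T \<in> A \<Longrightarrow> n2 T \<le> K * norm T" using n2_le_norm by blast
  have n2X: "(\<lambda>k. n2 (X - B k)) \<longlonglongrightarrow> 0"
  proof (rule Lim_null_comparison)
    have "(\<lambda>k. X - B k) \<longlonglongrightarrow> X - X" by (intro tendsto_intros X)
    then show "(\<lambda>k. K * norm (X - B k)) \<longlonglongrightarrow> 0"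
      by (intro tendsto_mult_right_zero tendsto_norm_zero) simp
    show "\<forall>\<^sub>F k in sequentially. norm (n2 (X - B k)) \<le> K * norm (X - B k)"
      using K XA B by (simp add: n2_nonneg A_diff)
  qed
  \<comment> \<open>The definition of the integral tests complex values of the state; this
    translates them into 2-norms.\<close>
  have conv_iff: "(\<lambda>k. \<phi> (adj (Y - C k) o\<^sub>L (Y - C k))) \<longlonglongrightarrow> 0 \<longleftrightarrow> (\<lambda>k. n2 (Y - C k)) \<longlonglongrightarrow> 0"
    if "Y \<in> A" "\<And>k. C k \<in> A" for Y C
  proof -
    have eq: "(\<lambda>k. \<phi> (adj (Y - C k) o\<^sub>L (Y - C k))) = (\<lambda>k. complex_of_real ((n2 (Y - C k))\<^sup>2))"
      using that by (simp add: state_adj_self A_diff)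
    show ?thesis
    proof
      assume "(\<lambda>k. \<phi> (adj (Y - C k) o\<^sub>L (Y - C k))) \<longlonglongrightarrow> 0"
      then have "(\<lambda>k. complex_of_real ((n2 (Y - C k))\<^sup>2)) \<longlonglongrightarrow> complex_of_real 0"
        unfolding eq by simp
      then have "(\<lambda>k. (n2 (Y - C k))\<^sup>2) \<longlonglongrightarrow> 0"
        by (simp only: tendsto_of_real_iff)
      then have "(\<lambda>k. sqrt ((n2 (Y - C k))\<^sup>2)) \<longlonglongrightarrow> sqrt 0" by (rule tendsto_real_sqrt)
      then show "(\<lambda>k. n2 (Y - C k)) \<longlonglongrightarrow> 0" using that by (simp add: n2_nonneg A_diff)
    next
      assume "(\<lambda>k. n2 (Y - C k)) \<longlonglongrightarrow> 0"
      then have "(\<lambda>k. complex_of_real ((n2 (Y - C k))\<^sup>2)) \<longlonglongrightarrow> complex_of_real (0\<^sup>2)"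
        by (intro tendsto_intros)
      then show "(\<lambda>k. \<phi> (adj (Y - C k) o\<^sub>L (Y - C k))) \<longlonglongrightarrow> 0" unfolding eq by simp
    qed
  qed
  have "wigner_integral A \<phi> S n f = X"
    unfolding wigner_integral_def
  proof (rule the_equality)
    show "X \<in> A \<and> (\<exists>ts. (\<forall>k. off_diagonal n (ts k)) \<and>
        (\<lambda>k. \<integral>t. (cmod (f t - box_fun n (ts k) t))\<^sup>2 \<partial>Rplus n) \<longlonglongrightarrow> 0 \<and>
        (\<lambda>k. \<phi> (adj (X - box_integral S n (ts k)) o\<^sub>L (X - box_integral S n (ts k)))) \<longlonglongrightarrow> 0)"
      using XA od lim n2X conv_iff[OF XA B] by (auto simp: d2_def B_def intro!: exI[of _ ts])
  next
    fix Y assume "Y \<in> A \<and> (\<exists>ts. (\<forall>k. off_diagonal n (ts k)) \<and>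
        (\<lambda>k. \<integral>t. (cmod (f t - box_fun n (ts k) t))\<^sup>2 \<partial>Rplus n) \<longlonglongrightarrow> 0 \<and>
        (\<lambda>k. \<phi> (adj (Y - box_integral S n (ts k)) o\<^sub>L (Y - box_integral S n (ts k)))) \<longlonglongrightarrow> 0)"
    then obtain us where Y: "Y \<in> A" and us: "\<And>k. off_diagonal n (us k)"
      "(\<lambda>k. d2 n (\<lambda>t. f t - box_fun n (us k) t)) \<longlonglongrightarrow> 0"
      "(\<lambda>k. \<phi> (adj (Y - box_integral S n (us k)) o\<^sub>L (Y - box_integral S n (us k)))) \<longlonglongrightarrow> 0"
      by (auto simp: d2_def)
    have C: "box_integral S n (us k) \<in> A" for k by (rule box_integral_bounds(1)[OF us(1)])
    have "(\<lambda>k. n2 (Y - box_integral S n (us k))) \<longlonglongrightarrow> 0"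
      using us(3) conv_iff[of Y "\<lambda>k. box_integral S n (us k)", OF Y C] by blast
    moreover have "(\<lambda>k. n2 (box_integral S n (us k) - B k)) \<longlonglongrightarrow> 0"
    proof (rule Lim_null_comparison)
      have "(\<lambda>k. sqrt (2 * e k + 2 * d2 n (\<lambda>t. f t - box_fun n (us k) t))) \<longlonglongrightarrow> sqrt (2 * 0 + 2 * 0)"
        by (intro tendsto_intros e0 us(2))
      then show "(\<lambda>k. sqrt (2 * e k + 2 * d2 n (\<lambda>t. f t - box_fun n (us k) t))) \<longlonglongrightarrow> 0" by simp
      have "n2 (box_integral S n (us k) - B k) \<le> sqrt (2 * e k + 2 * d2 n (\<lambda>t. f t - box_fun n (us k) t))" for k
        using diff_le[of k "us k"] n2_minus_commute[OF C[of k] B[of k]] box_integral_diff_bounds(1)[OF od[of k] us(1)[of k]]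
        by (simp add: B_def)
      then show "\<forall>\<^sub>F k in sequentially. norm (n2 (box_integral S n (us k) - B k)) \<le>
          sqrt (2 * e k + 2 * d2 n (\<lambda>t. f t - box_fun n (us k) t))"
        using C B by (simp add: n2_nonneg A_diff)
    qed
    ultimately show "Y = X"
      using n2X by (intro n2_tendsto_zero_unique[OF Y XA C B])
  qed
  then show "wigner_integral A \<phi> S n f \<in> A" "(\<lambda>k. box_integral S n (ts k)) \<longlonglongrightarrow> wigner_integral A \<phi> S n f"
    using XA X by (auto simp: B_def[abs_def])
qed

lemma wigner_integral_A:
  assumes f: "f \<in> L2 n" shows "wigner_integral A \<phi> S n f \<in> A"
proof -
  obtain ts where "\<And>k. off_diagonal n (ts k)" "(\<lambda>k. d2 n (\<lambda>t. f t - box_fun n (ts k) t)) \<longlonglongrightarrow> 0"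
    using ex_box_sequence[OF f] by blast
  then show ?thesis by (rule wigner_integral_limit(1)[OF f])
qed

text \<open>Step functions and their mirror images have the same limit, so the integral equals its
  adjoint. Averaging the two keeps the approximation and makes the approximant exactly self-adjoint,
  as the discrete fourth moment formula demands.\<close>

lemma ex_self_adjoint_boxes:
  assumes f: "f \<in> L2 n" and m: "mirror_symmetric n f" and e: "0 < e"
  shows "adj (wigner_integral A \<phi> S n f) = wigner_integral A \<phi> S n f"
    "\<exists>ts. off_diagonal n ts \<and> adj (box_integral S n ts) = box_integral S n ts \<and>
       norm (wigner_integral A \<phi> S n f - box_integral S n ts) < e"
proof -
  let ?W = "wigner_integral A \<phi> S n f"
  obtain ts where od: "\<And>k. off_diagonal n (ts k)" and lim: "(\<lambda>k. d2 n (\<lambda>t. f t - box_fun n (ts k) t)) \<longlonglongrightarrow> 0"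
    using ex_box_sequence[OF f] by blast
  define B where "B k = box_integral S n (ts k)" for k
  have W: "?W \<in> A" and BW: "B \<longlonglongrightarrow> ?W"
    using wigner_integral_limit[OF f od lim] by (auto simp: B_def[abs_def])
  have B: "B k \<in> A" for k unfolding B_def by (rule box_integral_bounds(1)[OF od])
  have "(\<lambda>k. box_integral S n (rev_boxes n (ts k))) \<longlonglongrightarrow> ?W"
    using lim by (intro wigner_integral_limit(2)[OF f off_diagonal_rev[OF od]]) (simp add: d2_rev_boxes[OF f m])
  then have adjB: "(\<lambda>k. adj (B k)) \<longlonglongrightarrow> ?W"
    by (simp add: B_def adj_box_integral[OF od])
  have norm_adj_diff: "norm (adj ?W - adj (B k)) = norm (?W - B k)" for k
    using norm_adj[OF A_BH[OF A_diff[OF W B]]] by (simp add: adj_diff A_BH W B)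
  have d0: "(\<lambda>k. norm (?W - B k)) \<longlonglongrightarrow> 0"
  proof -
    have "(\<lambda>k. ?W - B k) \<longlonglongrightarrow> ?W - ?W" by (intro tendsto_intros BW)
    then show ?thesis by (intro tendsto_norm_zero) simp
  qed
  have "(\<lambda>k. adj ?W - adj (B k)) \<longlonglongrightarrow> 0"
    by (rule tendsto_norm_zero_cancel) (simp only: norm_adj_diff d0)
  then have "(\<lambda>k. adj ?W - (adj ?W - adj (B k))) \<longlonglongrightarrow> adj ?W - 0" by (intro tendsto_intros)
  then show adjW: "adj ?W = ?W" using adjB LIMSEQ_unique by fastforce
  obtain k where k: "norm (?W - B k) < e"
    using order_tendstoD(2)[OF d0 e] by (auto simp: eventually_sequentially)
  define us where "us = scale_boxes (1 / 2) (ts k @ rev_boxes n (ts k))"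
  have us_od: "off_diagonal n us"
    unfolding us_def by (intro off_diagonal_scale off_diagonal_append off_diagonal_rev od)
  have us: "box_integral S n us = scale_op (1 / 2) (B k + adj (B k))"
    by (simp add: us_def box_integral_scale box_integral_append B_def adj_box_integral[OF od])
  have "adj (box_integral S n us) = box_integral S n us"
    using B by (simp add: us adj_scale_op adj_add A_BH A_intros adj_adj add.commute)
  moreover have "?W - box_integral S n us = scale_op (1 / 2) (?W - B k) + scale_op (1 / 2) (adj ?W - adj (B k))"
  proof -
    have "scale_op (1 / 2) ?W + scale_op (1 / 2) ?W = ?W"
      by (simp flip: scale_op_add_left)
    then show ?thesis
      by (simp add: us adjW scale_op_add_right scale_op_diff_right algebra_simps)
  qed
  then have "norm (?W - box_integral S n us) \<le> (1 / 2) * norm (?W - B k) + (1 / 2) * norm (adj ?W - adj (B k))"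
    by (simp add: order_trans[OF norm_triangle_ineq] norm_scale_op)
  then have "norm (?W - box_integral S n us) < e"
    using k by (simp add: norm_adj_diff)
  ultimately show "\<exists>ts. off_diagonal n ts \<and> adj (box_integral S n ts) = box_integral S n ts \<and>
       norm (?W - box_integral S n ts) < e"
    using us_od by blast
qed

end

section \<open>The multidimensional fourth moment theorem\<close>

context tracial_W_prob_space
begin

text \<open>Telescoping: one factor is exchanged at a time while the others stay bounded.\<close>

lemma op_prod_tendsto_diff:
  fixes X Y :: "nat \<Rightarrow> nat \<Rightarrow> 'h op"
  assumes diff: "\<And>i. i \<in> set w \<Longrightarrow> (\<lambda>k. norm (X k i - Y k i)) \<longlonglongrightarrow> 0"
    and X: "\<And>k i. i \<in> set w \<Longrightarrow> norm (X k i) \<le> B" and Y: "\<And>k i. i \<in> set w \<Longrightarrow> norm (Y k i) \<le> B"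
  shows "(\<lambda>k. norm (op_prod (map (X k) w) - op_prod (map (Y k) w))) \<longlonglongrightarrow> 0"
  using assms
proof (induction w)
  case (Cons i w)
  let ?P = "\<lambda>k. op_prod (map (X k) w)" and ?Q = "\<lambda>k. op_prod (map (Y k) w)"
  define C where "C = (\<Prod>i\<leftarrow>w. B)"
  have Q: "norm (?Q k) \<le> C" for k
    unfolding C_def by (rule norm_op_prod_le) (use Cons.prems in auto)
  have IH: "(\<lambda>k. norm (?P k - ?Q k)) \<longlonglongrightarrow> 0"
    using Cons by simp
  have le: "norm ((X k i o\<^sub>L ?P k) - (Y k i o\<^sub>L ?Q k)) \<le> B * norm (?P k - ?Q k) + norm (X k i - Y k i) * C" for k
  proof -
    have "(X k i o\<^sub>L ?P k) - (Y k i o\<^sub>L ?Q k) = (X k i o\<^sub>L (?P k - ?Q k)) + ((X k i - Y k i) o\<^sub>L ?Q k)"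
      by (simp add: compose_diff_left compose_diff_right)
    then have "norm ((X k i o\<^sub>L ?P k) - (Y k i o\<^sub>L ?Q k)) \<le>
        norm (X k i) * norm (?P k - ?Q k) + norm (X k i - Y k i) * norm (?Q k)"
      by (simp add: norm_triangle_le add_mono norm_blinfun_compose)
    also have "\<dots> \<le> B * norm (?P k - ?Q k) + norm (X k i - Y k i) * C"
      using Cons.prems(2)[of i k] Q[of k] by (intro add_mono mult_right_mono mult_left_mono) auto
    finally show ?thesis .
  qed
  have "(\<lambda>k. B * norm (?P k - ?Q k) + norm (X k i - Y k i) * C) \<longlonglongrightarrow> B * 0 + 0 * C"
    using Cons.prems(1)[of i] by (intro tendsto_intros IH) simp
  then show ?case
    by (intro Lim_null_comparison[of "\<lambda>k. norm (op_prod (map (X k) (i # w)) - op_prod (map (Y k) (i # w)))"])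
      (use le in auto)
qed simp

lemma state_tendsto_diff:
  assumes "\<And>k. T k \<in> A" "\<And>k. U k \<in> A" "(\<lambda>k. norm (T k - U k)) \<longlonglongrightarrow> 0" "(\<lambda>k. \<phi> (T k)) \<longlonglongrightarrow> l"
  shows "(\<lambda>k. \<phi> (U k)) \<longlonglongrightarrow> l"
proof -
  obtain K where K: "\<And>T. T \<in> A \<Longrightarrow> cmod (\<phi> T) \<le> K * norm T" using state_bounded by blast
  have "(\<lambda>k. K * norm (T k - U k)) \<longlonglongrightarrow> 0"
    using assms(3) by (rule tendsto_mult_right_zero)
  then have "(\<lambda>k. \<phi> (T k) - \<phi> (U k)) \<longlonglongrightarrow> 0"
    by (rule Lim_null_comparison[rotated])
      (use K[OF A_diff[OF assms(1,2)]] in \<open>simp add: state_diff assms(1,2)\<close>)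
  then have "(\<lambda>k. \<phi> (T k) - (\<phi> (T k) - \<phi> (U k))) \<longlonglongrightarrow> l - 0"
    by (intro tendsto_diff assms(4))
  then show ?thesis by simp
qed

end

text \<open>By orthonormality of the Wick words a kernel is determined by its operator, so
  self-adjointness passes to the kernel.\<close>

lemma (in free_semicircular_system) star_eq_of_self_adjoint:
  assumes f: "homog N n f" and sa: "adj (J n f) = J n f"
  shows "star f = f"
proof -
  let ?h = "\<lambda>v. star f v + (-1) * f v"
  have "J n ?h = J n (star f) + scale_op (-1) (J n f)"
    unfolding J_add J_scale by (rule refl)
  also have "\<dots> = 0" using sa by (simp add: adj_J flip: diff_eq_scale_op)
  finally have "sq N n ?h = 0" using n2_J[of n ?h] by simp
  then have 0: "?h v = 0" if "v \<in> wordsle N n" for v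
    using that by (simp add: sq_def sum_nonneg_eq_0_iff)
  show ?thesis
  proof
    fix v
    show "star f v = f v"
    proof (cases "v \<in> words N n")
      case True
      then show ?thesis using 0[of v] words_subset_wordsle[of n n N] by auto
    next
      case False
      then show ?thesis using f homog_star[OF f] by (simp add: homog_def)
    qed
  qed
qed

context free_brownian_motion
begin

text \<open>Each integral is replaced by a discrete one at distance less than 1 / (k + 1) in norm.
  With uniform norm bounds, moments of the two families have the same limits, so the hypotheses pass
  to the grids and the conclusion passes back.\<close>

theorem fourth_moment_implies_joint_convergence:
  fixes n :: "nat \<Rightarrow> nat" and f :: "nat \<Rightarrow> nat \<Rightarrow> (nat \<Rightarrow> real) \<Rightarrow> complex" and c :: "nat \<Rightarrow> nat \<Rightarrow> real"
  defines "W \<equiv> \<lambda>k i. wigner_integral A \<phi> S (n i) (f i k)"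
  assumes I: "finite I" and n: "\<And>i. i \<in> I \<Longrightarrow> 1 \<le> n i"
    and f: "\<And>i k. i \<in> I \<Longrightarrow> f i k \<in> L2 (n i)"
    and m: "\<And>i k. i \<in> I \<Longrightarrow> mirror_symmetric (n i) (f i k)"
    and cov: "\<And>i j. \<lbrakk>i \<in> I; j \<in> I\<rbrakk> \<Longrightarrow> (\<lambda>k. \<phi> (W k i o\<^sub>L W k j)) \<longlonglongrightarrow> of_real (c i j)"
    and four: "\<And>i. i \<in> I \<Longrightarrow> (\<lambda>k. \<phi> (op_pow (W k i) 4)) \<longlonglongrightarrow> of_real (2 * (c i i)\<^sup>2)"
    and w: "set w \<subseteq> I"
  shows "(\<lambda>k. \<phi> (op_prod (map (W k) w))) \<longlonglongrightarrow> vac (\<lambda>i j. of_real (c i j)) (rev w) []"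
proof -
  have WA: "W k i \<in> A" if "i \<in> I" for k i
    unfolding W_def by (rule wigner_integral_A[OF f[OF that]])
  have Wsa: "adj (W k i) = W k i" if "i \<in> I" for k i
    unfolding W_def by (rule ex_self_adjoint_boxes(1)[OF f[OF that] m[OF that] zero_less_one])
  have approx: "\<exists>ts. off_diagonal (n i) ts \<and> adj (box_integral S (n i) ts) = box_integral S (n i) ts \<and>
      norm (W k i - box_integral S (n i) ts) < 1 / real (Suc k)" if "i \<in> I" for k i
    unfolding W_def by (rule ex_self_adjoint_boxes(2)[OF f[OF that] m[OF that]]) simp
  obtain ts where od: "\<And>k i. i \<in> I \<Longrightarrow> off_diagonal (n i) (ts k i)"
    and sa: "\<And>k i. i \<in> I \<Longrightarrow> adj (box_integral S (n i) (ts k i)) = box_integral S (n i) (ts k i)"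
    and near: "\<And>k i. i \<in> I \<Longrightarrow> norm (W k i - box_integral S (n i) (ts k i)) < 1 / real (Suc k)"
  proof -
    define P where "P k i ts \<longleftrightarrow> off_diagonal (n i) ts \<and> adj (box_integral S (n i) ts) = box_integral S (n i) ts \<and>
      norm (W k i - box_integral S (n i) ts) < 1 / real (Suc k)" for k i ts
    have "\<forall>k i. \<exists>ts. i \<in> I \<longrightarrow> P k i ts"
      using approx unfolding P_def by blast
    then obtain ts where "\<forall>k i. i \<in> I \<longrightarrow> P k i (ts k i)"
      unfolding choice_iff by blast
    then show thesis
      unfolding P_def by (intro that[of ts]) blast+
  qed
  \<comment> \<open>For each k one grid serves all i in the finite set \<open>I\<close>, since mixed
    products need a common system.\<close>
  have "\<exists>\<tau> N. grid \<tau> N \<and> (\<Union>i\<in>I. endpoints (n i) (ts k i)) \<subseteq> \<tau> ` {..N}" for k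
    by (rule ex_grid) (use I finite_endpoints endpoints_nonneg od in blast)+
  then obtain \<tau> N where grid: "\<And>k. grid (\<tau> k) (N k)"
    and ends: "\<And>k. (\<Union>i\<in>I. endpoints (n i) (ts k i)) \<subseteq> \<tau> k ` {..N k}" by metis
  define g where "g k i = grid_coeff (n i) (\<tau> k) (N k) (ts k i)" for k i
  define Y where "Y k i = free_semicircular_system.J (incr (\<tau> k)) (N k) (n i) (g k i)" for k i
  have sys: "free_semicircular_system A \<phi> (incr (\<tau> k)) (N k)" for k
    by (rule free_incr[OF grid])
  have hom: "homog (N k) (n i) (g k i)" for k i
    unfolding g_def by (rule homog_grid_coeff)
  have Y_box: "box_integral S (n i) (ts k i) = Y k i" if "i \<in> I" for k i
    unfolding Y_def g_def using ends[of k] that by (intro box_integral_grid[OF grid _ od[OF that]]) blast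
  have YA: "Y k i \<in> A" for k i
    unfolding Y_def by (rule free_semicircular_system.J_A[OF sys])
  have star: "star (g k i) = g k i" if "i \<in> I" for k i
    using sa[OF that, of k] unfolding Y_box[OF that]
    unfolding Y_def by (rule free_semicircular_system.star_eq_of_self_adjoint[OF sys hom])
  have diff: "(\<lambda>k. norm (W k i - Y k i)) \<longlonglongrightarrow> 0" if "i \<in> I" for i
  proof (rule Lim_null_comparison)
    show "(\<lambda>k. 1 / real (Suc k)) \<longlonglongrightarrow> 0"
      using LIMSEQ_inverse_real_of_nat by (simp add: inverse_eq_divide)
    show "\<forall>\<^sub>F k in sequentially. norm (norm (W k i - Y k i)) \<le> 1 / real (Suc k)"
      using near[OF that] Y_box[OF that] by (intro always_eventually allI) (simp add: less_imp_le del: of_nat_Suc)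
  qed
  obtain K where K: "K > 0" "\<And>T. T \<in> A \<Longrightarrow> n2 T \<le> K * norm T" using n2_le_norm by blast
  \<comment> \<open>The Haagerup inequality is at hand on grids only, so \<open>W\<close> is bounded
    by way of \<open>Y\<close>: the 2-norms of \<open>W\<close> are bounded because the variances
    converge, those of \<open>Y\<close> differ from them by at most \<open>K\<close>, and the norm
    of \<open>Y\<close> bounds that of \<open>W\<close> up to 1.\<close>
  have "\<exists>B. \<forall>k. norm (W k i) \<le> B \<and> norm (Y k i) \<le> B" if i: "i \<in> I" for i
  proof -
    have "n2 (W k i) = sqrt (cmod (\<phi> (W k i o\<^sub>L W k i)))" for k
      using state_adj_self[OF WA[OF i], of k] n2_nonneg[OF WA[OF i], of k]
      by (simp add: Wsa[OF i] norm_power)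
    moreover have "(\<lambda>k. sqrt (cmod (\<phi> (W k i o\<^sub>L W k i)))) \<longlonglongrightarrow> sqrt (cmod (of_real (c i i)))"
      by (intro tendsto_real_sqrt tendsto_norm cov i)
    ultimately have "convergent (\<lambda>k. n2 (W k i))" by (auto intro: convergentI)
    then obtain C where C: "\<And>k. norm (n2 (W k i)) \<le> C"
      using convergent_imp_Bseq[of "\<lambda>k. n2 (W k i)"] unfolding Bseq_def by blast
    have near1: "norm (W k i - Y k i) \<le> 1" for k
    proof -
      have "1 / real (Suc k) \<le> 1" by simp
      then show ?thesis using near[OF i, of k] unfolding Y_box[OF i] by linarith
    qed
    have Yb: "norm (Y k i) \<le> (real (n i) + 1) * (C + K)" for k
    proof -
      have "n2 (Y k i) \<le> n2 (W k i) + n2 (Y k i - W k i)"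
        using n2_triangle[OF WA[OF i] A_diff[OF YA WA[OF i]], of k k i k] by simp
      also have "n2 (Y k i - W k i) \<le> K * norm (W k i - Y k i)"
        using K(2)[OF A_diff[OF YA WA[OF i]], of k i k] by (simp add: norm_minus_commute)
      also have "\<dots> \<le> K * 1" using K near1 by (intro mult_left_mono) auto
      finally have "n2 (Y k i) \<le> C + K" using C[of k] by simp
      moreover have "norm (Y k i) \<le> (real (n i) + 1) * n2 (Y k i)"
        unfolding Y_def by (rule free_semicircular_system.norm_J_le[OF sys hom])
      ultimately show ?thesis
        by (meson mult_left_mono order_trans of_nat_0_le_iff add_nonneg_nonneg zero_le_one)
    qed
    have "norm (W k i) \<le> (real (n i) + 1) * (C + K) + 1" for k
      using Yb[of k] near1[of k] norm_triangle_ineq2[of "W k i" "Y k i"] by linarith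
    moreover have "norm (Y k i) \<le> (real (n i) + 1) * (C + K) + 1" for k
      using Yb[of k] by linarith
    ultimately show ?thesis by blast
  qed
  then obtain b where b: "\<And>k i. i \<in> I \<Longrightarrow> norm (W k i) \<le> b i \<and> norm (Y k i) \<le> b i" by metis
  define B where "B = Max (insert 0 (b ` I))"
  have bB: "b i \<le> B" if "i \<in> I" for i
    unfolding B_def using that I by (intro Max_ge) auto
  have WB: "norm (W k i) \<le> B" and YB: "norm (Y k i) \<le> B" if "i \<in> I" for k i
    using b[OF that, of k] bB[OF that] by auto
  have close: "(\<lambda>k. norm (op_prod (map (W k) v) - op_prod (map (Y k) v))) \<longlonglongrightarrow> 0" if "set v \<subseteq> I" for v
    by (rule op_prod_tendsto_diff[where B = B]) (use that diff WB YB in auto)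
  have WAv: "op_prod (map (W k) v) \<in> A" and YAv: "op_prod (map (Y k) v) \<in> A" if "set v \<subseteq> I" for k v
    by (intro A_prod; use that WA YA in \<open>auto simp: subset_iff\<close>)+
  have WY: "(\<lambda>k. \<phi> (op_prod (map (Y k) v))) \<longlonglongrightarrow> l"
    if "set v \<subseteq> I" "(\<lambda>k. \<phi> (op_prod (map (W k) v))) \<longlonglongrightarrow> l" for v l
    using state_tendsto_diff[OF WAv[OF that(1)] YAv[OF that(1)] close[OF that(1)] that(2)] .
  have "(\<lambda>k. \<phi> (op_prod (map (Y k) w))) \<longlonglongrightarrow> vac (\<lambda>i j. of_real (c i j)) (rev w) []"
    unfolding Y_def
  proof (rule discrete_fourth_moment_limit[OF sys, where I = I])
    fix i j assume "i \<in> I" "j \<in> I"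
    then show "(\<lambda>k. \<phi> (free_semicircular_system.J (incr (\<tau> k)) (N k) (n i) (g k i) o\<^sub>L
        free_semicircular_system.J (incr (\<tau> k)) (N k) (n j) (g k j))) \<longlonglongrightarrow> of_real (c i j)"
      using WY[of "[i, j]"] cov by (simp add: Y_def)
  next
    fix i assume i: "i \<in> I"
    have "(\<lambda>k. \<phi> (op_prod (map (Y k) (replicate 4 i)))) \<longlonglongrightarrow> of_real (2 * (c i i)\<^sup>2)"
    proof (rule WY)
      show "(\<lambda>k. \<phi> (op_prod (map (W k) (replicate 4 i)))) \<longlonglongrightarrow> of_real (2 * (c i i)\<^sup>2)"
        using four[OF i] unfolding op_pow_def map_replicate .
    qed (use i in auto)
    then show "(\<lambda>k. \<phi> (op_pow (free_semicircular_system.J (incr (\<tau> k)) (N k) (n i) (g k i)) 4)) \<longlonglongrightarrow>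
        of_real (2 * (c i i)\<^sup>2)"
      unfolding op_pow_def map_replicate Y_def .
  qed (use hom star n w in auto)
  moreover have "(\<lambda>k. norm (op_prod (map (Y k) w) - op_prod (map (W k) w))) \<longlonglongrightarrow> 0"
    using close[OF w] by (simp add: norm_minus_commute)
  ultimately show ?thesis
    by (rule state_tendsto_diff[OF YAv[OF w] WAv[OF w], rotated])
qed

end

theorem theorem1p3:
  fixes A :: "'h::complex_hilbert_space op set" and \<phi> :: "'h op \<Rightarrow> complex"
    and \<A> :: "real \<Rightarrow> 'h op set" and S :: "real \<Rightarrow> 'h op"
    and d :: nat and n :: "nat \<Rightarrow> nat"
    and c :: "nat \<Rightarrow> nat \<Rightarrow> real" and s :: "nat \<Rightarrow> 'h op"
    and f :: "nat \<Rightarrow> nat \<Rightarrow> (nat \<Rightarrow> real) \<Rightarrow> complex"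
  assumes "free_brownian_motion A \<phi> \<A> S"
    and "2 \<le> d"
    and "\<And>i. i \<in> {1..d} \<Longrightarrow> 1 \<le> n i"
    and "symmetric_posdef d c"
    and "semicircular_family A \<phi> d c s"
    and "\<And>i k. i \<in> {1..d} \<Longrightarrow> f i k \<in> L2 (n i)"
    and "\<And>i k. i \<in> {1..d} \<Longrightarrow> mirror_symmetric (n i) (f i k)"
    and "\<And>i j. \<lbrakk>i \<in> {1..d}; j \<in> {1..d}\<rbrakk> \<Longrightarrow>
           (\<lambda>k. \<phi> (wigner_integral A \<phi> S (n i) (f i k) o\<^sub>L
                 wigner_integral A \<phi> S (n j) (f j k)))
              \<longlonglongrightarrow> complex_of_real (c i j)"
  shows "(jointly_converges_in_distribution \<phi> d (\<lambda>k i. wigner_integral A \<phi> S (n i) (f i k)) s \<longleftrightarrow>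
            (\<forall>i\<in>{1..d}. converges_in_distribution \<phi> (\<lambda>k. wigner_integral A \<phi> S (n i) (f i k)) (s i)))
       \<and> ((\<forall>i\<in>{1..d}. converges_in_distribution \<phi> (\<lambda>k. wigner_integral A \<phi> S (n i) (f i k)) (s i)) \<longleftrightarrow>
            (\<forall>i\<in>{1..d}. (\<lambda>k. \<phi> (op_pow (wigner_integral A \<phi> S (n i) (f i k)) 4))
              \<longlonglongrightarrow> complex_of_real (2 * (c i i)\<^sup>2)))"
proof -
  interpret free_brownian_motion A \<phi> \<A> S by (rule assms(1))
  define W where "W k i = wigner_integral A \<phi> S (n i) (f i k)" for k i
  have s_moment: "\<phi> (op_prod (map s w)) = vac (\<lambda>i j. complex_of_real (c i j)) (rev w) []"
    if "w \<noteq> []" "set w \<subseteq> {1..d}" for w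
  proof -
    have "\<phi> (op_prod (map s w)) =
        (\<Sum>\<pi>\<in>NC2 (length w). \<Prod>B\<in>\<pi>. complex_of_real (c (w ! (Min B - 1)) (w ! (Max B - 1))))"
      using assms(5) that unfolding semicircular_family_def by blast
    also have "\<dots> = vac (\<lambda>i j. complex_of_real (c i j)) (rev w) []"
      by (rule sum_NC2_eq_vac)
    finally show ?thesis .
  qed
  let ?joint = "jointly_converges_in_distribution \<phi> d W s"
  let ?single = "\<forall>i\<in>{1..d}. converges_in_distribution \<phi> (\<lambda>k. W k i) (s i)"
  let ?four = "\<forall>i\<in>{1..d}. (\<lambda>k. \<phi> (op_pow (W k i) 4)) \<longlonglongrightarrow> complex_of_real (2 * (c i i)\<^sup>2)"
  have 12: ?single if ?joint
    unfolding converges_in_distribution_def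
  proof (intro ballI allI impI)
    fix i and r :: nat assume i: "i \<in> {1..d}" and r: "1 \<le> r"
    then have "replicate r i \<noteq> []" "set (replicate r i) \<subseteq> {1..d}" by auto
    then have "(\<lambda>k. \<phi> (op_prod (map (W k) (replicate r i)))) \<longlonglongrightarrow> \<phi> (op_prod (map s (replicate r i)))"
      using that unfolding jointly_converges_in_distribution_def by blast
    then show "(\<lambda>k. \<phi> (op_pow (W k i) r)) \<longlonglongrightarrow> \<phi> (op_pow (s i) r)"
      unfolding op_pow_def map_replicate .
  qed
  have 23: ?four if ?single
  proof
    fix i assume i: "i \<in> {1..d}"
    have "op_pow (s i) 4 = op_prod (map s [i, i, i, i])"
      by (simp add: op_pow_def numeral_eq_Suc)
    \<comment> \<open>Four points have two non-crossing pairings, and each has weight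
      \<open>(c i i)\<^sup>2\<close>; evaluating \<open>vac\<close> on the word finds both.\<close>
    then have "\<phi> (op_pow (s i) 4) = complex_of_real (2 * (c i i)\<^sup>2)"
      using s_moment[of "[i, i, i, i]"] i by (simp add: power2_eq_square)
    then show "(\<lambda>k. \<phi> (op_pow (W k i) 4)) \<longlonglongrightarrow> complex_of_real (2 * (c i i)\<^sup>2)"
      using that i unfolding converges_in_distribution_def by (metis one_le_numeral)
  qed
  have 31: ?joint if ?four
    unfolding jointly_converges_in_distribution_def
  proof (intro allI impI)
    fix w assume w: "w \<noteq> [] \<and> set w \<subseteq> {1..d}"
    have "(\<lambda>k. \<phi> (op_prod (map (W k) w))) \<longlonglongrightarrow> vac (\<lambda>i j. complex_of_real (c i j)) (rev w) []"
      unfolding W_def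
      by (rule fourth_moment_implies_joint_convergence[where I = "{1..d}"])
        (use assms(3,6,7,8) that w in \<open>auto simp: W_def\<close>)
    then show "(\<lambda>k. \<phi> (op_prod (map (\<lambda>i. W k i) w))) \<longlonglongrightarrow> \<phi> (op_prod (map s w))"
      using s_moment w by simp
  qed
  have "(?joint \<longleftrightarrow> ?single) \<and> (?single \<longleftrightarrow> ?four)"
    using 12 23 31 by blast
  then show ?thesis unfolding W_def .
qed

end
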